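(* Let $F$ be a number field, $p$ a prime, $T$ a free $\mathbf{Z}_p$-module of finite rank with a continuous $\Omega_F$-action unramified at almost all finite places, and for each $n\ge1$ let $\mathfrak{A}_n$ be an $O_F$-subalgebra of $A_n$ with $\mathfrak{A}_n\otimes_{O_F}F=A_n$ and $q_n(\mathfrak{A}_n)=\mathfrak{A}_{n-1}$. Then for every $n\ge2$ and every $x\in H^1_{\mathfrak{A}_n}(F,G_n)$ we have $p_n(x)\in H^1_{\mathfrak{A}_{n-1}}(F,G_{n-1})$ and $$\phi_{\mathfrak{A}_{n-1}}(p_n(x))=(p_n^D)^*\big(\phi_{\mathfrak{A}_n}(x)\big)\in\mathrm{Cl}(\mathfrak{A}_{n-1}).$$
   Context: $\Gamma_n=p^{-n}T/T$ with its $\Omega_F$-action; $G_n$ the finite étale group scheme over $F$ with $G_n(F^c)=\Gamma_n$; $p_n:H^1(F,G_n)\to H^1(F,G_{n-1})$ is induced by multiplication by $p$, $\Gamma_n\to\Gamma_{n-1}$. $F^c[\Gamma_n]$ is the group algebra with $\Omega_F$ acting on coefficients and on $\Gamma_n$; $A_n=F^c[\Gamma_n]^{\Omega_F}$ (Hopf algebra of the Cartier dual $G_n^*$). $q_n:A_n\to A_{n-1}$ is the restriction of the algebra map $F^c[\Gamma_n]\to F^c[\Gamma_{n-1}]$ induced by $g\mapsto pg$ (it corresponds to the dual $p_n^D:G_{n-1}^*\to G_n^*$ of multiplication by $p$); $(p_n^D)^*:\mathrm{Cl}(\mathfrak{A}_n)\to\mathrm{Cl}(\mathfrak{A}_{n-1})$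 is the map induced by $q_n$ (extension of scalars $M\mapsto\mathfrak{A}_{n-1}\otimes_{\mathfrak{A}_n}M$, equivalently induced by $q_n$ on ideles). For each finite $v$ fix $F_v^c$ and $F^c\hookrightarrow F_v^c$; $\mathfrak{A}_{n,v}=\mathfrak{A}_n\otimes O_{F_v}$, $A_{n,v}=A_n\otimes F_v$. For $R\in\{O_F,F,O_{F_v},F_v\}$ with fraction field $K$, integral closure $R^c$, and $\mathfrak{B}\in\{A_n,\mathfrak{A}_n,A_{n,v},\mathfrak{A}_{n,v}\}$ over $R$: $\mathbf{H}(\mathfrak{B})=\{\alpha\in(\mathfrak{B}\otimes_RR^c)^\times:\alpha^\omega\alpha^{-1}\in\Gamma_n\ \forall\omega\in\Omega_K\}$ and $[\alpha]\in H^1(K,G_n)$ is the class of $\omega\mapsto\alpha^\omega\alpha^{-1}$ (every class is $[\alpha]$ for some $\alpha\in\mathbf{H}(A_n\otimes K)$). $H^1_{\mathfrak{A}_{n,v}}(F_v,G_n)=\{[\beta]:\beta\in\mathbf{H}(\mathfrak{A}_{n,v})\}$; $H^1_{\mathfrak{A}_n}(F,G_n)=\{x:x_v\in H^1_{\mathfrak{A}_{n,v}}(F_v,G_n)\ \forall v\text{ finite}\}$. $\mathfrak{M}_n$ is the maximal $O_F$-order in $A_n$; $J_f(A_n)$ is the restricted product of the $A_{n,v}^\times$ w.r.t. $(\mathfrak{M}_n\otimes O_{F_v})^\times$; $\mathrm{Cl}(\mathfrak{A}_n)=\mathrm{Pic}(\mathrm{Spec}\,\mathfrak{A}_n)\cong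 J_f(A_n)/((\prod_v\mathfrak{A}_{n,v}^\times)A_n^\times)$. For $x\in H^1_{\mathfrak{A}_n}(F,G_n)$ choose $\alpha\in\mathbf{H}(A_n)$ with $[\alpha]=x$ and $\beta_v\in\mathbf{H}(\mathfrak{A}_{n,v})$ with $[\beta_v]=x_v$; $\phi_{\mathfrak{A}_n}(x)$ is the class of $(\beta_v\alpha^{-1})_v$ in $((\prod\Gamma_n)J_f(A_n))/((\prod\Gamma_n)(\prod_v\mathfrak{A}_{n,v}^\times)A_n^\times)\cong\mathrm{Cl}(\mathfrak{A}_n)$, a well-defined homomorphism.
   Formalization: The equation is stated assuming that φ for 𝔄_n and for 𝔄_{n-1} is well defined with values in Cl, which can fail for general subalgebras; without this, the theorem shows that (p_n^D)^* sends every value of φ at x to a value of φ at p_n(x). *)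

theory Defs
  imports "HOL-Algebra.Algebra" "HOL-Analysis.Analysis"
begin

section \<open>Fields, Galois groups and Galois cohomology\<close>

text \<open>
  Throughout, \<open>L\<close> is the ring structure on an algebraic closure of a subfield \<open>K\<close> of \<open>L\<close>.
  Automorphisms are \<open>extensional\<close>, so that each has a single representing function.
\<close>

definition integral_closure :: "'a ring \<Rightarrow> 'a set \<Rightarrow> 'a set" where
  "integral_closure L S = {x \<in> carrier L. \<exists>(d::nat) c. c \<in> {..<d} \<rightarrow> S \<and>
     x [^]\<^bsub>L\<^esub> d \<oplus>\<^bsub>L\<^esub> (\<Oplus>\<^bsub>L\<^esub>i\<in>{..<d}. c i \<otimes>\<^bsub>L\<^esub> x [^]\<^bsub>L\<^esub> i) = \<zero>\<^bsub>L\<^esub>}"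

definition abs_gal :: "'a ring \<Rightarrow> 'a set \<Rightarrow> ('a \<Rightarrow> 'a) set" where
  "abs_gal L K = {\<omega> \<in> ring_iso L L \<inter> extensional (carrier L). \<forall>x\<in>K. \<omega> x = x}"

text \<open>The Krull topology is the topology of pointwise convergence, \<open>L\<close> being discrete.\<close>

definition krull_topology :: "'a ring \<Rightarrow> 'a set \<Rightarrow> ('a \<Rightarrow> 'a) topology" where
  "krull_topology L K = subtopology
     (product_topology (\<lambda>_. discrete_topology (carrier L)) (carrier L)) (abs_gal L K)"

text \<open>
  Cohomology in degree one of \<open>abs_gal L K\<close> with values in a discrete abelian group \<open>G\<close>
  (written multiplicatively) on which \<open>\<omega>\<close> acts by \<open>act \<omega>\<close>.
\<close>

definition cocycles ::
    "'a ring \<Rightarrow> 'a set \<Rightarrow> 'g monoid \<Rightarrow> (('a \<Rightarrow> 'a) \<Rightarrow> 'g \<Rightarrow> 'g) \<Rightarrow> (('a \<Rightarrow> 'a) \<Rightarrow> 'g) monoid" where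
  "cocycles L K G act = \<lparr>
     carrier = {c \<in> abs_gal L K \<rightarrow>\<^sub>E carrier G.
        continuous_map (krull_topology L K) (discrete_topology (carrier G)) c \<and>
        (\<forall>\<omega>\<in>abs_gal L K. \<forall>\<tau>\<in>abs_gal L K.
           c (compose (carrier L) \<omega> \<tau>) = c \<omega> \<otimes>\<^bsub>G\<^esub> act \<omega> (c \<tau>))},
     monoid.mult = (\<lambda>c d. \<lambda>\<omega>\<in>abs_gal L K. c \<omega> \<otimes>\<^bsub>G\<^esub> d \<omega>),
     monoid.one = (\<lambda>\<omega>\<in>abs_gal L K. \<one>\<^bsub>G\<^esub>)\<rparr>"

definition coboundaries ::
    "'a ring \<Rightarrow> 'a set \<Rightarrow> 'g monoid \<Rightarrow> (('a \<Rightarrow> 'a) \<Rightarrow> 'g \<Rightarrow> 'g) \<Rightarrow> (('a \<Rightarrow> 'a) \<Rightarrow> 'g) set" where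
  "coboundaries L K G act =
     (\<lambda>g. \<lambda>\<omega>\<in>abs_gal L K. act \<omega> g \<otimes>\<^bsub>G\<^esub> inv\<^bsub>G\<^esub> g) ` carrier G"

definition H1 ::
    "'a ring \<Rightarrow> 'a set \<Rightarrow> 'g monoid \<Rightarrow> (('a \<Rightarrow> 'a) \<Rightarrow> 'g \<Rightarrow> 'g) \<Rightarrow> (('a \<Rightarrow> 'a) \<Rightarrow> 'g) set monoid" where
  "H1 L K G act = cocycles L K G act Mod coboundaries L K G act"


section \<open>Group algebras and resolvent sets\<close>

definition grp_alg :: "'a ring \<Rightarrow> 'g monoid \<Rightarrow> ('g \<Rightarrow> 'a) ring" where
  "grp_alg L G = \<lparr>
     carrier = carrier G \<rightarrow>\<^sub>E carrier L,
     monoid.mult = (\<lambda>a b. \<lambda>g\<in>carrier G. \<Oplus>\<^bsub>L\<^esub>h\<in>carrier G. a h \<otimes>\<^bsub>L\<^esub> b (inv\<^bsub>G\<^esub> h \<otimes>\<^bsub>G\<^esub> g)),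
     monoid.one = (\<lambda>g\<in>carrier G. if g = \<one>\<^bsub>G\<^esub> then \<one>\<^bsub>L\<^esub> else \<zero>\<^bsub>L\<^esub>),
     ring.zero = (\<lambda>g\<in>carrier G. \<zero>\<^bsub>L\<^esub>),
     ring.add = (\<lambda>a b. \<lambda>g\<in>carrier G. a g \<oplus>\<^bsub>L\<^esub> b g)\<rparr>"

definition grp_elem :: "'a ring \<Rightarrow> 'g monoid \<Rightarrow> 'g \<Rightarrow> ('g \<Rightarrow> 'a)" where
  "grp_elem L G g = (\<lambda>h\<in>carrier G. if h = g then \<one>\<^bsub>L\<^esub> else \<zero>\<^bsub>L\<^esub>)"

definition scal :: "'a ring \<Rightarrow> 'g monoid \<Rightarrow> 'a \<Rightarrow> ('g \<Rightarrow> 'a) \<Rightarrow> ('g \<Rightarrow> 'a)" where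
  "scal L G r a = (\<lambda>g\<in>carrier G. r \<otimes>\<^bsub>L\<^esub> a g)"

text \<open>
  The semilinear action: \<open>\<omega>\<close> sends the sum of the \<open>a(g) g\<close> to the sum of the
  \<open>\<omega>(a(g)) (\<omega> g)\<close>.
\<close>

definition alg_act ::
    "'a ring \<Rightarrow> 'g monoid \<Rightarrow> (('a \<Rightarrow> 'a) \<Rightarrow> 'g \<Rightarrow> 'g) \<Rightarrow> ('a \<Rightarrow> 'a) \<Rightarrow> ('g \<Rightarrow> 'a) \<Rightarrow> ('g \<Rightarrow> 'a)" where
  "alg_act L G act \<omega> a = (\<lambda>h\<in>carrier G. \<omega> (a (inv_into (carrier G) (act \<omega>) h)))"

text \<open>
  All scalar extensions are formed inside a group algebra over an algebraically closed field:
  the additive group generated by the products \<open>r b\<close>, for \<open>r\<close> in a ring \<open>R\<close> of scalars, stands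
  for \<open>B \<otimes> R\<close>. For the algebras \<open>B\<close> below, lying in \<open>An D n\<close> or in its completions, the natural
  map from the tensor product is injective with this image: an \<open>F\<close>-basis of the invariants is a
  basis of the group algebra over the algebraic closure, and all scalar extensions are flat.
\<close>

definition span_over :: "'a ring \<Rightarrow> 'g monoid \<Rightarrow> 'a set \<Rightarrow> ('g \<Rightarrow> 'a) set \<Rightarrow> ('g \<Rightarrow> 'a) set" where
  "span_over L G R B =
     generate (add_monoid (grp_alg L G)) {scal L G r b | r b. r \<in> R \<and> b \<in> B}"

definition sub_units :: "'a ring \<Rightarrow> 'g monoid \<Rightarrow> ('g \<Rightarrow> 'a) set \<Rightarrow> ('g \<Rightarrow> 'a) set" where
  "sub_units L G B = Units ((grp_alg L G)\<lparr>carrier := B\<rparr>)"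

text \<open>The set \<open>\<^bold>H(B)\<close> for an algebra \<open>B\<close> over the ring \<open>R\<close> with fraction field \<open>K\<close>, and the class
  \<open>[\<alpha>]\<close> of its elements.\<close>

definition HH :: "'a ring \<Rightarrow> 'a set \<Rightarrow> 'g monoid \<Rightarrow> (('a \<Rightarrow> 'a) \<Rightarrow> 'g \<Rightarrow> 'g) \<Rightarrow>
    'a set \<Rightarrow> ('g \<Rightarrow> 'a) set \<Rightarrow> ('g \<Rightarrow> 'a) set" where
  "HH L K G act R B = {\<alpha> \<in> sub_units L G (span_over L G (integral_closure L R) B).
     \<forall>\<omega>\<in>abs_gal L K.
       alg_act L G act \<omega> \<alpha> \<otimes>\<^bsub>grp_alg L G\<^esub> inv\<^bsub>grp_alg L G\<^esub> \<alpha> \<in> grp_elem L G ` carrier G}"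

definition cls :: "'a ring \<Rightarrow> 'a set \<Rightarrow> 'g monoid \<Rightarrow> (('a \<Rightarrow> 'a) \<Rightarrow> 'g \<Rightarrow> 'g) \<Rightarrow>
    ('g \<Rightarrow> 'a) \<Rightarrow> (('a \<Rightarrow> 'a) \<Rightarrow> 'g) set" where
  "cls L K G act \<alpha> = coboundaries L K G act #>\<^bsub>cocycles L K G act\<^esub>
     (\<lambda>\<omega>\<in>abs_gal L K. THE \<gamma>. \<gamma> \<in> carrier G \<and>
        grp_elem L G \<gamma> = alg_act L G act \<omega> \<alpha> \<otimes>\<^bsub>grp_alg L G\<^esub> inv\<^bsub>grp_alg L G\<^esub> \<alpha>)"


section \<open>The \<open>p\<close>-adic integers, free modules and the group \<open>p^{-n}T/T\<close>\<close>

text \<open>An element is the compatible sequence of its residues modulo \<open>p^n\<close>.\<close>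

definition padic_int :: "nat \<Rightarrow> (nat \<Rightarrow> int) ring" where
  "padic_int p = \<lparr>
     carrier = {x. \<forall>n. x n \<in> {0..<int p ^ n} \<and> x (Suc n) mod int p ^ n = x n},
     monoid.mult = (\<lambda>x y n. (x n * y n) mod int p ^ n),
     monoid.one = (\<lambda>n. 1 mod int p ^ n),
     ring.zero = (\<lambda>n. 0),
     ring.add = (\<lambda>x y n. (x n + y n) mod int p ^ n)\<rparr>"

definition free_of_finite_rank :: "'r ring \<Rightarrow> ('r, 't) module \<Rightarrow> bool" where
  "free_of_finite_rank R M \<longleftrightarrow> (\<exists>B. finite B \<and> B \<subseteq> carrier M \<and>
     (\<forall>m\<in>carrier M. \<exists>!c. c \<in> B \<rightarrow>\<^sub>E carrier R \<and> m = (\<Oplus>\<^bsub>M\<^esub>b\<in>B. c b \<odot>\<^bsub>M\<^esub> b)))"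

definition p_multiples :: "nat \<Rightarrow> (nat \<Rightarrow> int, 't) module \<Rightarrow> nat \<Rightarrow> 't set" where
  "p_multiples p T n = (\<lambda>t. add_pow T (p ^ n) t) ` carrier T"

definition padic_topology :: "nat \<Rightarrow> (nat \<Rightarrow> int, 't) module \<Rightarrow> 't topology" where
  "padic_topology p T = topology (\<lambda>U. U \<subseteq> carrier T \<and>
     (\<forall>t\<in>U. \<exists>n. \<forall>s\<in>p_multiples p T n. t \<oplus>\<^bsub>T\<^esub> s \<in> U))"

text \<open>
  A pair \<open>(k, s)\<close> stands for the element \<open>p^{-k}s\<close> of \<open>T[1/p]\<close>, which is \<open>T \<otimes> \<rat>\<^sub>p\<close>.
  \<open>pfrac p T n t\<close> is the coset of \<open>p^{-n}t\<close> modulo \<open>T\<close>, that is, the set of all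
  pairs \<open>(k, s)\<close> with \<open>p^{-n}t - p^{-k}s \<in> T\<close>. In this way the group \<open>p^{-m}T/T\<close> is literally
  a subset of \<open>p^{-n}T/T\<close> for \<open>m \<le> n\<close>.
\<close>

definition pfrac :: "nat \<Rightarrow> (nat \<Rightarrow> int, 't) module \<Rightarrow> nat \<Rightarrow> 't \<Rightarrow> (nat \<times> 't) set" where
  "pfrac p T n t = {(k, s). s \<in> carrier T \<and>
     add_pow T (p ^ k) t \<ominus>\<^bsub>T\<^esub> add_pow T (p ^ n) s \<in> p_multiples p T (n + k)}"

definition pdiv_group :: "nat \<Rightarrow> (nat \<Rightarrow> int, 't) module \<Rightarrow> nat \<Rightarrow> (nat \<times> 't) set monoid" where
  "pdiv_group p T n = \<lparr>
     carrier = pfrac p T n ` carrier T,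
     monoid.mult = (\<lambda>x y. \<Union>(k, s)\<in>x. \<Union>(l, t)\<in>y.
               pfrac p T (k + l) (add_pow T (p ^ l) s \<oplus>\<^bsub>T\<^esub> add_pow T (p ^ k) t)),
     monoid.one = pfrac p T n \<zero>\<^bsub>T\<^esub>\<rparr>"


section \<open>Number fields, places and completions\<close>

definition int_ring :: "'a ring \<Rightarrow> 'a set" where
  "int_ring L = range (\<lambda>k::int. add_pow L k \<one>\<^bsub>L\<^esub>)"

definition char_zero :: "'a ring \<Rightarrow> bool" where
  "char_zero L \<longleftrightarrow> (\<forall>k::nat. k > 0 \<longrightarrow> add_pow L k \<one>\<^bsub>L\<^esub> \<noteq> \<zero>\<^bsub>L\<^esub>)"

text \<open>\<open>generate_field L {}\<close> is the prime field, i.e. the rationals.\<close>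

definition number_field :: "'a ring \<Rightarrow> 'a set \<Rightarrow> bool" where
  "number_field L F \<longleftrightarrow> field L \<and> char_zero L \<and> subfield F L \<and>
     ring.finite_dimension L (generate_field L {}) F"

definition ring_of_integers :: "'a ring \<Rightarrow> 'a set \<Rightarrow> 'a set" where
  "ring_of_integers L F = integral_closure L (int_ring L) \<inter> F"

definition finite_places :: "'a ring \<Rightarrow> 'a set \<Rightarrow> 'a set set" where
  "finite_places L F =
     {P. primeideal P (L\<lparr>carrier := ring_of_integers L F\<rparr>) \<and> P \<noteq> {\<zero>\<^bsub>L\<^esub>}}"

definition ideal_power :: "'a ring \<Rightarrow> 'a set \<Rightarrow> nat \<Rightarrow> 'a set" where
  "ideal_power R P k = ((\<lambda>I. ideal_prod R P I) ^^ k) (carrier R)"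

definition ord_at :: "'a ring \<Rightarrow> 'a set \<Rightarrow> 'a set \<Rightarrow> 'a \<Rightarrow> nat" where
  "ord_at L F P a =
     (GREATEST k. a \<in> ideal_power (L\<lparr>carrier := ring_of_integers L F\<rparr>) P k)"

text \<open>
  The subfield \<open>K\<close> of \<open>M\<close>, with the absolute value \<open>nv\<close>, is the completion of \<open>F\<close> at \<open>P\<close> by
  means of \<open>\<iota>\<close>, where \<open>\<iota>\<close> embeds the algebraic closure \<open>L\<close> of \<open>F\<close> in an algebraic closure \<open>M\<close>
  of \<open>K\<close>. Only the values of \<open>nv\<close> on \<open>K\<close> matter.
\<close>

definition is_completion :: "'a ring \<Rightarrow> 'a set \<Rightarrow> 'a set \<Rightarrow>
    'l ring \<Rightarrow> 'l set \<Rightarrow> ('a \<Rightarrow> 'l) \<Rightarrow> ('l \<Rightarrow> real) \<Rightarrow> bool" where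
  "is_completion L F P M K \<iota> nv \<longleftrightarrow>
     algebraic_closure M K \<and> \<iota> \<in> ring_hom L M \<and> \<iota> ` F \<subseteq> K \<and>
     (\<forall>x\<in>K. nv x \<ge> 0 \<and> (nv x = 0 \<longleftrightarrow> x = \<zero>\<^bsub>M\<^esub>)) \<and>
     (\<forall>x\<in>K. \<forall>y\<in>K. nv (x \<otimes>\<^bsub>M\<^esub> y) = nv x * nv y \<and> nv (x \<oplus>\<^bsub>M\<^esub> y) \<le> max (nv x) (nv y)) \<and>
     (\<forall>a\<in>ring_of_integers L F. a \<noteq> \<zero>\<^bsub>L\<^esub> \<longrightarrow> nv (\<iota> a) = exp (- real (ord_at L F P a))) \<and>
     (\<forall>x\<in>K. \<forall>\<epsilon>>0. \<exists>a\<in>F. nv (x \<ominus>\<^bsub>M\<^esub> \<iota> a) < \<epsilon>) \<and>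
     (\<forall>s :: nat \<Rightarrow> 'l. range s \<subseteq> K \<longrightarrow>
        (\<forall>\<epsilon>>0. \<exists>N. \<forall>i\<ge>N. \<forall>j\<ge>N. nv (s i \<ominus>\<^bsub>M\<^esub> s j) < \<epsilon>) \<longrightarrow>
        (\<exists>x\<in>K. \<forall>\<epsilon>>0. \<exists>N. \<forall>i\<ge>N. nv (s i \<ominus>\<^bsub>M\<^esub> x) < \<epsilon>))"


section \<open>The arithmetic data\<close>

record ('c, 'l, 't) galois_data =
  clos :: "'c ring"                          \<comment> \<open>the algebraic closure of \<open>F\<close>\<close>
  base :: "'c set"                           \<comment> \<open>the number field \<open>F\<close>\<close>
  lclos :: "'c set \<Rightarrow> 'l ring"                \<comment> \<open>algebraic closures of the completions of \<open>F\<close>\<close>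
  lfield :: "'c set \<Rightarrow> 'l set"                \<comment> \<open>the completions of \<open>F\<close>\<close>
  lemb :: "'c set \<Rightarrow> 'c \<Rightarrow> 'l"                 \<comment> \<open>the chosen embeddings of algebraic closures\<close>
  labs :: "'c set \<Rightarrow> 'l \<Rightarrow> real"              \<comment> \<open>absolute values on the completions\<close>
  prm :: nat                                 \<comment> \<open>the prime \<open>p\<close>\<close>
  lat :: "(nat \<Rightarrow> int, 't) module"           \<comment> \<open>the module \<open>T\<close>\<close>
  rho :: "('c \<Rightarrow> 'c) \<Rightarrow> 't \<Rightarrow> 't"             \<comment> \<open>the action on \<open>T\<close>\<close>

type_synonym 't gam = "(nat \<times> 't) set"

definition plc :: "('c, 'l, 't) galois_data \<Rightarrow> 'c set set" where
  "plc D = finite_places (clos D) (base D)"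

definition OFint :: "('c, 'l, 't) galois_data \<Rightarrow> 'c set" where
  "OFint D = ring_of_integers (clos D) (base D)"

definition Ov :: "('c, 'l, 't) galois_data \<Rightarrow> 'c set \<Rightarrow> 'l set" where
  "Ov D v = {x \<in> lfield D v. labs D v x \<le> 1}"

definition \<Omega>F :: "('c, 'l, 't) galois_data \<Rightarrow> ('c \<Rightarrow> 'c) set" where
  "\<Omega>F D = abs_gal (clos D) (base D)"

definition \<Omega>v :: "('c, 'l, 't) galois_data \<Rightarrow> 'c set \<Rightarrow> ('l \<Rightarrow> 'l) set" where
  "\<Omega>v D v = abs_gal (lclos D v) (lfield D v)"

text \<open>The homomorphism from \<open>\<Omega>v D v\<close> to \<open>\<Omega>F D\<close> determined by the embedding at \<open>v\<close>.\<close>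

definition gal_res :: "('c, 'l, 't) galois_data \<Rightarrow> 'c set \<Rightarrow> ('l \<Rightarrow> 'l) \<Rightarrow> ('c \<Rightarrow> 'c)" where
  "gal_res D v \<omega> =
     (\<lambda>x\<in>carrier (clos D). inv_into (carrier (clos D)) (lemb D v) (\<omega> (lemb D v x)))"

text \<open>Inertia: trivial action on the residue field of the local ring of integers of \<open>lclos D v\<close>.\<close>

definition inertia :: "('c, 'l, 't) galois_data \<Rightarrow> 'c set \<Rightarrow> ('l \<Rightarrow> 'l) set" where
  "inertia D v = {\<omega> \<in> \<Omega>v D v. \<forall>x\<in>integral_closure (lclos D v) (Ov D v).
     \<omega> x \<ominus>\<^bsub>lclos D v\<^esub> x \<notin> Units ((lclos D v)\<lparr>carrier := integral_closure (lclos D v) (Ov D v)\<rparr>)}"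

definition galois_setting :: "('c, 'l, 't) galois_data \<Rightarrow> bool" where
  "galois_setting D \<longleftrightarrow>
     number_field (clos D) (base D) \<and> algebraic_closure (clos D) (base D) \<and>
     (\<forall>v\<in>plc D. is_completion (clos D) (base D) v
                  (lclos D v) (lfield D v) (lemb D v) (labs D v)) \<and>
     Factorial_Ring.prime (prm D) \<and>
     module (padic_int (prm D)) (lat D) \<and> free_of_finite_rank (padic_int (prm D)) (lat D) \<and>
     (\<forall>\<omega>\<in>\<Omega>F D. \<forall>t\<in>carrier (lat D). rho D \<omega> t \<in> carrier (lat D) \<and>
        (\<forall>s\<in>carrier (lat D). rho D \<omega> (s \<oplus>\<^bsub>lat D\<^esub> t) = rho D \<omega> s \<oplus>\<^bsub>lat D\<^esub> rho D \<omega> t) \<and>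
        (\<forall>z\<in>carrier (padic_int (prm D)). rho D \<omega> (z \<odot>\<^bsub>lat D\<^esub> t) = z \<odot>\<^bsub>lat D\<^esub> rho D \<omega> t)) \<and>
     (\<forall>t\<in>carrier (lat D). rho D (\<lambda>x\<in>carrier (clos D). x) t = t) \<and>
     (\<forall>\<omega>\<in>\<Omega>F D. \<forall>\<tau>\<in>\<Omega>F D. \<forall>t\<in>carrier (lat D).
        rho D (compose (carrier (clos D)) \<omega> \<tau>) t = rho D \<omega> (rho D \<tau> t)) \<and>
     continuous_map
       (prod_topology (krull_topology (clos D) (base D)) (padic_topology (prm D) (lat D)))
       (padic_topology (prm D) (lat D)) (\<lambda>(\<omega>, t). rho D \<omega> t) \<and>
     finite {v \<in> plc D. \<exists>\<omega>\<in>inertia D v. \<exists>t\<in>carrier (lat D). rho D (gal_res D v \<omega>) t \<noteq> t}"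


section \<open>The group schemes \<open>G\<^sub>n\<close> and their cohomology\<close>

text \<open>A finite etale group scheme is given by its Galois module of geometric points, and its
  cohomology is that of the module.\<close>

definition Gam :: "('c, 'l, 't) galois_data \<Rightarrow> nat \<Rightarrow> 't gam monoid" where
  "Gam D n = pdiv_group (prm D) (lat D) n"

definition act :: "('c, 'l, 't) galois_data \<Rightarrow> ('c \<Rightarrow> 'c) \<Rightarrow> 't gam \<Rightarrow> 't gam" where
  "act D \<omega> x = (\<lambda>(k, s). (k, rho D \<omega> s)) ` x"

definition lact :: "('c, 'l, 't) galois_data \<Rightarrow> 'c set \<Rightarrow> ('l \<Rightarrow> 'l) \<Rightarrow> 't gam \<Rightarrow> 't gam" where
  "lact D v \<omega> = act D (gal_res D v \<omega>)"

definition H1F :: "('c, 'l, 't) galois_data \<Rightarrow> nat \<Rightarrow> (('c \<Rightarrow> 'c) \<Rightarrow> 't gam) set monoid" where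
  "H1F D n = H1 (clos D) (base D) (Gam D n) (act D)"

text \<open>Maps on cohomology are given on cosets: the image of a coset of cocycles is multiplied by
  the coboundaries of the target.\<close>

definition localize ::
    "('c, 'l, 't) galois_data \<Rightarrow> nat \<Rightarrow> 'c set \<Rightarrow> (('c \<Rightarrow> 'c) \<Rightarrow> 't gam) set \<Rightarrow>
      (('l \<Rightarrow> 'l) \<Rightarrow> 't gam) set" where
  "localize D n v x =
     coboundaries (lclos D v) (lfield D v) (Gam D n) (lact D v)
       <#>\<^bsub>cocycles (lclos D v) (lfield D v) (Gam D n) (lact D v)\<^esub>
     ((\<lambda>c. \<lambda>\<omega>\<in>\<Omega>v D v. c (gal_res D v \<omega>)) ` x)"

definition p_map ::
    "('c, 'l, 't) galois_data \<Rightarrow> nat \<Rightarrow> (('c \<Rightarrow> 'c) \<Rightarrow> 't gam) set \<Rightarrow> (('c \<Rightarrow> 'c) \<Rightarrow> 't gam) set" where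
  "p_map D n x =
     coboundaries (clos D) (base D) (Gam D (n - 1)) (act D)
       <#>\<^bsub>cocycles (clos D) (base D) (Gam D (n - 1)) (act D)\<^esub>
     ((\<lambda>c. \<lambda>\<omega>\<in>\<Omega>F D. c \<omega> [^]\<^bsub>Gam D n\<^esub> prm D) ` x)"


section \<open>The algebras \<open>A\<^sub>n\<close>, their orders, and the maps \<open>q\<^sub>n\<close>\<close>

definition An :: "('c, 'l, 't) galois_data \<Rightarrow> nat \<Rightarrow> ('t gam \<Rightarrow> 'c) set" where
  "An D n = {a \<in> carrier (grp_alg (clos D) (Gam D n)).
     \<forall>\<omega>\<in>\<Omega>F D. alg_act (clos D) (Gam D n) (act D) \<omega> a = a}"

text \<open>An \<open>O\<^sub>F\<close>-subalgebra of \<open>A\<^sub>n\<close> that spans it over \<open>F\<close>.\<close>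

definition full_subalgebra :: "('c, 'l, 't) galois_data \<Rightarrow> nat \<Rightarrow> ('t gam \<Rightarrow> 'c) set \<Rightarrow> bool" where
  "full_subalgebra D n B \<longleftrightarrow>
     subring B (grp_alg (clos D) (Gam D n)) \<and> B \<subseteq> An D n \<and>
     (\<forall>r\<in>OFint D. \<forall>b\<in>B. scal (clos D) (Gam D n) r b \<in> B) \<and>
     span_over (clos D) (Gam D n) (base D) B = An D n"

definition is_order :: "('c, 'l, 't) galois_data \<Rightarrow> nat \<Rightarrow> ('t gam \<Rightarrow> 'c) set \<Rightarrow> bool" where
  "is_order D n B \<longleftrightarrow> full_subalgebra D n B \<and>
     (\<exists>S. finite S \<and> S \<subseteq> B \<and> B = span_over (clos D) (Gam D n) (OFint D) S)"

text \<open>\<open>A\<^sub>n\<close> is commutative and separable, so it has a largest order.\<close>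

definition max_order :: "('c, 'l, 't) galois_data \<Rightarrow> nat \<Rightarrow> ('t gam \<Rightarrow> 'c) set" where
  "max_order D n = \<Union>{B. is_order D n B}"

text \<open>The map of group algebras over \<open>L\<close> induced by \<open>g \<mapsto> pg\<close>.\<close>

definition q_map ::
    "('c, 'l, 't) galois_data \<Rightarrow> 'a ring \<Rightarrow> nat \<Rightarrow> ('t gam \<Rightarrow> 'a) \<Rightarrow> ('t gam \<Rightarrow> 'a)" where
  "q_map D L n a = (\<lambda>h\<in>carrier (Gam D (n - 1)).
     \<Oplus>\<^bsub>L\<^esub>g\<in>{g \<in> carrier (Gam D n). g [^]\<^bsub>Gam D n\<^esub> prm D = h}. a g)"

definition to_local ::
    "('c, 'l, 't) galois_data \<Rightarrow> nat \<Rightarrow> 'c set \<Rightarrow> ('t gam \<Rightarrow> 'c) \<Rightarrow> ('t gam \<Rightarrow> 'l)" where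
  "to_local D n v a = (\<lambda>g\<in>carrier (Gam D n). lemb D v (a g))"

text \<open>\<open>loc_ext D n v R B\<close> is \<open>B \<otimes> R\<close>, where \<open>R\<close> is \<open>Ov D v\<close> or \<open>lfield D v\<close>.\<close>

definition loc_ext ::
    "('c, 'l, 't) galois_data \<Rightarrow> nat \<Rightarrow> 'c set \<Rightarrow> 'l set \<Rightarrow> ('t gam \<Rightarrow> 'c) set \<Rightarrow> ('t gam \<Rightarrow> 'l) set" where
  "loc_ext D n v R B = span_over (lclos D v) (Gam D n) R (to_local D n v ` B)"


section \<open>The groups \<open>H\<^sup>1\<close> attached to \<open>\<AA>\<^sub>n\<close>\<close>

definition HH_glob :: "('c, 'l, 't) galois_data \<Rightarrow> nat \<Rightarrow> ('t gam \<Rightarrow> 'c) set" where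
  "HH_glob D n = HH (clos D) (base D) (Gam D n) (act D) (base D) (An D n)"

definition HH_loc ::
    "('c, 'l, 't) galois_data \<Rightarrow> nat \<Rightarrow> ('t gam \<Rightarrow> 'c) set \<Rightarrow> 'c set \<Rightarrow> ('t gam \<Rightarrow> 'l) set" where
  "HH_loc D n \<AA> v =
     HH (lclos D v) (lfield D v) (Gam D n) (lact D v) (Ov D v) (loc_ext D n v (Ov D v) \<AA>)"

definition cls_glob ::
    "('c, 'l, 't) galois_data \<Rightarrow> nat \<Rightarrow> ('t gam \<Rightarrow> 'c) \<Rightarrow> (('c \<Rightarrow> 'c) \<Rightarrow> 't gam) set" where
  "cls_glob D n \<alpha> = cls (clos D) (base D) (Gam D n) (act D) \<alpha>"

definition cls_loc ::
    "('c, 'l, 't) galois_data \<Rightarrow> nat \<Rightarrow> 'c set \<Rightarrow> ('t gam \<Rightarrow> 'l) \<Rightarrow> (('l \<Rightarrow> 'l) \<Rightarrow> 't gam) set" where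
  "cls_loc D n v \<beta> = cls (lclos D v) (lfield D v) (Gam D n) (lact D v) \<beta>"

definition H1_order ::
    "('c, 'l, 't) galois_data \<Rightarrow> nat \<Rightarrow> ('t gam \<Rightarrow> 'c) set \<Rightarrow> (('c \<Rightarrow> 'c) \<Rightarrow> 't gam) set set" where
  "H1_order D n \<AA> =
     {x \<in> carrier (H1F D n). \<forall>v\<in>plc D. localize D n v x \<in> cls_loc D n v ` HH_loc D n \<AA> v}"


section \<open>Ideles, class groups and the map \<open>\<phi>\<close>\<close>

text \<open>The product over all finite places of the units of the group algebras over \<open>lclos D v\<close>
  contains the finite ideles, the components of \<open>\<phi>\<close>, and the product of the groups \<open>\<Gamma>\<^sub>n\<close>.\<close>

definition big_group :: "('c, 'l, 't) galois_data \<Rightarrow> nat \<Rightarrow> ('c set \<Rightarrow> 't gam \<Rightarrow> 'l) monoid" where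
  "big_group D n = product_group (plc D) (\<lambda>v. units_of (grp_alg (lclos D v) (Gam D n)))"

definition loc_units ::
    "('c, 'l, 't) galois_data \<Rightarrow> nat \<Rightarrow> 'c set \<Rightarrow> 'l set \<Rightarrow> ('t gam \<Rightarrow> 'c) set \<Rightarrow> ('t gam \<Rightarrow> 'l) set" where
  "loc_units D n v R B = sub_units (lclos D v) (Gam D n) (loc_ext D n v R B)"

definition finite_ideles :: "('c, 'l, 't) galois_data \<Rightarrow> nat \<Rightarrow> ('c set \<Rightarrow> 't gam \<Rightarrow> 'l) set" where
  "finite_ideles D n = {c \<in> (\<Pi>\<^sub>E v\<in>plc D. loc_units D n v (lfield D v) (An D n)).
     finite {v \<in> plc D. c v \<notin> loc_units D n v (Ov D v) (max_order D n)}}"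

definition diag :: "('c, 'l, 't) galois_data \<Rightarrow> nat \<Rightarrow> ('t gam \<Rightarrow> 'c) \<Rightarrow> ('c set \<Rightarrow> 't gam \<Rightarrow> 'l)" where
  "diag D n a = (\<lambda>v\<in>plc D. to_local D n v a)"

definition idele_kernel ::
    "('c, 'l, 't) galois_data \<Rightarrow> nat \<Rightarrow> ('t gam \<Rightarrow> 'c) set \<Rightarrow> ('c set \<Rightarrow> 't gam \<Rightarrow> 'l) set" where
  "idele_kernel D n \<AA> =
     (\<Pi>\<^sub>E v\<in>plc D. loc_units D n v (Ov D v) \<AA>)
       <#>\<^bsub>big_group D n\<^esub> (diag D n ` sub_units (clos D) (Gam D n) (An D n))"

definition Cl :: "('c, 'l, 't) galois_data \<Rightarrow> nat \<Rightarrow> ('t gam \<Rightarrow> 'c) set \<Rightarrow>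
    ('c set \<Rightarrow> 't gam \<Rightarrow> 'l) set monoid" where
  "Cl D n \<AA> = (big_group D n)\<lparr>carrier := finite_ideles D n\<rparr> Mod idele_kernel D n \<AA>"

definition gam_prod :: "('c, 'l, 't) galois_data \<Rightarrow> nat \<Rightarrow> ('c set \<Rightarrow> 't gam \<Rightarrow> 'l) set" where
  "gam_prod D n = (\<Pi>\<^sub>E v\<in>plc D. grp_elem (lclos D v) (Gam D n) ` carrier (Gam D n))"

text \<open>
  \<open>is_phi D n \<AA> x C\<close>: for some choice of \<open>\<alpha>\<close> and of the \<open>\<beta>\<^sub>v\<close>, the natural map from
  \<open>Cl D n \<AA>\<close> to the quotient by the product of \<open>gam_prod\<close> and \<open>idele_kernel\<close> sends \<open>C\<close> to the
  class of the family of the \<open>\<beta>\<^sub>v \<alpha>\<^sup>-\<^sup>1\<close>. This is the graph of \<open>\<phi>\<close>; for an arbitrary \<open>\<AA>\<close> that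
  natural map need not be injective, so that several \<open>C\<close> may be related to the same \<open>x\<close>.
\<close>

definition is_phi :: "('c, 'l, 't) galois_data \<Rightarrow> nat \<Rightarrow> ('t gam \<Rightarrow> 'c) set \<Rightarrow>
    (('c \<Rightarrow> 'c) \<Rightarrow> 't gam) set \<Rightarrow> ('c set \<Rightarrow> 't gam \<Rightarrow> 'l) set \<Rightarrow> bool" where
  "is_phi D n \<AA> x C \<longleftrightarrow> C \<in> carrier (Cl D n \<AA>) \<and>
     (\<exists>\<alpha>\<in>HH_glob D n. \<exists>\<beta>\<in>(\<Pi>\<^sub>E v\<in>plc D. HH_loc D n \<AA> v).
        cls_glob D n \<alpha> = x \<and> (\<forall>v\<in>plc D. cls_loc D n v (\<beta> v) = localize D n v x) \<and>
        gam_prod D n <#>\<^bsub>big_group D n\<^esub> C =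
          (gam_prod D n <#>\<^bsub>big_group D n\<^esub> idele_kernel D n \<AA>)
            #>\<^bsub>big_group D n\<^esub> (\<beta> \<otimes>\<^bsub>big_group D n\<^esub> inv\<^bsub>big_group D n\<^esub> (diag D n \<alpha>)))"

definition phi_well_defined :: "('c, 'l, 't) galois_data \<Rightarrow> nat \<Rightarrow> ('t gam \<Rightarrow> 'c) set \<Rightarrow> bool" where
  "phi_well_defined D n \<AA> \<longleftrightarrow> (\<forall>x\<in>H1_order D n \<AA>. \<exists>!C. is_phi D n \<AA> x C)"

definition phi :: "('c, 'l, 't) galois_data \<Rightarrow> nat \<Rightarrow> ('t gam \<Rightarrow> 'c) set \<Rightarrow>
    (('c \<Rightarrow> 'c) \<Rightarrow> 't gam) set \<Rightarrow> ('c set \<Rightarrow> 't gam \<Rightarrow> 'l) set" where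
  "phi D n \<AA> x = (THE C. is_phi D n \<AA> x C)"

text \<open>The map of class groups from level \<open>n\<close> to level \<open>n - 1\<close> that \<open>q\<^sub>n\<close> induces on ideles,
  \<open>\<BB>\<close> being the algebra at level \<open>n - 1\<close>: the coset of \<open>c\<close> goes to the coset of \<open>q\<^sub>n(c)\<close>.\<close>

definition pD_map :: "('c, 'l, 't) galois_data \<Rightarrow> nat \<Rightarrow> ('t gam \<Rightarrow> 'c) set \<Rightarrow>
    ('c set \<Rightarrow> 't gam \<Rightarrow> 'l) set \<Rightarrow> ('c set \<Rightarrow> 't gam \<Rightarrow> 'l) set" where
  "pD_map D n \<BB> C = idele_kernel D (n - 1) \<BB> <#>\<^bsub>big_group D (n - 1)\<^esub>
     ((\<lambda>c. \<lambda>v\<in>plc D. q_map D (lclos D v) n (c v)) ` C)"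

end

theory Submission
  imports Defs
begin

text \<open>
  Multiplication by \<open>p\<close> is a Galois-equivariant homomorphism \<open>f\<close> from the group at level \<open>n\<close> to the
  group at level \<open>n - 1\<close>, and \<open>q\<^sub>n\<close> is the push-forward of coefficients along \<open>f\<close>. The push-forward is
  a ring homomorphism that commutes with scalar extension and with the semilinear Galois action (which
  is itself a push-forward composed with a map of coefficients), and it sends the group element \<open>g\<close>
  to \<open>f g\<close>. Hence if \<open>\<alpha>\<close> is a resolvent with cocycle \<open>c\<close>, then \<open>q\<^sub>n(\<alpha>)\<close> is a resolvent with cocycle
  \<open>f \<circ> c\<close>, both globally and locally. So a choice of \<open>\<alpha>\<close> and \<open>\<beta>\<^sub>v\<close> for \<open>x\<close> yields the choice \<open>q\<^sub>n(\<alpha>)\<close>,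
  \<open>q\<^sub>n(\<beta>\<^sub>v)\<close> for \<open>p\<^sub>n(x)\<close>, and \<open>q\<^sub>n\<close> maps the idele \<open>(\<beta>\<^sub>v \<alpha>\<^sup>-\<^sup>1)\<close> representing the class of \<open>x\<close> to the one
  representing the class of \<open>p\<^sub>n(x)\<close>.
\<close>


section \<open>Group algebras\<close>

text \<open>Three obstacles shape the proof. \<open>finsum\<close> over an infinite index set is
  zero by convention, so the statements about \<open>push\<close> need \<open>p^(-n)T/T\<close>
  finite, and its elements \<open>pfrac\<close> must be classes of an equivalence relation. Both
  come from freeness of \<open>T\<close>: \<open>T/p^n T\<close> is finite and \<open>p^n\<close> is
  injective. Next, the local action goes through \<open>gal_res\<close>, an \<open>inv_into\<close>,
  which is meaningful because an automorphism of the local closure preserves the image of the global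
  one. Finally, \<open>C\<close> is the coset of a finite idele, whereas the family of the
  \<open>\<beta>\<^sub>v \<alpha>\<^sup>-\<^sup>1\<close> is only placed in
  \<open>big_group\<close>; the two are compared modulo \<open>gam_prod\<close> and
  \<open>idele_kernel\<close>. So \<open>q\<close> must respect these subgroups and also the finite
  ideles, which are defined by maximal orders. For the latter \<open>q\<close> has to send orders to
  orders, hence \<open>A_n\<close> onto \<open>A_(n-1)\<close>; this follows from surjectivity on
  the given algebras by taking spans over \<open>F\<close>.\<close>

lemma (in abelian_monoid) finsum_fibres:
  assumes "finite A" "finite B" "f \<in> A \<rightarrow> B" "\<phi> \<in> A \<rightarrow> carrier G"
  shows "(\<Oplus>u\<in>B. \<Oplus>k\<in>{k \<in> A. f k = u}. \<phi> k) = (\<Oplus>k\<in>A. \<phi> k)"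
proof -
  have "A = (\<Union>u\<in>B. {k \<in> A. f k = u})" using assms(3) by auto
  then have "(\<Oplus>k\<in>A. \<phi> k) = finsum G \<phi> (\<Union>u\<in>B. {k \<in> A. f k = u})" by simp
  also have "\<dots> = (\<Oplus>u\<in>B. \<Oplus>k\<in>{k \<in> A. f k = u}. \<phi> k)"
    using assms by (intro add.finprod_UN_disjoint) (auto simp: pairwise_def disjnt_def)
  finally show ?thesis by simp
qed

lemma (in abelian_monoid) finsum_swap:
  assumes "finite A" "finite B" "\<And>i j. i \<in> A \<Longrightarrow> j \<in> B \<Longrightarrow> \<phi> i j \<in> carrier G"
  shows "(\<Oplus>i\<in>A. \<Oplus>j\<in>B. \<phi> i j) = (\<Oplus>j\<in>B. \<Oplus>i\<in>A. \<phi> i j)"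
  using assms(1,3)
proof (induction A)
  case (insert a A)
  have "(\<Oplus>i\<in>insert a A. \<Oplus>j\<in>B. \<phi> i j) = (\<Oplus>j\<in>B. \<phi> a j) \<oplus> (\<Oplus>j\<in>B. \<Oplus>i\<in>A. \<phi> i j)"
    using insert by (subst finsum_insert) (auto intro!: finsum_closed)
  also have "\<dots> = (\<Oplus>j\<in>B. \<phi> a j \<oplus> (\<Oplus>i\<in>A. \<phi> i j))"
    using insert.prems by (intro finsum_addf [symmetric]) auto
  also have "\<dots> = (\<Oplus>j\<in>B. \<Oplus>i\<in>insert a A. \<phi> i j)"
    using insert by (intro finsum_cong') (auto simp: finsum_insert)
  finally show ?case .
qed simp

lemma (in abelian_monoid) finsum_reindex_bij:
  assumes "bij_betw \<pi> A B" "\<phi> \<in> B \<rightarrow> carrier G"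
  shows "(\<Oplus>k\<in>B. \<phi> k) = (\<Oplus>k\<in>A. \<phi> (\<pi> k))"
  using assms add.finprod_reindex [of \<phi> \<pi> A] by (auto simp: bij_betw_def)

lemma (in group) bij_betw_mult_left:
  assumes "x \<in> carrier G"
  shows "bij_betw (\<lambda>y. x \<otimes> y) (carrier G) (carrier G)"
  by (rule bij_betw_byWitness [where f' = "\<lambda>y. inv x \<otimes> y"])
    (use assms in \<open>auto simp: m_assoc [symmetric]\<close>)

lemma (in group) inv_mult_cancel_left:
  "x \<in> carrier G \<Longrightarrow> y \<in> carrier G \<Longrightarrow> inv x \<otimes> (x \<otimes> y) = y"
  by (simp add: m_assoc [symmetric])

lemma (in comm_group) divide_divide:
  assumes "g \<in> carrier G" "h \<in> carrier G"
  shows "inv (inv h \<otimes> g) \<otimes> g = h"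
proof -
  have "inv (inv h \<otimes> g) \<otimes> g = inv g \<otimes> (h \<otimes> g)"
    using assms by (simp add: inv_mult_group m_assoc)
  also have "\<dots> = h"
    using assms by (simp add: m_comm [of h g] inv_mult_cancel_left)
  finally show ?thesis .
qed

text \<open>The map is an involution by \<open>divide_divide\<close>; it is the substitution that
  exchanges the two factors of a convolution.\<close>

lemma (in comm_group) bij_betw_divide:
  assumes "g \<in> carrier G"
  shows "bij_betw (\<lambda>h. inv h \<otimes> g) (carrier G) (carrier G)"
  by (rule bij_betw_byWitness [where f' = "\<lambda>h. inv h \<otimes> g"])
    (use assms in \<open>auto simp: divide_divide\<close>)


text \<open>Finiteness is built in because the convolution is a \<open>finsum\<close>, which would
  collapse to zero over an infinite group.\<close>

locale group_algebra = coef: cring L + grp: comm_group G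
  for L :: "'a ring" and G :: "'g monoid" +
  assumes finite_carrier [simp]: "finite (carrier G)"
begin

abbreviation "A \<equiv> grp_alg L G"

lemma elem_closed [simp, intro]: "a \<in> carrier A \<Longrightarrow> g \<in> carrier G \<Longrightarrow> a g \<in> carrier L"
  by (auto simp: grp_alg_def)

lemma eqI:
  assumes "a \<in> carrier A" "b \<in> carrier A" "\<And>g. g \<in> carrier G \<Longrightarrow> a g = b g"
  shows "a = b"
  using assms by (auto simp: grp_alg_def intro: PiE_ext)

lemma mult_apply:
  "g \<in> carrier G \<Longrightarrow> (a \<otimes>\<^bsub>A\<^esub> b) g = (\<Oplus>\<^bsub>L\<^esub>h\<in>carrier G. a h \<otimes>\<^bsub>L\<^esub> b (inv\<^bsub>G\<^esub> h \<otimes>\<^bsub>G\<^esub> g))"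
  by (simp add: grp_alg_def)

lemma mult_closed [simp, intro]: "a \<in> carrier A \<Longrightarrow> b \<in> carrier A \<Longrightarrow> a \<otimes>\<^bsub>A\<^esub> b \<in> carrier A"
  by (auto simp: grp_alg_def intro!: coef.finsum_closed)

lemma one_eq_grp_elem: "\<one>\<^bsub>A\<^esub> = grp_elem L G \<one>\<^bsub>G\<^esub>"
  by (simp add: grp_alg_def grp_elem_def)

lemma grp_elem_closed [simp, intro]: "grp_elem L G g \<in> carrier A"
  by (auto simp: grp_alg_def grp_elem_def)

lemma grp_elem_apply: "h \<in> carrier G \<Longrightarrow> grp_elem L G g h = (if h = g then \<one>\<^bsub>L\<^esub> else \<zero>\<^bsub>L\<^esub>)"
  by (simp add: grp_elem_def)

lemma add_apply: "g \<in> carrier G \<Longrightarrow> (a \<oplus>\<^bsub>A\<^esub> b) g = a g \<oplus>\<^bsub>L\<^esub> b g"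
  by (simp add: grp_alg_def)

lemma add_closed: "a \<in> carrier A \<Longrightarrow> b \<in> carrier A \<Longrightarrow> a \<oplus>\<^bsub>A\<^esub> b \<in> carrier A"
  by (auto simp: grp_alg_def)

lemma zero_closed: "\<zero>\<^bsub>A\<^esub> \<in> carrier A"
  by (auto simp: grp_alg_def)

lemma zero_apply: "g \<in> carrier G \<Longrightarrow> \<zero>\<^bsub>A\<^esub> g = \<zero>\<^bsub>L\<^esub>"
  by (simp add: grp_alg_def)

text \<open>Only the term at \<open>g\<close> of the convolution survives, so a group element acts
  by translation. The unit law and \<open>grp_elem_mult\<close> both reduce to this.\<close>

lemma grp_elem_mult_apply:
  assumes "a \<in> carrier A" "g \<in> carrier G" "h \<in> carrier G"
  shows "(grp_elem L G g \<otimes>\<^bsub>A\<^esub> a) h = a (inv\<^bsub>G\<^esub> g \<otimes>\<^bsub>G\<^esub> h)"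
proof -
  have "(grp_elem L G g \<otimes>\<^bsub>A\<^esub> a) h =
      (\<Oplus>\<^bsub>L\<^esub>k\<in>carrier G. if g = k then a (inv\<^bsub>G\<^esub> k \<otimes>\<^bsub>G\<^esub> h) else \<zero>\<^bsub>L\<^esub>)"
    using assms by (auto simp: mult_apply grp_elem_apply intro!: coef.finsum_cong')
  also have "\<dots> = a (inv\<^bsub>G\<^esub> g \<otimes>\<^bsub>G\<^esub> h)"
    using assms by (intro coef.add.finprod_singleton) auto
  finally show ?thesis .
qed

lemma mult_comm:
  assumes "a \<in> carrier A" "b \<in> carrier A"
  shows "a \<otimes>\<^bsub>A\<^esub> b = b \<otimes>\<^bsub>A\<^esub> a"
proof (rule eqI)
  fix g assume g: "g \<in> carrier G"
  have "(a \<otimes>\<^bsub>A\<^esub> b) g = (\<Oplus>\<^bsub>L\<^esub>h\<in>carrier G.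
      a (inv\<^bsub>G\<^esub> h \<otimes>\<^bsub>G\<^esub> g) \<otimes>\<^bsub>L\<^esub> b (inv\<^bsub>G\<^esub> (inv\<^bsub>G\<^esub> h \<otimes>\<^bsub>G\<^esub> g) \<otimes>\<^bsub>G\<^esub> g))"
    unfolding mult_apply [OF g]
    using assms g by (intro coef.finsum_reindex_bij grp.bij_betw_divide) auto
  also have "\<dots> = (b \<otimes>\<^bsub>A\<^esub> a) g"
    unfolding mult_apply [OF g] using assms g
    by (intro coef.finsum_cong')
      (auto simp: grp.divide_divide intro!: coef.m_comm)
  finally show "(a \<otimes>\<^bsub>A\<^esub> b) g = (b \<otimes>\<^bsub>A\<^esub> a) g" .
qed (use assms in auto)

text \<open>Both sides are the double sum of \<open>a(k) b(m) c((k m)^(-1) g)\<close>; the left one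
  reaches this form by exchanging the sums and substituting \<open>h = k m\<close>.\<close>

lemma mult_assoc:
  assumes "a \<in> carrier A" "b \<in> carrier A" "c \<in> carrier A"
  shows "a \<otimes>\<^bsub>A\<^esub> b \<otimes>\<^bsub>A\<^esub> c = a \<otimes>\<^bsub>A\<^esub> (b \<otimes>\<^bsub>A\<^esub> c)"
proof (rule eqI)
  fix g assume g: "g \<in> carrier G"
  let ?t = "\<lambda>h k. a k \<otimes>\<^bsub>L\<^esub> (b (inv\<^bsub>G\<^esub> k \<otimes>\<^bsub>G\<^esub> h) \<otimes>\<^bsub>L\<^esub> c (inv\<^bsub>G\<^esub> h \<otimes>\<^bsub>G\<^esub> g))"
  have "(a \<otimes>\<^bsub>A\<^esub> b \<otimes>\<^bsub>A\<^esub> c) g = (\<Oplus>\<^bsub>L\<^esub>h\<in>carrier G. \<Oplus>\<^bsub>L\<^esub>k\<in>carrier G. ?t h k)"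
    unfolding mult_apply [OF g] using assms g
    by (intro coef.finsum_cong')
      (auto simp: mult_apply coef.finsum_ldistr coef.m_assoc intro!: coef.finsum_closed coef.finsum_cong')
  also have "\<dots> = (\<Oplus>\<^bsub>L\<^esub>k\<in>carrier G. \<Oplus>\<^bsub>L\<^esub>h\<in>carrier G. ?t h k)"
    using assms g by (intro coef.finsum_swap) auto
  also have "\<dots> = (\<Oplus>\<^bsub>L\<^esub>k\<in>carrier G. \<Oplus>\<^bsub>L\<^esub>m\<in>carrier G. ?t (k \<otimes>\<^bsub>G\<^esub> m) k)"
    using assms g
    by (intro coef.finsum_cong' coef.finsum_reindex_bij grp.bij_betw_mult_left)
      (auto intro!: coef.finsum_closed)
  also have "\<dots> = (a \<otimes>\<^bsub>A\<^esub> (b \<otimes>\<^bsub>A\<^esub> c)) g"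
    unfolding mult_apply [OF g] using assms g
    by (intro coef.finsum_cong')
      (auto simp: mult_apply coef.finsum_rdistr grp.inv_mult_group grp.m_assoc
        grp.inv_mult_cancel_left intro!: coef.finsum_closed coef.finsum_cong')
  finally show "(a \<otimes>\<^bsub>A\<^esub> b \<otimes>\<^bsub>A\<^esub> c) g = (a \<otimes>\<^bsub>A\<^esub> (b \<otimes>\<^bsub>A\<^esub> c)) g" .
qed (use assms in auto)

lemma is_cring: "cring A"
proof (rule cringI)
  have "\<exists>y\<in>carrier A. y \<oplus>\<^bsub>A\<^esub> x = \<zero>\<^bsub>A\<^esub>" if x: "x \<in> carrier A" for x
  proof
    show "(\<lambda>g\<in>carrier G. \<ominus>\<^bsub>L\<^esub> x g) \<in> carrier A"
      using x by (auto simp: grp_alg_def)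
    then show "(\<lambda>g\<in>carrier G. \<ominus>\<^bsub>L\<^esub> x g) \<oplus>\<^bsub>A\<^esub> x = \<zero>\<^bsub>A\<^esub>"
      using x by (intro eqI) (auto simp: add_apply zero_apply coef.l_neg intro: add_closed zero_closed)
  qed
  then show "abelian_group A"
    by (intro abelian_groupI eqI)
      (auto simp: add_closed zero_closed add_apply zero_apply coef.a_assoc intro: coef.a_comm)
  show "comm_monoid A"
  proof (rule comm_monoidI)
    fix x assume "x \<in> carrier A"
    then show "\<one>\<^bsub>A\<^esub> \<otimes>\<^bsub>A\<^esub> x = x"
      unfolding one_eq_grp_elem by (intro eqI) (auto simp: grp_elem_mult_apply)
  next
    fix x y assume "x \<in> carrier A" "y \<in> carrier A"
    then show "x \<otimes>\<^bsub>A\<^esub> y = y \<otimes>\<^bsub>A\<^esub> x" by (rule mult_comm)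
  qed (auto simp: one_eq_grp_elem mult_assoc)
  fix x y z assume xyz: "x \<in> carrier A" "y \<in> carrier A" "z \<in> carrier A"
  then show "(x \<oplus>\<^bsub>A\<^esub> y) \<otimes>\<^bsub>A\<^esub> z = x \<otimes>\<^bsub>A\<^esub> z \<oplus>\<^bsub>A\<^esub> y \<otimes>\<^bsub>A\<^esub> z"
  proof (intro eqI)
    fix g assume g: "g \<in> carrier G"
    have "((x \<oplus>\<^bsub>A\<^esub> y) \<otimes>\<^bsub>A\<^esub> z) g = (\<Oplus>\<^bsub>L\<^esub>h\<in>carrier G.
        x h \<otimes>\<^bsub>L\<^esub> z (inv\<^bsub>G\<^esub> h \<otimes>\<^bsub>G\<^esub> g) \<oplus>\<^bsub>L\<^esub> y h \<otimes>\<^bsub>L\<^esub> z (inv\<^bsub>G\<^esub> h \<otimes>\<^bsub>G\<^esub> g))"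
      unfolding mult_apply [OF g] using xyz g
      by (intro coef.finsum_cong') (auto simp: add_apply coef.l_distr)
    also have "\<dots> = (x \<otimes>\<^bsub>A\<^esub> z \<oplus>\<^bsub>A\<^esub> y \<otimes>\<^bsub>A\<^esub> z) g"
      unfolding mult_apply [OF g] add_apply [OF g]
      using xyz g by (intro coef.finsum_addf) auto
    finally show "((x \<oplus>\<^bsub>A\<^esub> y) \<otimes>\<^bsub>A\<^esub> z) g = (x \<otimes>\<^bsub>A\<^esub> z \<oplus>\<^bsub>A\<^esub> y \<otimes>\<^bsub>A\<^esub> z) g" .
  qed (auto intro!: add_closed)
qed

sublocale cring A by (rule is_cring)

lemma grp_elem_mult:
  assumes "g \<in> carrier G" "h \<in> carrier G"
  shows "grp_elem L G (g \<otimes>\<^bsub>G\<^esub> h) = grp_elem L G g \<otimes>\<^bsub>A\<^esub> grp_elem L G h"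
proof (rule eqI)
  fix k assume k: "k \<in> carrier G"
  have "k = g \<otimes>\<^bsub>G\<^esub> h \<longleftrightarrow> inv\<^bsub>G\<^esub> g \<otimes>\<^bsub>G\<^esub> k = h"
    using assms k grp.inv_solve_left [of h g k] by auto
  then show "grp_elem L G (g \<otimes>\<^bsub>G\<^esub> h) k = (grp_elem L G g \<otimes>\<^bsub>A\<^esub> grp_elem L G h) k"
    using assms k by (simp add: grp_elem_mult_apply grp_elem_apply)
qed auto

lemma grp_elem_Units:
  assumes "g \<in> carrier G"
  shows "grp_elem L G g \<in> Units A"
proof -
  have "grp_elem L G g \<otimes>\<^bsub>A\<^esub> grp_elem L G (inv\<^bsub>G\<^esub> g) = \<one>\<^bsub>A\<^esub>"
    using assms grp_elem_mult [of g "inv\<^bsub>G\<^esub> g"] by (simp add: one_eq_grp_elem)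
  then show ?thesis
    using grp_elem_closed m_comm [of "grp_elem L G g" "grp_elem L G (inv\<^bsub>G\<^esub> g)"]
    by (auto simp: Units_def)
qed

text \<open>With nonzero coefficients the group embeds in its algebra, so that the
  \<open>THE\<close> in \<open>cls\<close> denotes a unique group element.\<close>

lemma grp_elem_inj:
  assumes "\<one>\<^bsub>L\<^esub> \<noteq> \<zero>\<^bsub>L\<^esub>" "g \<in> carrier G" "grp_elem L G g = grp_elem L G h"
  shows "g = h"
  using assms(1,2) fun_cong [OF assms(3), of g] by (auto simp: grp_elem_apply split: if_splits)

end

text \<open>Units relative to a subset use the product and the one of the ambient ring, and a unit
  together with its inverse is carried along by \<open>h\<close>. The same argument serves orders,
  their scalar extensions and whole algebras.\<close>

lemma Units_image:
  assumes "a \<in> Units (R\<lparr>carrier := B\<rparr>)" "B \<subseteq> carrier R" "h \<in> ring_hom R S" "h ` B \<subseteq> C"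
  shows "h a \<in> Units (S\<lparr>carrier := C\<rparr>)"
proof -
  obtain b where b: "a \<in> B" "b \<in> B" "a \<otimes>\<^bsub>R\<^esub> b = \<one>\<^bsub>R\<^esub>" "b \<otimes>\<^bsub>R\<^esub> a = \<one>\<^bsub>R\<^esub>"
    using assms(1) by (auto simp: Units_def)
  then have "a \<in> carrier R" "b \<in> carrier R" using assms(2) by auto
  then have "h a \<otimes>\<^bsub>S\<^esub> h b = \<one>\<^bsub>S\<^esub> \<and> h b \<otimes>\<^bsub>S\<^esub> h a = \<one>\<^bsub>S\<^esub>"
    using b by (simp add: ring_hom_mult [OF assms(3), symmetric] ring_hom_one [OF assms(3)])
  then show ?thesis using b assms(4) by (auto simp: Units_def)
qed

lemma Units_carrier_mono:
  assumes "B \<subseteq> C"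
  shows "Units (R\<lparr>carrier := B\<rparr>) \<subseteq> Units (R\<lparr>carrier := C\<rparr>)"
  using assms by (auto simp: Units_def)

lemma Units_hom_inv:
  fixes R (structure) and S (structure)
  assumes "monoid R" "monoid S" "h \<in> ring_hom R S" "a \<in> Units R"
  shows "h a \<in> Units S" "h (inv\<^bsub>R\<^esub> a) = inv\<^bsub>S\<^esub> (h a)"
proof -
  interpret R: monoid R by fact
  interpret S: monoid S by fact
  show u: "h a \<in> Units S"
    using Units_image [where R = R and S = S and B = "carrier R" and C = "carrier S"] assms ring_hom_closed [OF assms(3)] by auto
  have "h (inv\<^bsub>R\<^esub> a) \<otimes>\<^bsub>S\<^esub> h a = \<one>\<^bsub>S\<^esub>"
    using ring_hom_mult [OF assms(3), of "inv\<^bsub>R\<^esub> a" a] assms(4) ring_hom_one [OF assms(3)]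
    by (simp add: R.Units_closed)
  then show "h (inv\<^bsub>R\<^esub> a) = inv\<^bsub>S\<^esub> (h a)"
    by (rule S.inv_unique [OF _ S.Units_r_inv [OF u]])
      (use u assms(4) in \<open>simp_all add: ring_hom_closed [OF assms(3)] S.Units_closed\<close>)
qed


definition push :: "'a ring \<Rightarrow> 'g monoid \<Rightarrow> 'h monoid \<Rightarrow> ('g \<Rightarrow> 'h) \<Rightarrow> ('g \<Rightarrow> 'a) \<Rightarrow> ('h \<Rightarrow> 'a)" where
  "push L G H f a = (\<lambda>h\<in>carrier H. \<Oplus>\<^bsub>L\<^esub>g\<in>{g \<in> carrier G. f g = h}. a g)"

text \<open>Covers two cases at once: the embedding at a place (\<open>to_local\<close>) and the
  action of a Galois automorphism on coefficients.\<close>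

definition coeff_map :: "'g monoid \<Rightarrow> ('a \<Rightarrow> 'b) \<Rightarrow> ('g \<Rightarrow> 'a) \<Rightarrow> ('g \<Rightarrow> 'b)" where
  "coeff_map G j a = (\<lambda>g\<in>carrier G. j (a g))"


section \<open>Scalar extensions inside the group algebra, their unit groups, and change of
  coefficients\<close>

context group_algebra
begin

lemma memI: "(\<And>g. g \<in> carrier G \<Longrightarrow> a g \<in> carrier L) \<Longrightarrow> a \<in> extensional (carrier G) \<Longrightarrow> a \<in> carrier A"
  by (auto simp: grp_alg_def PiE_def)

lemma scal_closed [simp, intro]: "r \<in> carrier L \<Longrightarrow> a \<in> carrier A \<Longrightarrow> scal L G r a \<in> carrier A"
  by (rule memI) (auto simp: scal_def)

lemma scal_apply: "g \<in> carrier G \<Longrightarrow> scal L G r a g = r \<otimes>\<^bsub>L\<^esub> a g"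
  by (simp add: scal_def)

lemma scal_mult_scal:
  assumes "r \<in> carrier L" "s \<in> carrier L" "a \<in> carrier A" "b \<in> carrier A"
  shows "scal L G r a \<otimes>\<^bsub>A\<^esub> scal L G s b = scal L G (r \<otimes>\<^bsub>L\<^esub> s) (a \<otimes>\<^bsub>A\<^esub> b)"
proof (rule eqI)
  fix g assume g: "g \<in> carrier G"
  show "(scal L G r a \<otimes>\<^bsub>A\<^esub> scal L G s b) g = scal L G (r \<otimes>\<^bsub>L\<^esub> s) (a \<otimes>\<^bsub>A\<^esub> b) g"
    using assms g
    by (auto simp: mult_apply scal_apply coef.finsum_rdistr coef.m_ac intro!: coef.finsum_cong')
qed (use assms in auto)

lemma scal_one:
  assumes "a \<in> carrier A"
  shows "scal L G \<one>\<^bsub>L\<^esub> a = a"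
  using assms by (intro eqI) (auto simp: scal_apply)

lemma span_over_gens_subset:
  assumes "R \<subseteq> carrier L" "B \<subseteq> carrier A"
  shows "{scal L G r b | r b. r \<in> R \<and> b \<in> B} \<subseteq> carrier A"
  using assms by auto

lemma span_over_subset:
  assumes "R \<subseteq> carrier L" "B \<subseteq> carrier A"
  shows "span_over L G R B \<subseteq> carrier A"
  using add.generate_incl [OF span_over_gens_subset [OF assms]] by (simp add: span_over_def)

lemma span_over_one_closed:
  assumes "\<one>\<^bsub>L\<^esub> \<in> R" "\<one>\<^bsub>A\<^esub> \<in> B"
  shows "\<one>\<^bsub>A\<^esub> \<in> span_over L G R B"
  unfolding span_over_def
  using assms scal_one [of "\<one>\<^bsub>A\<^esub>", symmetric] by (intro generate.incl) auto

text \<open>Biadditivity of the product, one factor at a time: \<open>left\<close> keeps the first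
  factor a generator while the second varies, and the final induction varies the first. This makes
  \<open>span_over\<close> closed under products, so that the units of a scalar extension form a
  group.\<close>

lemma generate_mult_closed:
  assumes "S \<subseteq> carrier A" "\<And>x y. x \<in> S \<Longrightarrow> y \<in> S \<Longrightarrow> x \<otimes>\<^bsub>A\<^esub> y \<in> S"
    and "x \<in> generate (add_monoid A) S" "y \<in> generate (add_monoid A) S"
  shows "x \<otimes>\<^bsub>A\<^esub> y \<in> generate (add_monoid A) S"
proof -
  let ?W = "generate (add_monoid A) S"
  have sub: "subgroup ?W (add_monoid A)"
    using assms(1) by (intro add.generate_is_subgroup) simp
  have W: "x \<in> carrier A" if "x \<in> ?W" for x
    using subgroup.mem_carrier [OF sub that] by simp
  have zero: "\<zero>\<^bsub>A\<^esub> \<in> ?W" and minus: "x \<in> ?W \<Longrightarrow> \<ominus>\<^bsub>A\<^esub> x \<in> ?W"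
    and plus: "x \<in> ?W \<Longrightarrow> y \<in> ?W \<Longrightarrow> x \<oplus>\<^bsub>A\<^esub> y \<in> ?W" for x y
    using subgroup.one_closed [OF sub] subgroup.m_inv_closed [OF sub, of x]
      subgroup.m_closed [OF sub, of x y] by (auto simp: a_inv_def)
  have left: "s \<otimes>\<^bsub>A\<^esub> y \<in> ?W" if s: "s \<in> S" and y: "y \<in> ?W" for s y
    using y
  proof (induction rule: generate.induct)
    case one
    then show ?case using s assms(1) zero by auto
  next
    case (incl h)
    then show ?case using s assms(2) generate.incl by metis
  next
    case (inv h)
    have "s \<otimes>\<^bsub>A\<^esub> h \<in> ?W" using s inv assms(2) generate.incl by metis
    moreover have "s \<otimes>\<^bsub>A\<^esub> inv\<^bsub>add_monoid A\<^esub> h = \<ominus>\<^bsub>A\<^esub> (s \<otimes>\<^bsub>A\<^esub> h)"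
      using r_minus [of s h] s inv assms(1) by (auto simp: a_inv_def)
    ultimately show ?case using minus by simp
  next
    case (eng h1 h2)
    then show ?case using s assms(1) W plus by (auto simp: r_distr subsetD)
  qed
  show ?thesis
    using assms(3)
  proof (induction rule: generate.induct)
    case one
    then show ?case using assms(4) W zero by auto
  next
    case (incl h)
    then show ?case using left assms(4) by simp
  next
    case (inv h)
    have "h \<otimes>\<^bsub>A\<^esub> y \<in> ?W" using inv left assms(4) by simp
    moreover have "inv\<^bsub>add_monoid A\<^esub> h \<otimes>\<^bsub>A\<^esub> y = \<ominus>\<^bsub>A\<^esub> (h \<otimes>\<^bsub>A\<^esub> y)"
      using l_minus [of h y] W [OF assms(4)] inv assms(1) by (auto simp: a_inv_def)
    ultimately show ?case using minus by simp
  next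
    case (eng h1 h2)
    then show ?case using W [OF assms(4)] W plus by (auto simp: l_distr)
  qed
qed

lemma span_over_mult_closed:
  assumes "R \<subseteq> carrier L" "B \<subseteq> carrier A"
    and "\<And>r s. r \<in> R \<Longrightarrow> s \<in> R \<Longrightarrow> r \<otimes>\<^bsub>L\<^esub> s \<in> R"
    and "\<And>b c. b \<in> B \<Longrightarrow> c \<in> B \<Longrightarrow> b \<otimes>\<^bsub>A\<^esub> c \<in> B"
    and "x \<in> span_over L G R B" "y \<in> span_over L G R B"
  shows "x \<otimes>\<^bsub>A\<^esub> y \<in> span_over L G R B"
  unfolding span_over_def
proof (rule generate_mult_closed)
  let ?S = "{scal L G r b | r b. r \<in> R \<and> b \<in> B}"
  show "?S \<subseteq> carrier A" using assms(1,2) by auto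
  show "u \<otimes>\<^bsub>A\<^esub> v \<in> ?S" if uv: "u \<in> ?S" "v \<in> ?S" for u v
  proof -
    obtain r b s c where "u = scal L G r b" "v = scal L G s c" "r \<in> R" "s \<in> R" "b \<in> B" "c \<in> B"
      using uv by blast
    moreover from this have "u \<otimes>\<^bsub>A\<^esub> v = scal L G (r \<otimes>\<^bsub>L\<^esub> s) (b \<otimes>\<^bsub>A\<^esub> c)"
      using assms(1,2) by (simp add: scal_mult_scal subsetD)
    ultimately show ?thesis using assms(3,4) by blast
  qed
qed (use assms(5,6) in \<open>auto simp: span_over_def\<close>)

lemma sub_units_subset_Units:
  assumes "B \<subseteq> carrier A"
  shows "sub_units L G B \<subseteq> Units A"
  using Units_carrier_mono [OF assms, of A] by (simp add: sub_units_def)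

text \<open>Inverses are unique in the ambient algebra, so the inverse found in \<open>B\<close> is
  the ambient one.\<close>

lemma sub_units_inv_closed:
  assumes "B \<subseteq> carrier A" "a \<in> sub_units L G B"
  shows "inv\<^bsub>A\<^esub> a \<in> sub_units L G B"
proof -
  obtain b where b: "a \<in> B" "b \<in> B" "a \<otimes>\<^bsub>A\<^esub> b = \<one>\<^bsub>A\<^esub>" "b \<otimes>\<^bsub>A\<^esub> a = \<one>\<^bsub>A\<^esub>"
    using assms(2) by (auto simp: sub_units_def Units_def)
  then have "inv\<^bsub>A\<^esub> a = b"
    using assms(1) by (intro inv_char) auto
  then show ?thesis using b by (auto simp: sub_units_def Units_def)
qed

lemma sub_units_subgroup:
  assumes "B \<subseteq> carrier A" "\<one>\<^bsub>A\<^esub> \<in> B" "\<And>b c. b \<in> B \<Longrightarrow> c \<in> B \<Longrightarrow> b \<otimes>\<^bsub>A\<^esub> c \<in> B"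
  shows "subgroup (sub_units L G B) (units_of A)"
proof
  show "sub_units L G B \<subseteq> carrier (units_of A)"
    using sub_units_subset_Units [OF assms(1)] by (simp add: units_of_carrier)
  show "\<one>\<^bsub>units_of A\<^esub> \<in> sub_units L G B"
    using assms(2) one_closed by (auto simp: sub_units_def Units_def units_of_one intro!: bexI [of _ "\<one>\<^bsub>A\<^esub>"])
  show "inv\<^bsub>units_of A\<^esub> x \<in> sub_units L G B" if "x \<in> sub_units L G B" for x
    using that sub_units_inv_closed [OF assms(1)] sub_units_subset_Units [OF assms(1)]
    by (metis subsetD units_of_inv)
  fix x y assume x: "x \<in> sub_units L G B" and y: "y \<in> sub_units L G B"
  obtain x' where x': "x \<in> B" "x' \<in> B" "x \<otimes>\<^bsub>A\<^esub> x' = \<one>\<^bsub>A\<^esub>"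
    using x by (auto simp: sub_units_def Units_def)
  obtain y' where y': "y \<in> B" "y' \<in> B" "y \<otimes>\<^bsub>A\<^esub> y' = \<one>\<^bsub>A\<^esub>"
    using y by (auto simp: sub_units_def Units_def)
  have car: "x \<in> carrier A" "x' \<in> carrier A" "y \<in> carrier A" "y' \<in> carrier A"
    using x' y' assms(1) by auto
  have "(x \<otimes>\<^bsub>A\<^esub> y) \<otimes>\<^bsub>A\<^esub> (x' \<otimes>\<^bsub>A\<^esub> y') = (x \<otimes>\<^bsub>A\<^esub> x') \<otimes>\<^bsub>A\<^esub> (y \<otimes>\<^bsub>A\<^esub> y')"
    using car by (simp add: m_ac)
  then have "(x \<otimes>\<^bsub>A\<^esub> y) \<otimes>\<^bsub>A\<^esub> (x' \<otimes>\<^bsub>A\<^esub> y') = \<one>\<^bsub>A\<^esub>" using x' y' by simp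
  moreover from this have "(x' \<otimes>\<^bsub>A\<^esub> y') \<otimes>\<^bsub>A\<^esub> (x \<otimes>\<^bsub>A\<^esub> y) = \<one>\<^bsub>A\<^esub>"
    using car by (metis m_comm m_closed)
  ultimately show "x \<otimes>\<^bsub>units_of A\<^esub> y \<in> sub_units L G B"
    using x' y' assms(3) unfolding units_of_mult by (auto simp: sub_units_def Units_def)
qed

lemma Units_comm_group: "comm_group (units_of A)"
  by (rule units_comm_group)

lemma coeff_map_closed:
  assumes "j \<in> ring_hom L M" "a \<in> carrier A"
  shows "coeff_map G j a \<in> carrier (grp_alg M G)"
  using assms by (auto simp: grp_alg_def coeff_map_def ring_hom_closed)

lemma coeff_map_ring_hom:
  assumes "cring M" "j \<in> ring_hom L M"
  shows "coeff_map G j \<in> ring_hom A (grp_alg M G)"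
proof -
  interpret M: group_algebra M G by (intro group_algebra.intro assms grp.comm_group_axioms group_algebra_axioms.intro) auto
  interpret h: ring_hom_cring L M j
    by (intro ring_hom_cring.intro assms coef.is_cring ring_hom_cring_axioms.intro)
  note closed = coeff_map_closed [OF assms(2)]
  show ?thesis
  proof (rule ring_hom_memI)
    fix a b assume ab: "a \<in> carrier A" "b \<in> carrier A"
    show "coeff_map G j (a \<otimes>\<^bsub>A\<^esub> b) = coeff_map G j a \<otimes>\<^bsub>M.A\<^esub> coeff_map G j b"
    proof (rule M.eqI)
      fix g assume g: "g \<in> carrier G"
      have "j ((a \<otimes>\<^bsub>A\<^esub> b) g) = (\<Oplus>\<^bsub>M\<^esub>h\<in>carrier G. j (a h \<otimes>\<^bsub>L\<^esub> b (inv\<^bsub>G\<^esub> h \<otimes>\<^bsub>G\<^esub> g)))"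
        unfolding mult_apply [OF g] using ab g by (subst h.hom_finsum) (auto simp: o_def)
      then show "coeff_map G j (a \<otimes>\<^bsub>A\<^esub> b) g = (coeff_map G j a \<otimes>\<^bsub>M.A\<^esub> coeff_map G j b) g"
        using ab g by (auto simp: coeff_map_def M.mult_apply intro!: M.coef.finsum_cong')
    qed (use ab closed in auto)
    show "coeff_map G j (a \<oplus>\<^bsub>A\<^esub> b) = coeff_map G j a \<oplus>\<^bsub>M.A\<^esub> coeff_map G j b"
      using ab closed
      by (intro M.eqI) (auto simp: coeff_map_def M.add_apply add_apply)
  next
    show "coeff_map G j \<one>\<^bsub>A\<^esub> = \<one>\<^bsub>M.A\<^esub>"
      using closed
      by (intro M.eqI) (auto simp: coeff_map_def one_eq_grp_elem M.one_eq_grp_elem grp_elem_apply M.grp_elem_apply)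
  qed (use closed in auto)
qed

end


section \<open>Push-forward along a group homomorphism\<close>

locale group_algebra_hom = dom: group_algebra L G + cod: group_algebra L H
  for L :: "'a ring" and G :: "'g monoid" and H :: "'h monoid" +
  fixes f :: "'g \<Rightarrow> 'h"
  assumes f_hom: "f \<in> hom G H"
begin

lemma f_closed [simp, intro]: "g \<in> carrier G \<Longrightarrow> f g \<in> carrier H"
  using f_hom by (auto simp: hom_def)

lemma f_mult [simp]: "g \<in> carrier G \<Longrightarrow> h \<in> carrier G \<Longrightarrow> f (g \<otimes>\<^bsub>G\<^esub> h) = f g \<otimes>\<^bsub>H\<^esub> f h"
  using f_hom by (auto simp: hom_def)

lemma f_group_hom: "group_hom G H f"
  by (intro group_hom.intro group_hom_axioms.intro f_hom dom.grp.is_group cod.grp.is_group)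

lemma f_inv [simp]: "g \<in> carrier G \<Longrightarrow> f (inv\<^bsub>G\<^esub> g) = inv\<^bsub>H\<^esub> (f g)"
  by (rule group_hom.hom_inv [OF f_group_hom])

lemma f_one [simp]: "f \<one>\<^bsub>G\<^esub> = \<one>\<^bsub>H\<^esub>"
  by (rule group_hom.hom_one [OF f_group_hom])

lemma push_closed [simp, intro]: "a \<in> carrier dom.A \<Longrightarrow> push L G H f a \<in> carrier cod.A"
  by (rule cod.memI) (auto simp: push_def intro!: dom.coef.finsum_closed)

lemma push_apply:
  "h \<in> carrier H \<Longrightarrow> push L G H f a h = (\<Oplus>\<^bsub>L\<^esub>g\<in>{g \<in> carrier G. f g = h}. a g)"
  by (simp add: push_def)

lemma push_add:
  assumes "a \<in> carrier dom.A" "b \<in> carrier dom.A"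
  shows "push L G H f (a \<oplus>\<^bsub>dom.A\<^esub> b) = push L G H f a \<oplus>\<^bsub>cod.A\<^esub> push L G H f b"
proof (rule cod.eqI)
  fix h assume h: "h \<in> carrier H"
  have "push L G H f (a \<oplus>\<^bsub>dom.A\<^esub> b) h =
      (\<Oplus>\<^bsub>L\<^esub>g\<in>{g \<in> carrier G. f g = h}. a g \<oplus>\<^bsub>L\<^esub> b g)"
    unfolding push_apply [OF h] using assms
    by (intro dom.coef.finsum_cong') (auto simp: dom.add_apply)
  also have "\<dots> = (push L G H f a \<oplus>\<^bsub>cod.A\<^esub> push L G H f b) h"
    unfolding cod.add_apply [OF h] push_apply [OF h]
    using assms by (intro dom.coef.finsum_addf) auto
  finally show "push L G H f (a \<oplus>\<^bsub>dom.A\<^esub> b) h = (push L G H f a \<oplus>\<^bsub>cod.A\<^esub> push L G H f b) h" .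
qed (use assms in \<open>auto intro: dom.add_closed cod.add_closed\<close>)

lemma push_scal:
  assumes "r \<in> carrier L" "a \<in> carrier dom.A"
  shows "push L G H f (scal L G r a) = scal L H r (push L G H f a)"
proof (rule cod.eqI)
  fix h assume h: "h \<in> carrier H"
  show "push L G H f (scal L G r a) h = scal L H r (push L G H f a) h"
    unfolding push_apply [OF h] cod.scal_apply [OF h]
    using assms by (subst dom.coef.finsum_rdistr) (auto simp: dom.scal_apply intro!: dom.coef.finsum_cong')
qed (use assms in auto)

text \<open>Translation by \<open>k\<close> matches the fibres. In a convolution it is the
  substitution \<open>g = k m\<close>.\<close>

lemma fibre_shift:
  assumes "k \<in> carrier G" "h \<in> carrier H"
  shows "bij_betw (\<lambda>m. k \<otimes>\<^bsub>G\<^esub> m) {m \<in> carrier G. f m = inv\<^bsub>H\<^esub> (f k) \<otimes>\<^bsub>H\<^esub> h} {g \<in> carrier G. f g = h}"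
  by (rule bij_betw_byWitness [where f' = "\<lambda>g. inv\<^bsub>G\<^esub> k \<otimes>\<^bsub>G\<^esub> g"])
    (use assms in \<open>auto simp: dom.grp.m_assoc [symmetric] cod.grp.m_assoc [symmetric]\<close>)

text \<open>Expand the convolution over the fibre of \<open>h\<close> and exchange the sums. For
  fixed \<open>k\<close> the inner sum is \<open>a k\<close> times a full fibre sum of
  \<open>b\<close>, by \<open>fibre_shift\<close>, and it depends on \<open>k\<close> otherwise only
  through \<open>f k\<close>; collecting the \<open>k\<close> with equal \<open>f k\<close> produces
  the convolution over \<open>H\<close>.\<close>

lemma push_mult:
  assumes "a \<in> carrier dom.A" "b \<in> carrier dom.A"
  shows "push L G H f (a \<otimes>\<^bsub>dom.A\<^esub> b) = push L G H f a \<otimes>\<^bsub>cod.A\<^esub> push L G H f b"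
proof (rule cod.eqI)
  fix h assume h: "h \<in> carrier H"
  let ?b = "\<lambda>u. push L G H f b (inv\<^bsub>H\<^esub> u \<otimes>\<^bsub>H\<^esub> h)"
  have b: "?b u \<in> carrier L" if "u \<in> carrier H" for u
    using that h assms by auto
  have fibre: "(\<Oplus>\<^bsub>L\<^esub>g\<in>{g \<in> carrier G. f g = h}. a k \<otimes>\<^bsub>L\<^esub> b (inv\<^bsub>G\<^esub> k \<otimes>\<^bsub>G\<^esub> g)) = a k \<otimes>\<^bsub>L\<^esub> ?b (f k)"
    if k: "k \<in> carrier G" for k
  proof -
    have "(\<Oplus>\<^bsub>L\<^esub>g\<in>{g \<in> carrier G. f g = h}. a k \<otimes>\<^bsub>L\<^esub> b (inv\<^bsub>G\<^esub> k \<otimes>\<^bsub>G\<^esub> g)) =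
        (\<Oplus>\<^bsub>L\<^esub>m\<in>{m \<in> carrier G. f m = inv\<^bsub>H\<^esub> (f k) \<otimes>\<^bsub>H\<^esub> h}.
          a k \<otimes>\<^bsub>L\<^esub> b (inv\<^bsub>G\<^esub> k \<otimes>\<^bsub>G\<^esub> (k \<otimes>\<^bsub>G\<^esub> m)))"
      using assms k by (intro dom.coef.finsum_reindex_bij [OF fibre_shift [OF k h]]) auto
    also have "\<dots> = (\<Oplus>\<^bsub>L\<^esub>m\<in>{m \<in> carrier G. f m = inv\<^bsub>H\<^esub> (f k) \<otimes>\<^bsub>H\<^esub> h}. a k \<otimes>\<^bsub>L\<^esub> b m)"
      using assms k by (intro dom.coef.finsum_cong') (auto simp: dom.grp.inv_mult_cancel_left)
    also have "\<dots> = a k \<otimes>\<^bsub>L\<^esub> ?b (f k)"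
      using assms k h by (subst push_apply) (auto simp: dom.coef.finsum_rdistr)
    finally show ?thesis .
  qed
  have "push L G H f (a \<otimes>\<^bsub>dom.A\<^esub> b) h = (\<Oplus>\<^bsub>L\<^esub>g\<in>{g \<in> carrier G. f g = h}.
      \<Oplus>\<^bsub>L\<^esub>k\<in>carrier G. a k \<otimes>\<^bsub>L\<^esub> b (inv\<^bsub>G\<^esub> k \<otimes>\<^bsub>G\<^esub> g))"
    unfolding push_apply [OF h] using assms
    by (intro dom.coef.finsum_cong') (auto simp: dom.mult_apply intro!: dom.coef.finsum_closed)
  also have "\<dots> = (\<Oplus>\<^bsub>L\<^esub>k\<in>carrier G. \<Oplus>\<^bsub>L\<^esub>g\<in>{g \<in> carrier G. f g = h}.
      a k \<otimes>\<^bsub>L\<^esub> b (inv\<^bsub>G\<^esub> k \<otimes>\<^bsub>G\<^esub> g))"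
    using assms by (intro dom.coef.finsum_swap) auto
  also have "\<dots> = (\<Oplus>\<^bsub>L\<^esub>k\<in>carrier G. a k \<otimes>\<^bsub>L\<^esub> ?b (f k))"
    using assms b by (intro dom.coef.finsum_cong' refl fibre) auto
  also have "\<dots> = (\<Oplus>\<^bsub>L\<^esub>u\<in>carrier H. \<Oplus>\<^bsub>L\<^esub>k\<in>{k \<in> carrier G. f k = u}. a k \<otimes>\<^bsub>L\<^esub> ?b (f k))"
    using assms b by (intro dom.coef.finsum_fibres [symmetric]) auto
  also have "\<dots> = (\<Oplus>\<^bsub>L\<^esub>u\<in>carrier H. push L G H f a u \<otimes>\<^bsub>L\<^esub> ?b u)"
  proof (intro dom.coef.finsum_cong' refl)
    fix u assume u: "u \<in> carrier H"
    have "(\<Oplus>\<^bsub>L\<^esub>k\<in>{k \<in> carrier G. f k = u}. a k \<otimes>\<^bsub>L\<^esub> ?b (f k)) =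
        (\<Oplus>\<^bsub>L\<^esub>k\<in>{k \<in> carrier G. f k = u}. a k \<otimes>\<^bsub>L\<^esub> ?b u)"
      using assms b u by (intro dom.coef.finsum_cong' refl) auto
    also have "\<dots> = push L G H f a u \<otimes>\<^bsub>L\<^esub> ?b u"
      unfolding push_apply [OF u] using assms b u
      by (intro dom.coef.finsum_ldistr [symmetric]) auto
    finally show "(\<Oplus>\<^bsub>L\<^esub>k\<in>{k \<in> carrier G. f k = u}. a k \<otimes>\<^bsub>L\<^esub> ?b (f k)) = push L G H f a u \<otimes>\<^bsub>L\<^esub> ?b u" .
  qed (use assms b in auto)
  also have "\<dots> = (push L G H f a \<otimes>\<^bsub>cod.A\<^esub> push L G H f b) h"
    by (rule cod.mult_apply [OF h, symmetric])
  finally show "push L G H f (a \<otimes>\<^bsub>dom.A\<^esub> b) h = (push L G H f a \<otimes>\<^bsub>cod.A\<^esub> push L G H f b) h" .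
qed (use assms in auto)

lemma push_grp_elem:
  assumes "g \<in> carrier G"
  shows "push L G H f (grp_elem L G g) = grp_elem L H (f g)"
proof (rule cod.eqI)
  fix h assume h: "h \<in> carrier H"
  show "push L G H f (grp_elem L G g) h = grp_elem L H (f g) h"
  proof (cases "f g = h")
    case True
    have "push L G H f (grp_elem L G g) h =
        (\<Oplus>\<^bsub>L\<^esub>k\<in>{k \<in> carrier G. f k = h}. if k = g then \<one>\<^bsub>L\<^esub> else \<zero>\<^bsub>L\<^esub>)"
      unfolding push_apply [OF h] by (intro dom.coef.finsum_cong') (auto simp: dom.grp_elem_apply)
    also have "\<dots> = \<one>\<^bsub>L\<^esub>"
      using assms True by (intro dom.coef.add.finprod_singleton_swap) auto
    finally show ?thesis using True h by (simp add: cod.grp_elem_apply)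
  next
    case False
    have "push L G H f (grp_elem L G g) h = (\<Oplus>\<^bsub>L\<^esub>k\<in>{k \<in> carrier G. f k = h}. \<zero>\<^bsub>L\<^esub>)"
      unfolding push_apply [OF h] using False
      by (intro dom.coef.finsum_cong') (auto simp: dom.grp_elem_apply)
    then show ?thesis using False h by (auto simp: cod.grp_elem_apply)
  qed
qed (use assms in auto)

lemma push_ring_hom: "push L G H f \<in> ring_hom dom.A cod.A"
  using push_grp_elem [of "\<one>\<^bsub>G\<^esub>"]
  by (intro ring_hom_memI) (auto simp: push_mult push_add dom.one_eq_grp_elem cod.one_eq_grp_elem)

text \<open>A ring homomorphism commutes with the finite sum over a fibre. Applied to the embeddings
  at places it compares \<open>q\<close> globally and locally; applied to automorphisms it enters
  \<open>push_alg_act\<close>.\<close>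

lemma push_coeff_map:
  assumes "cring M" "j \<in> ring_hom L M" "a \<in> carrier dom.A"
  shows "push M G H f (coeff_map G j a) = coeff_map H j (push L G H f a)"
proof -
  interpret h: ring_hom_cring L M j
    by (intro ring_hom_cring.intro assms dom.coef.is_cring ring_hom_cring_axioms.intro)
  have "j (\<Oplus>\<^bsub>L\<^esub>g\<in>{g \<in> carrier G. f g = h}. a g) =
      (\<Oplus>\<^bsub>M\<^esub>g\<in>{g \<in> carrier G. f g = h}. coeff_map G j a g)" for h
    using assms by (subst h.hom_finsum) (auto simp: o_def coeff_map_def intro!: h.S.finsum_cong')
  then show ?thesis
    by (auto simp: push_def coeff_map_def [of H])
qed

text \<open>The image of a generated subgroup is generated by the images of the generators.
  Equality, rather than inclusion, is what later yields that \<open>q\<close> maps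
  \<open>A_n\<close> onto \<open>A_(n-1)\<close> and orders to orders.\<close>

lemma push_span_over:
  assumes "R \<subseteq> carrier L" "B \<subseteq> carrier dom.A"
  shows "push L G H f ` span_over L G R B = span_over L H R (push L G H f ` B)"
proof -
  have "group_hom (add_monoid dom.A) (add_monoid cod.A) (push L G H f)"
    by (intro group_hom.intro dom.add.is_group cod.add.is_group group_hom_axioms.intro homI)
      (auto simp: push_add)
  moreover have "push L G H f ` {scal L G r b | r b. r \<in> R \<and> b \<in> B} =
      {scal L H r b | r b. r \<in> R \<and> b \<in> push L G H f ` B}"
    using assms push_scal by (auto simp: image_iff subset_iff) metis+
  ultimately show ?thesis
    unfolding span_over_def
    using group_hom.generate_img [of "add_monoid dom.A" "add_monoid cod.A" "push L G H f"
        "{scal L G r b | r b. r \<in> R \<and> b \<in> B}"]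
      dom.span_over_gens_subset [OF assms] by simp
qed

lemma push_sub_units:
  assumes "B \<subseteq> carrier dom.A" "push L G H f ` B \<subseteq> C" "a \<in> sub_units L G B"
  shows "push L G H f a \<in> sub_units L H C"
  using Units_image [OF _ assms(1) push_ring_hom assms(2)] assms(3) by (simp add: sub_units_def)

lemma push_inv:
  assumes "a \<in> Units dom.A"
  shows "push L G H f a \<in> Units cod.A" "push L G H f (inv\<^bsub>dom.A\<^esub> a) = inv\<^bsub>cod.A\<^esub> (push L G H f a)"
  using Units_hom_inv [OF dom.monoid_axioms cod.monoid_axioms push_ring_hom assms] by auto

end

text \<open>A fibre of the composite is the disjoint union of the fibres of \<open>f\<close> over a
  fibre of \<open>g\<close>; this is \<open>finsum_fibres\<close>.\<close>

lemma push_push: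
  assumes "group_algebra_hom L G H f" "group_algebra_hom L H K g" "a \<in> carrier (grp_alg L G)"
  shows "push L H K g (push L G H f a) = push L G K (\<lambda>x. g (f x)) a"
proof -
  interpret f: group_algebra_hom L G H f by fact
  interpret g: group_algebra_hom L H K g by fact
  have "(\<Oplus>\<^bsub>L\<^esub>h\<in>{h \<in> carrier H. g h = k}. push L G H f a h) =
      (\<Oplus>\<^bsub>L\<^esub>x\<in>{x \<in> carrier G. g (f x) = k}. a x)" for k
  proof -
    have "(\<Oplus>\<^bsub>L\<^esub>h\<in>{h \<in> carrier H. g h = k}. push L G H f a h) =
        (\<Oplus>\<^bsub>L\<^esub>h\<in>{h \<in> carrier H. g h = k}.
          \<Oplus>\<^bsub>L\<^esub>x\<in>{x \<in> {x \<in> carrier G. g (f x) = k}. f x = h}. a x)"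
    proof (intro f.dom.coef.finsum_cong' refl)
      fix h assume h: "h \<in> {h \<in> carrier H. g h = k}"
      then have "{x \<in> {x \<in> carrier G. g (f x) = k}. f x = h} = {x \<in> carrier G. f x = h}"
        by auto
      then show "push L G H f a h = (\<Oplus>\<^bsub>L\<^esub>x\<in>{x \<in> {x \<in> carrier G. g (f x) = k}. f x = h}. a x)"
        using h by (simp add: f.push_apply)
    qed (use assms(3) in \<open>auto intro!: f.dom.coef.finsum_closed\<close>)
    also have "\<dots> = (\<Oplus>\<^bsub>L\<^esub>x\<in>{x \<in> carrier G. g (f x) = k}. a x)"
      using assms(3) by (intro f.dom.coef.finsum_fibres) auto
    finally show ?thesis .
  qed
  then show ?thesis by (simp add: push_def [of L H K] push_def [of L G K])
qed

lemma push_cong: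
  "(\<And>x. x \<in> carrier G \<Longrightarrow> f x = g x) \<Longrightarrow> push L G H f a = push L G H g a"
  unfolding push_def by (intro restrict_ext arg_cong [where f = "finsum L a"]) auto

text \<open>For a bijection each fibre is the single point named by \<open>inv_into\<close> in
  \<open>alg_act\<close>, so the fibre sum has one term.\<close>

lemma (in group_algebra) alg_act_eq_push:
  assumes "\<omega> \<in> ring_hom L L" "bij_betw (\<rho> \<omega>) (carrier G) (carrier G)" "a \<in> carrier A"
  shows "alg_act L G \<rho> \<omega> a = push L G G (\<rho> \<omega>) (coeff_map G \<omega> a)"
proof -
  have "\<omega> (a (inv_into (carrier G) (\<rho> \<omega>) h)) =
      (\<Oplus>\<^bsub>L\<^esub>g\<in>{g \<in> carrier G. \<rho> \<omega> g = h}. coeff_map G \<omega> a g)"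
    if h: "h \<in> carrier G" for h
  proof -
    let ?g = "inv_into (carrier G) (\<rho> \<omega>) h"
    have g: "?g \<in> carrier G" "\<rho> \<omega> ?g = h"
      using assms(2) h by (auto simp: bij_betw_def inv_into_into f_inv_into_f)
    have "{g \<in> carrier G. \<rho> \<omega> g = h} = {?g}"
      using g assms(2) by (auto simp: bij_betw_def inj_on_def)
    then show ?thesis
      using g assms(1,3) by (simp add: coeff_map_def ring_hom_closed)
  qed
  then show ?thesis by (auto simp: alg_act_def push_def)
qed


section \<open>Resolvents and their cocycles\<close>

text \<open>The image of \<open>N c\<close> is \<open>h(N) h(c)\<close>, and \<open>N'\<close>
  absorbs \<open>h(N)\<close>. The left side is the form in which \<open>p_map\<close>,
  \<open>localize\<close> and \<open>pD_map\<close> are defined, so this lemma evaluates all three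
  on a representative.\<close>

lemma coset_image:
  assumes "group P" "group Q" "h \<in> hom P Q" "subgroup N P" "subgroup N' Q" "h ` N \<subseteq> N'"
    and "c \<in> carrier P"
  shows "N' <#>\<^bsub>Q\<^esub> h ` (N #>\<^bsub>P\<^esub> c) = N' #>\<^bsub>Q\<^esub> h c"
proof -
  interpret Q: group Q by fact
  have N: "N \<subseteq> carrier P" and N': "N' \<subseteq> carrier Q"
    using assms(4,5) by (auto dest: subgroup.subset)
  have hc: "h c \<in> carrier Q" using assms(3,7) by (auto simp: hom_def)
  have hN: "subgroup (h ` N) Q"
    using assms by (intro group_hom.subgroup_img_is_subgroup [of P Q])
      (auto intro: group_hom.intro group_hom_axioms.intro)
  have "N' <#>\<^bsub>Q\<^esub> h ` N = N'"
  proof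
    show "N' <#>\<^bsub>Q\<^esub> h ` N \<subseteq> N'"
      using assms(6) subgroup.m_closed [OF assms(5)] by (auto simp: set_mult_def)
    show "N' \<subseteq> N' <#>\<^bsub>Q\<^esub> h ` N"
    proof
      fix x assume "x \<in> N'"
      then have "x = x \<otimes>\<^bsub>Q\<^esub> \<one>\<^bsub>Q\<^esub>" using N' by auto
      then show "x \<in> N' <#>\<^bsub>Q\<^esub> h ` N"
        using \<open>x \<in> N'\<close> subgroup.one_closed [OF hN] unfolding set_mult_def by blast
    qed
  qed
  moreover have "h ` (N #>\<^bsub>P\<^esub> c) = h ` N <#>\<^bsub>Q\<^esub> {h c}"
    using set_mult_hom [OF assms(3) N, of "{c}"] assms(7) by (simp add: r_coset_eq_set_mult)
  ultimately show ?thesis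
    using Q.set_mult_assoc [of N' "h ` N" "{h c}"] N' hc subgroup.subset [OF hN]
    by (simp add: r_coset_eq_set_mult)
qed

text \<open>
  Products of cochains are pointwise, so cosets can be computed in the group of all cochains, continuous
  or not.
\<close>

lemma cocycles_r_coset:
  "N #>\<^bsub>cocycles L K G \<rho>\<^esub> c = N #>\<^bsub>product_group (abs_gal L K) (\<lambda>_. G)\<^esub> c"
  by (simp add: r_coset_def cocycles_def)

lemma cocycles_set_mult:
  "N <#>\<^bsub>cocycles L K G \<rho>\<^esub> M = N <#>\<^bsub>product_group (abs_gal L K) (\<lambda>_. G)\<^esub> M"
  by (simp add: set_mult_def cocycles_def)

text \<open>Coboundaries are the image of the map from an element to its coboundary, which is a
  homomorphism because \<open>G\<close> is commutative.\<close>

lemma coboundaries_subgroup: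
  assumes "comm_group G" "\<And>\<omega>. \<omega> \<in> abs_gal L K \<Longrightarrow> \<rho> \<omega> \<in> hom G G"
  shows "subgroup (coboundaries L K G \<rho>) (product_group (abs_gal L K) (\<lambda>_. G))"
proof -
  interpret G: comm_group G by fact
  let ?\<Omega> = "abs_gal L K"
  let ?P = "product_group ?\<Omega> (\<lambda>_. G)"
  interpret P: group ?P by simp
  let ?d = "\<lambda>g. \<lambda>\<omega>\<in>?\<Omega>. \<rho> \<omega> g \<otimes>\<^bsub>G\<^esub> inv\<^bsub>G\<^esub> g"
  have \<rho>: "\<rho> \<omega> g \<in> carrier G" if "\<omega> \<in> ?\<Omega>" "g \<in> carrier G" for \<omega> g
    using assms(2) that by (auto simp: hom_def)
  have "group_hom G ?P ?d"
  proof (intro group_hom.intro G.is_group P.is_group group_hom_axioms.intro homI)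
    fix x y assume xy: "x \<in> carrier G" "y \<in> carrier G"
    have "\<rho> \<omega> (x \<otimes>\<^bsub>G\<^esub> y) \<otimes>\<^bsub>G\<^esub> inv\<^bsub>G\<^esub> (x \<otimes>\<^bsub>G\<^esub> y) =
        (\<rho> \<omega> x \<otimes>\<^bsub>G\<^esub> inv\<^bsub>G\<^esub> x) \<otimes>\<^bsub>G\<^esub> (\<rho> \<omega> y \<otimes>\<^bsub>G\<^esub> inv\<^bsub>G\<^esub> y)" if w: "\<omega> \<in> ?\<Omega>" for \<omega>
      using xy \<rho> [OF w] hom_mult [OF assms(2) [OF w] xy] by (simp add: G.inv_mult G.m_ac)
    then show "?d (x \<otimes>\<^bsub>G\<^esub> y) = ?d x \<otimes>\<^bsub>?P\<^esub> ?d y" by auto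
  qed (auto simp: \<rho>)
  then show ?thesis
    unfolding coboundaries_def by (rule group_hom.img_is_subgroup)
qed

text \<open>The representative inside \<open>cls\<close>, named so that its values can be computed
  before passing to cosets.\<close>

definition resolvent_cocycle ::
    "'a ring \<Rightarrow> 'a set \<Rightarrow> 'g monoid \<Rightarrow> (('a \<Rightarrow> 'a) \<Rightarrow> 'g \<Rightarrow> 'g) \<Rightarrow> ('g \<Rightarrow> 'a) \<Rightarrow> (('a \<Rightarrow> 'a) \<Rightarrow> 'g)" where
  "resolvent_cocycle L K G \<rho> \<alpha> = (\<lambda>\<omega>\<in>abs_gal L K. THE \<gamma>. \<gamma> \<in> carrier G \<and>
     grp_elem L G \<gamma> = alg_act L G \<rho> \<omega> \<alpha> \<otimes>\<^bsub>grp_alg L G\<^esub> inv\<^bsub>grp_alg L G\<^esub> \<alpha>)"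

lemma cls_eq:
  "cls L K G \<rho> \<alpha> = coboundaries L K G \<rho> #>\<^bsub>product_group (abs_gal L K) (\<lambda>_. G)\<^esub>
     resolvent_cocycle L K G \<rho> \<alpha>"
  by (simp add: cls_def resolvent_cocycle_def cocycles_r_coset)

lemma integral_closure_subset: "integral_closure L R \<subseteq> carrier L"
  by (auto simp: integral_closure_def)

lemma (in group_algebra) HH_subset_Units:
  assumes "B \<subseteq> carrier A"
  shows "HH L K G \<rho> R B \<subseteq> Units A"
  using sub_units_subset_Units [OF span_over_subset [OF integral_closure_subset assms]]
  by (auto simp: HH_def)

text \<open>Membership in \<open>HH\<close> gives existence of the group element and
  \<open>grp_elem_inj\<close> its uniqueness, which discharges the \<open>THE\<close>.\<close>

lemma (in group_algebra) resolvent_cocycle: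
  assumes "\<one>\<^bsub>L\<^esub> \<noteq> \<zero>\<^bsub>L\<^esub>" "\<alpha> \<in> HH L K G \<rho> R B" "\<omega> \<in> abs_gal L K"
  shows "resolvent_cocycle L K G \<rho> \<alpha> \<omega> \<in> carrier G"
    and "grp_elem L G (resolvent_cocycle L K G \<rho> \<alpha> \<omega>) = alg_act L G \<rho> \<omega> \<alpha> \<otimes>\<^bsub>A\<^esub> inv\<^bsub>A\<^esub> \<alpha>"
proof -
  obtain \<gamma> where \<gamma>: "\<gamma> \<in> carrier G" "grp_elem L G \<gamma> = alg_act L G \<rho> \<omega> \<alpha> \<otimes>\<^bsub>A\<^esub> inv\<^bsub>A\<^esub> \<alpha>"
    using assms(2,3) unfolding HH_def by (auto simp: image_iff)
  have "\<exists>!\<gamma>. \<gamma> \<in> carrier G \<and> grp_elem L G \<gamma> = alg_act L G \<rho> \<omega> \<alpha> \<otimes>\<^bsub>A\<^esub> inv\<^bsub>A\<^esub> \<alpha>"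
    using \<gamma> grp_elem_inj [OF assms(1)] by (intro ex1I [of _ \<gamma>]) auto
  from theI' [OF this] assms(3)
  show "resolvent_cocycle L K G \<rho> \<alpha> \<omega> \<in> carrier G"
    "grp_elem L G (resolvent_cocycle L K G \<rho> \<alpha> \<omega>) = alg_act L G \<rho> \<omega> \<alpha> \<otimes>\<^bsub>A\<^esub> inv\<^bsub>A\<^esub> \<alpha>"
    by (simp_all add: resolvent_cocycle_def)
qed

lemma span_over_mono:
  assumes "B \<subseteq> C"
  shows "span_over L G R B \<subseteq> span_over L G R C"
proof
  fix x assume "x \<in> span_over L G R B"
  then show "x \<in> span_over L G R C"
    unfolding span_over_def
  proof (induction rule: generate.induct)
    case one
    show ?case by (rule generate.one)
  next
    case (incl h)
    then show ?case using assms by (intro generate.incl) auto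
  next
    case (inv h)
    then show ?case using assms by (intro generate.inv) auto
  next
    case (eng h1 h2)
    then show ?case by (intro generate.eng)
  qed
qed

text \<open>Instantiated twice with \<open>f\<close> multiplication by \<open>p\<close>: over the
  global field, and over each completion with the action pulled back along
  \<open>gal_res\<close>.\<close>

locale equivariant_hom = group_algebra_hom L G H f
  for L :: "'a ring" and G :: "'g monoid" and H :: "'h monoid" and f +
  fixes K :: "'a set"
    and \<rho> :: "('a \<Rightarrow> 'a) \<Rightarrow> 'g \<Rightarrow> 'g" and \<rho>' :: "('a \<Rightarrow> 'a) \<Rightarrow> 'h \<Rightarrow> 'h"
  assumes one_not_zero: "\<one>\<^bsub>L\<^esub> \<noteq> \<zero>\<^bsub>L\<^esub>"
    and \<rho>_iso: "\<omega> \<in> abs_gal L K \<Longrightarrow> \<rho> \<omega> \<in> iso G G"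
    and \<rho>'_iso: "\<omega> \<in> abs_gal L K \<Longrightarrow> \<rho>' \<omega> \<in> iso H H"
    and equivariant: "\<omega> \<in> abs_gal L K \<Longrightarrow> g \<in> carrier G \<Longrightarrow> f (\<rho> \<omega> g) = \<rho>' \<omega> (f g)"
begin

lemma abs_gal_ring_hom: "\<omega> \<in> abs_gal L K \<Longrightarrow> \<omega> \<in> ring_hom L L"
  by (auto simp: abs_gal_def ring_iso_def)

text \<open>Once both actions are written as a push-forward after a coefficient map, the claim is
  functoriality applied to the two sides of the equivariance of \<open>f\<close>.\<close>

lemma push_alg_act:
  assumes "\<omega> \<in> abs_gal L K" "a \<in> carrier dom.A"
  shows "push L G H f (alg_act L G \<rho> \<omega> a) = alg_act L H \<rho>' \<omega> (push L G H f a)"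
proof -
  note w = abs_gal_ring_hom [OF assms(1)]
  have \<rho>: "group_algebra_hom L G G (\<rho> \<omega>)" "bij_betw (\<rho> \<omega>) (carrier G) (carrier G)"
    and \<rho>': "group_algebra_hom L H H (\<rho>' \<omega>)" "bij_betw (\<rho>' \<omega>) (carrier H) (carrier H)"
    using \<rho>_iso [OF assms(1)] \<rho>'_iso [OF assms(1)]
    by (auto simp: iso_def intro!: group_algebra_hom.intro group_algebra_hom_axioms.intro
        dom.group_algebra_axioms cod.group_algebra_axioms)
  have c: "coeff_map G \<omega> a \<in> carrier dom.A"
    using dom.coeff_map_closed [OF w assms(2)] .
  have "push L G H f (alg_act L G \<rho> \<omega> a) = push L G H f (push L G G (\<rho> \<omega>) (coeff_map G \<omega> a))"
    using dom.alg_act_eq_push [where \<rho> = \<rho>, OF w \<rho>(2) assms(2)] by simp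
  also have "\<dots> = push L G H (\<lambda>x. f (\<rho> \<omega> x)) (coeff_map G \<omega> a)"
    by (rule push_push [OF \<rho>(1) group_algebra_hom_axioms c])
  also have "\<dots> = push L G H (\<lambda>x. \<rho>' \<omega> (f x)) (coeff_map G \<omega> a)"
    by (rule push_cong) (simp add: equivariant assms(1))
  also have "\<dots> = push L H H (\<rho>' \<omega>) (push L G H f (coeff_map G \<omega> a))"
    by (rule push_push [OF group_algebra_hom_axioms \<rho>'(1) c, symmetric])
  also have "\<dots> = alg_act L H \<rho>' \<omega> (push L G H f a)"
    using push_coeff_map [OF dom.coef.is_cring w assms(2)]
      cod.alg_act_eq_push [where \<rho> = \<rho>', OF w \<rho>'(2) push_closed [OF assms(2)]] by simp
  finally show ?thesis .
qed

lemma alg_act_closed: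
  assumes "\<omega> \<in> abs_gal L K" "a \<in> carrier dom.A"
  shows "alg_act L G \<rho> \<omega> a \<in> carrier dom.A"
proof (rule dom.memI)
  fix g assume g: "g \<in> carrier G"
  then have "inv_into (carrier G) (\<rho> \<omega>) g \<in> carrier G"
    using \<rho>_iso [OF assms(1)] by (auto simp: iso_def bij_betw_def intro: inv_into_into)
  then show "alg_act L G \<rho> \<omega> a g \<in> carrier L"
    using g ring_hom_closed [OF abs_gal_ring_hom [OF assms(1)]] dom.elem_closed [OF assms(2)]
    by (simp add: alg_act_def)
qed (simp add: alg_act_def)

context
  fixes \<alpha> R B
  assumes \<alpha>: "\<alpha> \<in> HH L K G \<rho> R B" and B: "B \<subseteq> carrier dom.A"
begin

lemma push_resolvent:
  assumes "\<omega> \<in> abs_gal L K"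
  shows "alg_act L H \<rho>' \<omega> (push L G H f \<alpha>) \<otimes>\<^bsub>cod.A\<^esub> inv\<^bsub>cod.A\<^esub> (push L G H f \<alpha>) =
    grp_elem L H (f (resolvent_cocycle L K G \<rho> \<alpha> \<omega>))"
proof -
  have u: "\<alpha> \<in> Units dom.A"
    using dom.HH_subset_Units [OF B] \<alpha> by auto
  have "grp_elem L H (f (resolvent_cocycle L K G \<rho> \<alpha> \<omega>)) =
      push L G H f (alg_act L G \<rho> \<omega> \<alpha> \<otimes>\<^bsub>dom.A\<^esub> inv\<^bsub>dom.A\<^esub> \<alpha>)"
    using dom.resolvent_cocycle [OF one_not_zero \<alpha> assms] push_grp_elem by metis
  also have "\<dots> = alg_act L H \<rho>' \<omega> (push L G H f \<alpha>) \<otimes>\<^bsub>cod.A\<^esub> inv\<^bsub>cod.A\<^esub> (push L G H f \<alpha>)"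
    using u by (simp add: push_mult alg_act_closed assms push_alg_act push_inv dom.Units_closed)
  finally show ?thesis by simp
qed

lemma push_HH:
  assumes "push L G H f ` B \<subseteq> C"
  shows "push L G H f \<alpha> \<in> HH L K H \<rho>' R C"
  unfolding HH_def
proof (intro CollectI conjI ballI)
  let ?R = "integral_closure L R"
  have "push L G H f ` span_over L G ?R B \<subseteq> span_over L H ?R C"
    unfolding push_span_over [OF integral_closure_subset B] by (rule span_over_mono [OF assms])
  then show "push L G H f \<alpha> \<in> sub_units L H (span_over L H ?R C)"
    using \<alpha> by (intro push_sub_units [OF dom.span_over_subset [OF integral_closure_subset B]])
      (auto simp: HH_def)
  fix \<omega> assume "\<omega> \<in> abs_gal L K"
  then show "alg_act L H \<rho>' \<omega> (push L G H f \<alpha>) \<otimes>\<^bsub>cod.A\<^esub> inv\<^bsub>cod.A\<^esub> (push L G H f \<alpha>)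
      \<in> grp_elem L H ` carrier H"
    using dom.resolvent_cocycle [OF one_not_zero \<alpha>] by (simp add: push_resolvent)
qed

lemma push_resolvent_cocycle:
  assumes "\<omega> \<in> abs_gal L K"
  shows "resolvent_cocycle L K H \<rho>' (push L G H f \<alpha>) \<omega> = f (resolvent_cocycle L K G \<rho> \<alpha> \<omega>)"
proof -
  \<comment> \<open>The cocycle is defined by \<open>THE\<close>, so the pushed element must first
    be known to be a resolvent of some algebra; the image of \<open>B\<close> serves.\<close>
  have "push L G H f \<alpha> \<in> HH L K H \<rho>' R (push L G H f ` B)"
    by (rule push_HH) simp
  from cod.resolvent_cocycle [OF one_not_zero this assms]
  show ?thesis
    using push_resolvent [OF assms] cod.grp_elem_inj [OF one_not_zero] by metis
qed

end

abbreviation "\<Omega> \<equiv> abs_gal L K"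

lemma f_cochain_hom:
  "(\<lambda>c. \<lambda>\<omega>\<in>\<Omega>. f (c \<omega>)) \<in> hom (product_group \<Omega> (\<lambda>_. G)) (product_group \<Omega> (\<lambda>_. H))"
  by (rule homI) (auto simp: PiE_iff)

lemma f_coboundaries:
  "(\<lambda>c. \<lambda>\<omega>\<in>\<Omega>. f (c \<omega>)) ` coboundaries L K G \<rho> \<subseteq> coboundaries L K H \<rho>'"
proof -
  have "(\<lambda>\<omega>\<in>\<Omega>. f ((\<lambda>\<omega>\<in>\<Omega>. \<rho> \<omega> g \<otimes>\<^bsub>G\<^esub> inv\<^bsub>G\<^esub> g) \<omega>)) =
      (\<lambda>\<omega>\<in>\<Omega>. \<rho>' \<omega> (f g) \<otimes>\<^bsub>H\<^esub> inv\<^bsub>H\<^esub> (f g))" if g: "g \<in> carrier G" for g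
  proof (rule restrict_ext)
    fix \<omega> assume w: "\<omega> \<in> \<Omega>"
    have "\<rho> \<omega> g \<in> carrier G"
      using \<rho>_iso [OF w] g by (auto simp: iso_def hom_def)
    then show "f ((\<lambda>\<omega>\<in>\<Omega>. \<rho> \<omega> g \<otimes>\<^bsub>G\<^esub> inv\<^bsub>G\<^esub> g) \<omega>) = \<rho>' \<omega> (f g) \<otimes>\<^bsub>H\<^esub> inv\<^bsub>H\<^esub> (f g)"
      using g w by (simp add: equivariant)
  qed
  then show ?thesis by (auto simp: coboundaries_def)
qed

lemma f_coset:
  assumes "c \<in> \<Omega> \<rightarrow>\<^sub>E carrier G"
  shows "coboundaries L K H \<rho>' <#>\<^bsub>cocycles L K H \<rho>'\<^esub>
      (\<lambda>c. \<lambda>\<omega>\<in>\<Omega>. f (c \<omega>)) ` (coboundaries L K G \<rho> #>\<^bsub>cocycles L K G \<rho>\<^esub> c) =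
    coboundaries L K H \<rho>' #>\<^bsub>cocycles L K H \<rho>'\<^esub> (\<lambda>\<omega>\<in>\<Omega>. f (c \<omega>))"
  unfolding cocycles_set_mult cocycles_r_coset
proof (rule coset_image [OF _ _ f_cochain_hom _ _ f_coboundaries])
  show "subgroup (coboundaries L K G \<rho>) (product_group \<Omega> (\<lambda>_. G))"
    by (rule coboundaries_subgroup [OF dom.grp.comm_group_axioms]) (use \<rho>_iso in \<open>auto simp: iso_def\<close>)
  show "subgroup (coboundaries L K H \<rho>') (product_group \<Omega> (\<lambda>_. H))"
    by (rule coboundaries_subgroup [OF cod.grp.comm_group_axioms]) (use \<rho>'_iso in \<open>auto simp: iso_def\<close>)
qed (use assms in auto)

text \<open>The right side has the shape of \<open>p_map\<close>, so the global case is mere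
  unfolding; locally it is combined with \<open>f_coset\<close>.\<close>

lemma cls_push:
  assumes "\<alpha> \<in> HH L K G \<rho> R B" "B \<subseteq> carrier dom.A"
  shows "cls L K H \<rho>' (push L G H f \<alpha>) =
    coboundaries L K H \<rho>' <#>\<^bsub>cocycles L K H \<rho>'\<^esub> (\<lambda>c. \<lambda>\<omega>\<in>\<Omega>. f (c \<omega>)) ` cls L K G \<rho> \<alpha>"
proof -
  let ?c = "resolvent_cocycle L K G \<rho> \<alpha>"
  have c: "?c \<in> \<Omega> \<rightarrow>\<^sub>E carrier G"
    using dom.resolvent_cocycle(1) [OF one_not_zero assms(1)]
    by (auto simp: PiE_iff) (simp add: resolvent_cocycle_def)
  have "resolvent_cocycle L K H \<rho>' (push L G H f \<alpha>) = (\<lambda>\<omega>\<in>\<Omega>. f (?c \<omega>))"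
    using push_resolvent_cocycle [OF assms] unfolding resolvent_cocycle_def [of L K H]
    by (auto simp: fun_eq_iff)
  then show ?thesis
    using f_coset [OF c] by (simp add: cls_eq cocycles_r_coset)
qed

end


section \<open>Lattices over the \<open>p\<close>-adic integers\<close>

text \<open>Two consequences of freeness are extracted: \<open>p^n\<close> acts injectively on
  \<open>T\<close> (\<open>q_inj\<close>), and \<open>p^(-n)T/T\<close> is finite
  (\<open>finite_pdiv\<close>).\<close>

locale padic_lattice = module "padic_int p" T
  for p :: nat and T :: "(nat \<Rightarrow> int, 't) module" +
  assumes p_gt_0: "p > 0"
    and free: "free_of_finite_rank (padic_int p) T"
begin

abbreviation "Zp \<equiv> padic_int p"

abbreviation q :: "nat \<Rightarrow> 't \<Rightarrow> 't" where "q n t \<equiv> add_pow T (p ^ n) t"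

lemma padic_mod:
  assumes "x \<in> carrier Zp"
  shows "x (m + n) mod int p ^ m = x m"
proof (induction n)
  case 0
  then show ?case using assms by (auto simp: padic_int_def)
next
  case (Suc n)
  have "x (m + n) = x (Suc (m + n)) mod int p ^ (m + n)"
    using assms by (auto simp: padic_int_def)
  then have "x (m + n) mod int p ^ m = x (Suc (m + n)) mod int p ^ m"
    by (metis le_add1 le_imp_power_dvd mod_mod_cancel)
  then show ?case using Suc by simp
qed

lemma padic_range:
  assumes "x \<in> carrier Zp"
  shows "0 \<le> x m" "x m < int p ^ m"
  using assms by (auto simp: padic_int_def)

lemma padic_add_pow:
  assumes "x \<in> carrier Zp"
  shows "(add_pow Zp (k::nat) x) m = (int k * x m) mod int p ^ m"
proof (induction k)
  case 0
  have "add_pow Zp (0::nat) x = \<zero>\<^bsub>Zp\<^esub>" by simp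
  then show ?case by (simp only:) (simp add: padic_int_def)
next
  case (Suc k)
  have "add_pow Zp (Suc k) x = add_pow Zp k x \<oplus>\<^bsub>Zp\<^esub> x" by simp
  then have "add_pow Zp (Suc k) x m = (add_pow Zp k x m + x m) mod int p ^ m"
    by (simp only:) (simp add: padic_int_def)
  then show ?case using Suc by (simp add: mod_simps algebra_simps)
qed

text \<open>Multiplication by \<open>p^n\<close> costs \<open>n\<close> digits: that
  \<open>x m\<close> vanishes is read off from the residue of the product modulo
  \<open>p^(m+n)\<close>.\<close>

lemma padic_torsion_free:
  assumes "x \<in> carrier Zp" "add_pow Zp (p ^ n) x = \<zero>\<^bsub>Zp\<^esub>"
  shows "x = \<zero>\<^bsub>Zp\<^esub>"
proof
  fix m
  have "(int (p ^ n) * x (m + n)) mod int p ^ (m + n) = 0"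
    using padic_add_pow [OF assms(1), of "p ^ n" "m + n"] assms(2) by (simp add: padic_int_def)
  then have "int p ^ n * int p ^ m dvd int p ^ n * x (m + n)"
    by (simp add: mod_0_imp_dvd power_add mult.commute)
  then have "int p ^ m dvd x (m + n)"
    using p_gt_0 by simp
  then show "x m = \<zero>\<^bsub>Zp\<^esub> m"
    using padic_mod [OF assms(1), of m n] by (simp add: padic_int_def)
qed

text \<open>A p-adic integer whose residue modulo \<open>p^n\<close> is zero is divisible by
  \<open>p^n\<close>; here this is applied to the difference \<open>?d\<close>.\<close>

lemma padic_divide:
  assumes "x \<in> carrier Zp" "y \<in> carrier Zp" "x n = y n"
  obtains z where "z \<in> carrier Zp" "x = y \<oplus>\<^bsub>Zp\<^esub> add_pow Zp (p ^ n) z"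
proof -
  let ?d = "x \<ominus>\<^bsub>Zp\<^esub> y"
  have d: "?d \<in> carrier Zp" and xd: "x = y \<oplus>\<^bsub>Zp\<^esub> ?d"
    using assms by (auto simp: R.minus_eq R.a_lcomm R.r_neg)
  have "x n = (y n + ?d n) mod int p ^ n"
    using arg_cong [OF xd, of "\<lambda>f. f n"] by (simp add: padic_int_def)
  then have "(y n + ?d n) mod int p ^ n = (y n + 0) mod int p ^ n"
    using assms padic_range [OF assms(2), of n] by simp
  \<comment> \<open>The residue is divisible by \<open>p^n\<close> and lies in the range from 0 to
    \<open>p^n - 1\<close>.\<close>
  then have dn: "?d n = 0"
    using padic_range [OF d, of n] zdvd_not_zless [of "?d n" "int p ^ n"]
    by (cases "0 < ?d n") (simp_all add: mod_eq_dvd_iff)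
  \<comment> \<open>The index is shifted by \<open>n\<close>, because the quotient modulo
    \<open>p^m\<close> is determined by the dividend modulo \<open>p^(m+n)\<close>.\<close>
  define z where "z = (\<lambda>m. ?d (m + n) div int p ^ n)"
  have z: "z \<in> carrier Zp"
  proof -
    have "0 \<le> z m \<and> z m < int p ^ m \<and> z (Suc m) mod int p ^ m = z m" for m
    proof (intro conjI)
      show "0 \<le> z m" using padic_range [OF d, of "m + n"] by (simp add: z_def pos_imp_zdiv_nonneg_iff p_gt_0)
      have "int p ^ n * z m \<le> ?d (m + n)"
        using mult_div_mod_eq [of "int p ^ n" "?d (m + n)"]
          pos_mod_sign [of "int p ^ n" "?d (m + n)"] p_gt_0 unfolding z_def by (smt (verit) zero_less_power of_nat_0_less_iff)
      also have "\<dots> < int p ^ n * int p ^ m"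
        using padic_range(2) [OF d, of "m + n"] by (simp add: power_add mult.commute)
      finally show "z m < int p ^ m" using p_gt_0 by simp
      \<comment> \<open>Coherence of \<open>z\<close> comes from that of \<open>?d\<close> at level
        \<open>m + n\<close>: the remainder modulo \<open>p^n * p^m\<close> is split into its
        quotient and remainder by \<open>p^n\<close>.\<close>
      have "?d (m + n) = ?d (Suc m + n) mod (int p ^ n * int p ^ m)"
        using padic_mod [OF d, of "m + n" 1] by (simp add: power_add mult.commute)
      also have "\<dots> = int p ^ n * ((?d (Suc m + n) div int p ^ n) mod int p ^ m) + ?d (Suc m + n) mod int p ^ n"
        by (rule zmod_zmult2_eq) simp
      finally have "?d (m + n) div int p ^ n = (?d (Suc m + n) div int p ^ n) mod int p ^ m"
        using p_gt_0 by (simp add: div_pos_pos_trivial)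
      then show "z (Suc m) mod int p ^ m = z m" by (simp add: z_def)
    qed
    then show ?thesis by (auto simp: padic_int_def)
  qed
  have "?d = add_pow Zp (p ^ n) z"
  proof
    fix m
    have "int p ^ n dvd ?d (m + n)"
      using padic_mod [OF d, of n m] dn by (simp add: add.commute mod_0_imp_dvd)
    then have "int (p ^ n) * z m = ?d (m + n)" by (simp add: z_def)
    then show "?d m = add_pow Zp (p ^ n) z m"
      using padic_add_pow [OF z] padic_mod [OF d, of m n] by simp
  qed
  with z xd show ?thesis using that by metis
qed

lemma q_closed [simp, intro]: "t \<in> carrier T \<Longrightarrow> q n t \<in> carrier T"
  by (rule M.add.nat_pow_closed)

lemma q_add: "s \<in> carrier T \<Longrightarrow> t \<in> carrier T \<Longrightarrow> q n (s \<oplus>\<^bsub>T\<^esub> t) = q n s \<oplus>\<^bsub>T\<^esub> q n t"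
  by (rule M.add.nat_pow_distrib)

lemma q_q: "t \<in> carrier T \<Longrightarrow> q n (q m t) = q (n + m) t"
  by (simp add: M.add.nat_pow_pow power_add mult.commute)

lemma q_minus: "t \<in> carrier T \<Longrightarrow> q n (\<ominus>\<^bsub>T\<^esub> t) = \<ominus>\<^bsub>T\<^esub> q n t"
  by (rule M.add.nat_pow_inv)

lemma add_pow_smult:
  assumes "a \<in> carrier Zp" "t \<in> carrier T"
  shows "add_pow T (k::nat) (a \<odot>\<^bsub>T\<^esub> t) = add_pow Zp k a \<odot>\<^bsub>T\<^esub> t"
  by (induction k) (use assms in \<open>simp_all add: smult_l_distr\<close>)

lemma add_pow_finsum:
  assumes "finite B" "g \<in> B \<rightarrow> carrier T"
  shows "add_pow T (k::nat) (\<Oplus>\<^bsub>T\<^esub>b\<in>B. g b) = (\<Oplus>\<^bsub>T\<^esub>b\<in>B. add_pow T k (g b))"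
  using assms
proof (induction B)
  case (insert b B)
  then have "g b \<in> carrier T" "g \<in> B \<rightarrow> carrier T" by auto
  then show ?case using insert
    by (simp add: M.add.nat_pow_distrib M.add.nat_pow_closed Pi_def)
qed simp

lemma add_pow_comb:
  assumes "finite B" "B \<subseteq> carrier T" "c \<in> B \<rightarrow> carrier Zp"
  shows "add_pow T (k::nat) (\<Oplus>\<^bsub>T\<^esub>b\<in>B. c b \<odot>\<^bsub>T\<^esub> b) = (\<Oplus>\<^bsub>T\<^esub>b\<in>B. add_pow Zp k (c b) \<odot>\<^bsub>T\<^esub> b)"
proof -
  have "add_pow T k (\<Oplus>\<^bsub>T\<^esub>b\<in>B. c b \<odot>\<^bsub>T\<^esub> b) = (\<Oplus>\<^bsub>T\<^esub>b\<in>B. add_pow T k (c b \<odot>\<^bsub>T\<^esub> b))"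
    using assms by (intro add_pow_finsum) auto
  also have "\<dots> = (\<Oplus>\<^bsub>T\<^esub>b\<in>B. add_pow Zp k (c b) \<odot>\<^bsub>T\<^esub> b)"
    using assms by (intro M.finsum_cong' refl) (auto simp: add_pow_smult subset_iff Pi_def intro!: smult_closed R.add.nat_pow_closed)
  finally show ?thesis .
qed

text \<open>Coordinates as a function. The last clause is uniqueness for families that need not be
  extensional, so that a coefficient formula can be inserted directly.\<close>

lemma basis:
  obtains B coord where "finite B" "B \<subseteq> carrier T"
    and "\<And>t. t \<in> carrier T \<Longrightarrow> coord t \<in> B \<rightarrow>\<^sub>E carrier Zp"
    and "\<And>t. t \<in> carrier T \<Longrightarrow> t = (\<Oplus>\<^bsub>T\<^esub>b\<in>B. coord t b \<odot>\<^bsub>T\<^esub> b)"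
    and "\<And>t c. c \<in> B \<rightarrow> carrier Zp \<Longrightarrow> t = (\<Oplus>\<^bsub>T\<^esub>b\<in>B. c b \<odot>\<^bsub>T\<^esub> b) \<Longrightarrow>
      t \<in> carrier T \<and> (\<forall>b\<in>B. coord t b = c b)"
proof -
  obtain B where B: "finite B" "B \<subseteq> carrier T"
    "\<forall>t\<in>carrier T. \<exists>!c. c \<in> B \<rightarrow>\<^sub>E carrier Zp \<and> t = (\<Oplus>\<^bsub>T\<^esub>b\<in>B. c b \<odot>\<^bsub>T\<^esub> b)"
    using free by (auto simp: free_of_finite_rank_def)
  define coord where
    "coord t = (THE c. c \<in> B \<rightarrow>\<^sub>E carrier Zp \<and> t = (\<Oplus>\<^bsub>T\<^esub>b\<in>B. c b \<odot>\<^bsub>T\<^esub> b))" for t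
  have coord: "coord t \<in> B \<rightarrow>\<^sub>E carrier Zp \<and> t = (\<Oplus>\<^bsub>T\<^esub>b\<in>B. coord t b \<odot>\<^bsub>T\<^esub> b)"
    if "t \<in> carrier T" for t
    using theI' [OF B(3) [rule_format, OF that]] by (simp add: coord_def)
  show ?thesis
  proof (rule that [OF B(1,2)])
    fix t c assume c: "c \<in> B \<rightarrow> carrier Zp" and t: "t = (\<Oplus>\<^bsub>T\<^esub>b\<in>B. c b \<odot>\<^bsub>T\<^esub> b)"
    have tT: "t \<in> carrier T"
      unfolding t using c B(2) by (intro M.finsum_closed) (auto intro!: smult_closed)
    have "t = (\<Oplus>\<^bsub>T\<^esub>b\<in>B. restrict c B b \<odot>\<^bsub>T\<^esub> b)"
      unfolding t using c B(2) by (intro M.finsum_cong' refl) (auto intro!: smult_closed)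
    moreover have "restrict c B \<in> B \<rightarrow>\<^sub>E carrier Zp" using c by auto
    ultimately have "coord t = restrict c B"
      using B(3) tT coord [OF tT] by blast
    then show "t \<in> carrier T \<and> (\<forall>b\<in>B. coord t b = c b)" using tT by simp
  qed (use coord in auto)
qed

text \<open>Torsion-freeness is what makes the relation defining \<open>pfrac\<close> transitive.\<close>

lemma q_eq_zero:
  assumes "t \<in> carrier T" "q n t = \<zero>\<^bsub>T\<^esub>"
  shows "t = \<zero>\<^bsub>T\<^esub>"
proof -
  obtain B coord where B: "finite B" "B \<subseteq> carrier T"
    and coord: "\<And>t. t \<in> carrier T \<Longrightarrow> coord t \<in> B \<rightarrow>\<^sub>E carrier Zp"
      "\<And>t. t \<in> carrier T \<Longrightarrow> t = (\<Oplus>\<^bsub>T\<^esub>b\<in>B. coord t b \<odot>\<^bsub>T\<^esub> b)"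
    and uniq: "\<And>t c. c \<in> B \<rightarrow> carrier Zp \<Longrightarrow> t = (\<Oplus>\<^bsub>T\<^esub>b\<in>B. c b \<odot>\<^bsub>T\<^esub> b) \<Longrightarrow>
      t \<in> carrier T \<and> (\<forall>b\<in>B. coord t b = c b)"
    using basis by blast
  have c: "coord t \<in> B \<rightarrow> carrier Zp" using coord(1) [OF assms(1)] by auto
  have "q n t = (\<Oplus>\<^bsub>T\<^esub>b\<in>B. add_pow Zp (p ^ n) (coord t b) \<odot>\<^bsub>T\<^esub> b)"
    using add_pow_comb [OF B c, of "p ^ n"] coord(2) [OF assms(1)] by simp
  \<comment> \<open>The zero vector now has two expansions, the scaled one of \<open>t\<close> and
    the trivial one; uniqueness equates them, and \<open>Zp\<close> has no torsion.\<close>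
  then have "\<forall>b\<in>B. coord \<zero>\<^bsub>T\<^esub> b = add_pow Zp (p ^ n) (coord t b)"
    using uniq [of "\<lambda>b. add_pow Zp (p ^ n) (coord t b)" "\<zero>\<^bsub>T\<^esub>"] c assms(2)
    by (auto intro!: R.add.nat_pow_closed)
  moreover have "\<zero>\<^bsub>T\<^esub> = (\<Oplus>\<^bsub>T\<^esub>b\<in>B. \<zero>\<^bsub>Zp\<^esub> \<odot>\<^bsub>T\<^esub> b)"
  proof -
    have "(\<Oplus>\<^bsub>T\<^esub>b\<in>B. \<zero>\<^bsub>Zp\<^esub> \<odot>\<^bsub>T\<^esub> b) = (\<Oplus>\<^bsub>T\<^esub>b\<in>B. \<zero>\<^bsub>T\<^esub>)"
      using B by (intro M.finsum_cong' refl) auto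
    then show ?thesis by simp
  qed
  then have "\<forall>b\<in>B. coord \<zero>\<^bsub>T\<^esub> b = \<zero>\<^bsub>Zp\<^esub>"
    using uniq [of "\<lambda>b. \<zero>\<^bsub>Zp\<^esub>" "\<zero>\<^bsub>T\<^esub>"] by auto
  ultimately have "\<forall>b\<in>B. coord t b = \<zero>\<^bsub>Zp\<^esub>"
    using padic_torsion_free c by (metis PiE Pi_mem)
  then have "t = (\<Oplus>\<^bsub>T\<^esub>b\<in>B. \<zero>\<^bsub>Zp\<^esub> \<odot>\<^bsub>T\<^esub> b)"
    using B by (subst coord(2) [OF assms(1)], intro M.finsum_cong' refl) (auto intro!: smult_closed)
  then show ?thesis using \<open>\<zero>\<^bsub>T\<^esub> = (\<Oplus>\<^bsub>T\<^esub>b\<in>B. \<zero>\<^bsub>Zp\<^esub> \<odot>\<^bsub>T\<^esub> b)\<close> by simp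
qed

lemma q_inj:
  assumes "s \<in> carrier T" "t \<in> carrier T" "q n s = q n t"
  shows "s = t"
proof -
  have "q n (s \<ominus>\<^bsub>T\<^esub> t) = \<zero>\<^bsub>T\<^esub>"
    using assms by (simp add: M.minus_eq q_add q_minus M.r_neg)
  then have "s \<ominus>\<^bsub>T\<^esub> t = \<zero>\<^bsub>T\<^esub>" by (rule q_eq_zero [rotated]) (use assms in simp)
  then have "s = t \<oplus>\<^bsub>T\<^esub> \<zero>\<^bsub>T\<^esub>"
    using assms(1,2) by (metis M.a_assoc M.a_comm M.a_inv_closed M.minus_eq M.r_neg M.r_zero)
  then show ?thesis using assms(2) by simp
qed

end


section \<open>The groups \<open>p^{-n}T/T\<close>\<close>

context padic_lattice
begin

text \<open>The relation \<open>p^(-n)t = p^(-k)s + a\<close> with \<open>a\<close> in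
  \<open>T\<close>, multiplied by \<open>p^(n+k)\<close>. Having a sum instead of the difference in
  \<open>pfrac\<close> eases rewriting.\<close>

definition frac_rel :: "nat \<Rightarrow> 't \<Rightarrow> nat \<Rightarrow> 't \<Rightarrow> bool" where
  "frac_rel n t k s \<longleftrightarrow> (\<exists>a\<in>carrier T. q k t = q n s \<oplus>\<^bsub>T\<^esub> q (n + k) a)"

lemma pfrac_eq:
  assumes "t \<in> carrier T"
  shows "pfrac p T n t = {(k, s). s \<in> carrier T \<and> frac_rel n t k s}"
proof -
  have "q k t \<ominus>\<^bsub>T\<^esub> q n s \<in> p_multiples p T (n + k) \<longleftrightarrow> frac_rel n t k s" if s: "s \<in> carrier T" for k s
  proof -
    have "q k t \<ominus>\<^bsub>T\<^esub> q n s = q (n + k) a \<longleftrightarrow> q k t = q n s \<oplus>\<^bsub>T\<^esub> q (n + k) a" if a: "a \<in> carrier T" for a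
    proof
      assume "q k t \<ominus>\<^bsub>T\<^esub> q n s = q (n + k) a"
      then have "q n s \<oplus>\<^bsub>T\<^esub> q (n + k) a = q n s \<oplus>\<^bsub>T\<^esub> (q k t \<ominus>\<^bsub>T\<^esub> q n s)" by simp
      also have "\<dots> = q k t" using assms s by (simp add: M.minus_eq M.a_lcomm M.r_neg)
      finally show "q k t = q n s \<oplus>\<^bsub>T\<^esub> q (n + k) a" by simp
    next
      assume "q k t = q n s \<oplus>\<^bsub>T\<^esub> q (n + k) a"
      then have "q k t \<ominus>\<^bsub>T\<^esub> q n s = \<ominus>\<^bsub>T\<^esub> q n s \<oplus>\<^bsub>T\<^esub> (q n s \<oplus>\<^bsub>T\<^esub> q (n + k) a)"
        using s a by (simp add: M.minus_eq M.a_comm)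
      also have "\<dots> = q (n + k) a" using s a by (simp add: M.a_assoc [symmetric] M.l_neg)
      finally show "q k t \<ominus>\<^bsub>T\<^esub> q n s = q (n + k) a" .
    qed
    then show ?thesis by (auto simp: p_multiples_def frac_rel_def image_iff)
  qed
  then show ?thesis by (auto simp: pfrac_def)
qed

lemma frac_rel_refl: "t \<in> carrier T \<Longrightarrow> frac_rel n t n t"
  unfolding frac_rel_def by (rule bexI [of _ "\<zero>\<^bsub>T\<^esub>"]) auto

lemma frac_rel_sym:
  assumes "t \<in> carrier T" "s \<in> carrier T" "frac_rel n t k s"
  shows "frac_rel k s n t"
proof -
  obtain a where a: "a \<in> carrier T" "q k t = q n s \<oplus>\<^bsub>T\<^esub> q (n + k) a"
    using assms(3) by (auto simp: frac_rel_def)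
  then have "q n s = q k t \<oplus>\<^bsub>T\<^esub> q (k + n) (\<ominus>\<^bsub>T\<^esub> a)"
    using assms by (simp add: q_minus M.a_assoc M.r_neg add.commute)
  then show ?thesis using a by (auto simp: frac_rel_def intro!: bexI [of _ "\<ominus>\<^bsub>T\<^esub> a"])
qed

text \<open>Scale the two relations by \<open>p^m\<close> and \<open>p^n\<close> so that the middle
  terms agree. A common factor \<open>p^k\<close> remains and is cancelled by
  \<open>q_inj\<close>.\<close>

lemma frac_rel_trans:
  assumes T: "t \<in> carrier T" "s \<in> carrier T" "u \<in> carrier T"
    and "frac_rel n t k s" "frac_rel k s m u"
  shows "frac_rel n t m u"
proof -
  obtain a where a: "a \<in> carrier T" "q k t = q n s \<oplus>\<^bsub>T\<^esub> q (n + k) a"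
    using assms(4) by (auto simp: frac_rel_def)
  obtain b where b: "b \<in> carrier T" "q m s = q k u \<oplus>\<^bsub>T\<^esub> q (k + m) b"
    using assms(5) by (auto simp: frac_rel_def)
  have "q k (q m t) = q m (q k t)"
    using T by (simp add: q_q add.commute)
  also have "\<dots> = q n (q m s) \<oplus>\<^bsub>T\<^esub> q (n + k + m) a"
    using T a by (simp add: q_add q_q ac_simps)
  also have "\<dots> = q k (q n u) \<oplus>\<^bsub>T\<^esub> (q (n + k + m) b \<oplus>\<^bsub>T\<^esub> q (n + k + m) a)"
    using T a b by (simp add: q_add q_q ac_simps M.a_assoc)
  also have "\<dots> = q k (q n u \<oplus>\<^bsub>T\<^esub> q (n + m) (b \<oplus>\<^bsub>T\<^esub> a))"
    using T a b by (simp add: q_add q_q ac_simps)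
  finally have "q m t = q n u \<oplus>\<^bsub>T\<^esub> q (n + m) (b \<oplus>\<^bsub>T\<^esub> a)"
    by (rule q_inj [rotated 2]) (use T a b in auto)
  then show ?thesis using a b by (auto simp: frac_rel_def)
qed

text \<open>\<open>pfrac p T n t\<close> is the equivalence class of the pair
  \<open>(n, t)\<close>.\<close>

lemma pfrac_eq_iff:
  assumes "t \<in> carrier T" "s \<in> carrier T"
  shows "pfrac p T n t = pfrac p T k s \<longleftrightarrow> frac_rel n t k s"
proof
  assume "pfrac p T n t = pfrac p T k s"
  moreover have "(k, s) \<in> pfrac p T k s"
    using assms frac_rel_refl by (simp add: pfrac_eq)
  ultimately show "frac_rel n t k s"
    using assms by (auto simp: pfrac_eq)
next
  assume "frac_rel n t k s"
  with assms show "pfrac p T n t = pfrac p T k s"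
    by (auto simp: pfrac_eq intro: frac_rel_trans frac_rel_sym)
qed

text \<open>Cancellation of \<open>p^m\<close> in a fraction. Read with \<open>m = 1\<close>, it is
  the reason why multiplication by \<open>p\<close> lowers the level by one.\<close>

lemma pfrac_raise:
  assumes "t \<in> carrier T"
  shows "pfrac p T (n + m) (q m t) = pfrac p T n t"
proof -
  have "frac_rel (n + m) (q m t) n t"
    unfolding frac_rel_def using assms by (intro bexI [of _ "\<zero>\<^bsub>T\<^esub>"]) (auto simp: q_q)
  then show ?thesis using assms by (simp add: pfrac_eq_iff)
qed

text \<open>The product is a union over all pairs of representatives; each pair contributes the same
  class. The multiplication does not mention the level, hence the free \<open>m\<close>.\<close>

lemma pfrac_mult:
  assumes "s \<in> carrier T" "t \<in> carrier T"
  shows "pfrac p T n s \<otimes>\<^bsub>pdiv_group p T m\<^esub> pfrac p T n t = pfrac p T n (s \<oplus>\<^bsub>T\<^esub> t)"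
proof -
  have "pfrac p T (k + l) (q l s' \<oplus>\<^bsub>T\<^esub> q k t') = pfrac p T n (s \<oplus>\<^bsub>T\<^esub> t)"
    if st': "(k, s') \<in> pfrac p T n s" "(l, t') \<in> pfrac p T n t" for k s' l t'
  proof -
    obtain a where s': "s' \<in> carrier T" and a: "a \<in> carrier T" "q k s = q n s' \<oplus>\<^bsub>T\<^esub> q (n + k) a"
      using st'(1) assms by (auto simp: pfrac_eq frac_rel_def)
    obtain b where t': "t' \<in> carrier T" and b: "b \<in> carrier T" "q l t = q n t' \<oplus>\<^bsub>T\<^esub> q (n + l) b"
      using st'(2) assms by (auto simp: pfrac_eq frac_rel_def)
    have "q (k + l) (s \<oplus>\<^bsub>T\<^esub> t) = q l (q k s) \<oplus>\<^bsub>T\<^esub> q k (q l t)"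
      using assms by (simp add: q_q q_add add.commute)
    also have "\<dots> = q n (q l s' \<oplus>\<^bsub>T\<^esub> q k t') \<oplus>\<^bsub>T\<^esub> q (n + (k + l)) (a \<oplus>\<^bsub>T\<^esub> b)"
      using s' t' a b by (simp add: q_q q_add ac_simps M.a_ac)
    finally have "frac_rel n (s \<oplus>\<^bsub>T\<^esub> t) (k + l) (q l s' \<oplus>\<^bsub>T\<^esub> q k t')"
      using a b by (auto simp: frac_rel_def)
    then have "pfrac p T n (s \<oplus>\<^bsub>T\<^esub> t) = pfrac p T (k + l) (q l s' \<oplus>\<^bsub>T\<^esub> q k t')"
      using assms s' t' by (subst pfrac_eq_iff) auto
    then show ?thesis by simp
  qed
  note eq = this
  \<comment> \<open>The union of a constant family is that constant only over a nonempty index set,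
    which these members provide.\<close>
  have mem: "(n, s) \<in> pfrac p T n s" "(n, t) \<in> pfrac p T n t"
    using assms frac_rel_refl by (simp_all add: pfrac_eq)
  have "(\<Union>(l, t')\<in>pfrac p T n t. pfrac p T (k + l) (q l s' \<oplus>\<^bsub>T\<^esub> q k t')) = pfrac p T n (s \<oplus>\<^bsub>T\<^esub> t)"
    if "(k, s') \<in> pfrac p T n s" for k s'
  proof -
    have "(\<Union>(l, t')\<in>pfrac p T n t. pfrac p T (k + l) (q l s' \<oplus>\<^bsub>T\<^esub> q k t')) =
        (\<Union>_\<in>pfrac p T n t. pfrac p T n (s \<oplus>\<^bsub>T\<^esub> t))"
      by (rule SUP_cong) (use eq [OF that] in auto)
    then show ?thesis using mem(2) by auto
  qed
  then have "(\<Union>(k, s')\<in>pfrac p T n s. \<Union>(l, t')\<in>pfrac p T n t.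
      pfrac p T (k + l) (q l s' \<oplus>\<^bsub>T\<^esub> q k t')) = (\<Union>_\<in>pfrac p T n s. pfrac p T n (s \<oplus>\<^bsub>T\<^esub> t))"
    by (intro SUP_cong) auto
  then show ?thesis using mem(1) by (auto simp: pdiv_group_def)
qed

abbreviation "\<Gamma> n \<equiv> pdiv_group p T n"

lemma carrier_pdiv: "carrier (\<Gamma> n) = pfrac p T n ` carrier T"
  by (simp add: pdiv_group_def)

lemma one_pdiv: "\<one>\<^bsub>\<Gamma> n\<^esub> = pfrac p T n \<zero>\<^bsub>T\<^esub>"
  by (simp add: pdiv_group_def)

lemma pdiv_comm_group: "comm_group (\<Gamma> n)"
proof (rule comm_groupI)
  fix x assume "x \<in> carrier (\<Gamma> n)"
  then obtain t where t: "t \<in> carrier T" "x = pfrac p T n t" by (auto simp: carrier_pdiv)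
  show "\<exists>y\<in>carrier (\<Gamma> n). y \<otimes>\<^bsub>\<Gamma> n\<^esub> x = \<one>\<^bsub>\<Gamma> n\<^esub>"
    using t by (intro bexI [of _ "pfrac p T n (\<ominus>\<^bsub>T\<^esub> t)"]) (auto simp: carrier_pdiv pfrac_mult one_pdiv M.l_neg)
qed (auto simp: carrier_pdiv one_pdiv pfrac_mult M.a_ac)

lemma pdiv_pow:
  assumes "t \<in> carrier T"
  shows "pfrac p T n t [^]\<^bsub>\<Gamma> n\<^esub> (k::nat) = pfrac p T n (add_pow T k t)"
  by (induction k) (use assms in \<open>simp_all add: one_pdiv pfrac_mult M.add.nat_pow_closed\<close>)

text \<open>\<open>p\<close> times \<open>p^(-n)t\<close> is \<open>p^(-(n-1))t\<close>;
  \<open>n \<ge> 1\<close> keeps the truncated subtraction honest.\<close>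

lemma pdiv_pow_p:
  assumes "t \<in> carrier T" "n \<ge> 1"
  shows "pfrac p T n t [^]\<^bsub>\<Gamma> n\<^esub> p = pfrac p T (n - 1) t"
  using pdiv_pow [OF assms(1), of n p] pfrac_raise [OF assms(1), of "n - 1" 1] assms(2) by simp

lemma pow_p_hom:
  assumes "n \<ge> 1"
  shows "(\<lambda>x. x [^]\<^bsub>\<Gamma> n\<^esub> p) \<in> hom (\<Gamma> n) (\<Gamma> (n - 1))"
  using assms by (intro homI) (auto simp: carrier_pdiv pfrac_mult pdiv_pow_p)

text \<open>A class is determined by the residues modulo \<open>p^n\<close> of the coordinates of a
  representative, and there are finitely many such residue vectors.\<close>

lemma finite_pdiv: "finite (carrier (\<Gamma> n))"
proof -
  obtain B coord where B: "finite B" "B \<subseteq> carrier T"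
    and coord: "\<And>t. t \<in> carrier T \<Longrightarrow> coord t \<in> B \<rightarrow>\<^sub>E carrier Zp"
      "\<And>t. t \<in> carrier T \<Longrightarrow> t = (\<Oplus>\<^bsub>T\<^esub>b\<in>B. coord t b \<odot>\<^bsub>T\<^esub> b)"
    by (rule basis) (rule that; assumption)
  define code where "code t = (\<lambda>b\<in>B. coord t b n)" for t
  have eq: "pfrac p T n s = pfrac p T n t"
    if st: "s \<in> carrier T" "t \<in> carrier T" and "code s = code t" for s t
  proof -
    have "\<exists>z. z \<in> carrier Zp \<and> coord s b = coord t b \<oplus>\<^bsub>Zp\<^esub> add_pow Zp (p ^ n) z" if b: "b \<in> B" for b
    proof -
      have "coord s b n = coord t b n"
        using fun_cong [OF \<open>code s = code t\<close>, of b] b by (simp add: code_def)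
      moreover have "coord s b \<in> carrier Zp" "coord t b \<in> carrier Zp"
        using coord(1) [OF st(1)] coord(1) [OF st(2)] b by auto
      ultimately show ?thesis
        using padic_divide by metis
    qed
    then obtain z where z: "\<And>b. b \<in> B \<Longrightarrow> z b \<in> carrier Zp"
      "\<And>b. b \<in> B \<Longrightarrow> coord s b = coord t b \<oplus>\<^bsub>Zp\<^esub> add_pow Zp (p ^ n) (z b)"
      by metis
    have ct: "coord t b \<in> carrier Zp" if "b \<in> B" for b
      using coord(1) [OF st(2)] that by auto
    let ?a = "\<Oplus>\<^bsub>T\<^esub>b\<in>B. z b \<odot>\<^bsub>T\<^esub> b"
    have a: "?a \<in> carrier T" using z B by (intro M.finsum_closed) auto
    have "s = (\<Oplus>\<^bsub>T\<^esub>b\<in>B. coord s b \<odot>\<^bsub>T\<^esub> b)" by (rule coord(2) [OF st(1)])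
    also have "\<dots> = (\<Oplus>\<^bsub>T\<^esub>b\<in>B. coord t b \<odot>\<^bsub>T\<^esub> b \<oplus>\<^bsub>T\<^esub> add_pow Zp (p ^ n) (z b) \<odot>\<^bsub>T\<^esub> b)"
      using z B ct by (intro M.finsum_cong' refl) (auto simp: smult_l_distr subset_iff intro!: smult_closed M.a_closed R.add.nat_pow_closed)
    also have "\<dots> = (\<Oplus>\<^bsub>T\<^esub>b\<in>B. coord t b \<odot>\<^bsub>T\<^esub> b) \<oplus>\<^bsub>T\<^esub> (\<Oplus>\<^bsub>T\<^esub>b\<in>B. add_pow Zp (p ^ n) (z b) \<odot>\<^bsub>T\<^esub> b)"
      using z B ct by (intro M.finsum_addf) (auto intro!: smult_closed R.add.nat_pow_closed)
    also have "\<dots> = t \<oplus>\<^bsub>T\<^esub> q n ?a"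
      using add_pow_comb [OF B, of z "p ^ n"] z coord(2) [OF st(2)] by auto
    \<comment> \<open>\<open>s\<close> and \<open>t\<close> differ by \<open>p^n ?a\<close>; one
      more factor \<open>p^n\<close> gives the form of \<open>frac_rel\<close> with both levels
      equal to \<open>n\<close>.\<close>
    finally have "q n s = q n t \<oplus>\<^bsub>T\<^esub> q (n + n) ?a"
      using st a by (simp add: q_add q_q)
    then show ?thesis using st a by (auto simp: pfrac_eq_iff frac_rel_def)
  qed
  let ?C = "B \<rightarrow>\<^sub>E {0..<int p ^ n}"
  \<comment> \<open>Any vector of the given code will do, since by \<open>eq\<close> its class
    depends on the code alone; codes that do not occur are harmless.\<close>
  define F where "F c = pfrac p T n (SOME t. t \<in> carrier T \<and> code t = c)" for c
  have "carrier (\<Gamma> n) \<subseteq> F ` ?C"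
  proof
    fix x assume "x \<in> carrier (\<Gamma> n)"
    then obtain t where t: "t \<in> carrier T" "x = pfrac p T n t" by (auto simp: carrier_pdiv)
    have "coord t b \<in> carrier Zp" if "b \<in> B" for b
      using coord(1) [OF t(1)] that by auto
    then have "code t \<in> ?C"
      using padic_range by (auto simp: code_def)
    moreover have "F (code t) = x"
      using someI [of "\<lambda>s. s \<in> carrier T \<and> code s = code t" t] t(1) eq
      unfolding F_def t(2) by blast
    ultimately show "x \<in> F ` ?C" by blast
  qed
  then show ?thesis
    by (rule finite_subset) (use B(1) in \<open>auto intro!: finite_PiE\<close>)
qed

lemma additive_q:
  assumes "r \<in> hom (add_monoid T) (add_monoid T)" "t \<in> carrier T"
  shows "r (add_pow T (k::nat) t) = add_pow T k (r t)"
proof -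
  interpret r: group_hom "add_monoid T" "add_monoid T" r
    by (intro group_hom.intro group_hom_axioms.intro assms M.add.is_group)
  show ?thesis
    using r.hom_nat_pow [of t k] assms(2) by (simp add: add_pow_def)
qed

lemma frac_rel_map:
  assumes r: "r \<in> hom (add_monoid T) (add_monoid T)"
    and ts: "t \<in> carrier T" "s \<in> carrier T" and "frac_rel n t k s"
  shows "frac_rel n (r t) k (r s)"
proof -
  obtain a where a: "a \<in> carrier T" "q k t = q n s \<oplus>\<^bsub>T\<^esub> q (n + k) a"
    using assms(4) by (auto simp: frac_rel_def)
  have "r (q k t) = r (q n s) \<oplus>\<^bsub>T\<^esub> r (q (n + k) a)"
    unfolding a(2) using hom_mult [OF r, of "q n s" "q (n + k) a"] ts a(1) by simp
  then have "q k (r t) = q n (r s) \<oplus>\<^bsub>T\<^esub> q (n + k) (r a)"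
    using ts a(1) by (simp add: additive_q [OF r])
  then show ?thesis
    using hom_in_carrier [OF r] a(1) by (auto simp: frac_rel_def)
qed

text \<open>The action is an image of a set of pairs, so equality with a whole class needs both
  inclusions: \<open>frac_rel_map\<close> for \<open>r\<close>, and for its inverse.\<close>

lemma pfrac_map:
  assumes r: "r \<in> iso (add_monoid T) (add_monoid T)" and t: "t \<in> carrier T"
  shows "(\<lambda>(k, s). (k, r s)) ` pfrac p T n t = pfrac p T n (r t)"
proof -
  let ?r' = "inv_into (carrier T) r"
  have hom: "r \<in> hom (add_monoid T) (add_monoid T)" and bij: "bij_betw r (carrier T) (carrier T)"
    using r by (auto simp: iso_def)
  have hom': "?r' \<in> hom (add_monoid T) (add_monoid T)"
    using group.iso_set_sym [OF M.add.is_group r] by (simp add: iso_def)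
  have rT: "r s \<in> carrier T" if "s \<in> carrier T" for s
    using bij that by (auto simp: bij_betw_def)
  have inv: "?r' s \<in> carrier T" "r (?r' s) = s" if "s \<in> carrier T" for s
    using bij that by (auto simp: bij_betw_def f_inv_into_f inv_into_into)
  have inv': "?r' (r s) = s" if "s \<in> carrier T" for s
    using bij that by (auto simp: bij_betw_def)
  have "(k, s) \<in> (\<lambda>(k, s). (k, r s)) ` pfrac p T n t" if "(k, s) \<in> pfrac p T n (r t)" for k s
  proof -
    have s: "s \<in> carrier T" "frac_rel n (r t) k s"
      using that t rT by (auto simp: pfrac_eq)
    then have "frac_rel n t k (?r' s)"
      using frac_rel_map [OF hom', of "r t" s n k] t rT inv' by simp
    then have "(k, ?r' s) \<in> pfrac p T n t" using t s inv by (simp add: pfrac_eq)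
    then show ?thesis using inv(2) [OF s(1)] by force
  qed
  moreover have "(k, r s) \<in> pfrac p T n (r t)" if "(k, s) \<in> pfrac p T n t" for k s
    using that t rT frac_rel_map [OF hom] by (auto simp: pfrac_eq)
  ultimately show ?thesis by auto
qed

lemma pdiv_map_iso:
  assumes r: "r \<in> iso (add_monoid T) (add_monoid T)"
  shows "(\<lambda>x. (\<lambda>(k, s). (k, r s)) ` x) \<in> iso (\<Gamma> n) (\<Gamma> n)"
proof -
  let ?r' = "inv_into (carrier T) r" and ?h = "\<lambda>r x. (\<lambda>(k::nat, s). (k, r s)) ` x"
  have bij: "bij_betw r (carrier T) (carrier T)" and add: "r \<in> hom (add_monoid T) (add_monoid T)"
    using r by (auto simp: iso_def)
  have r': "?r' \<in> iso (add_monoid T) (add_monoid T)"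
    using group.iso_set_sym [OF M.add.is_group r] by simp
  have rT: "r s \<in> carrier T" if "s \<in> carrier T" for s
    using bij that by (auto simp: bij_betw_def)
  have inv: "?r' s \<in> carrier T" "r (?r' s) = s" "?r' (r s) = s" if "s \<in> carrier T" for s
    using bij that by (auto simp: bij_betw_def f_inv_into_f inv_into_into)
  have "bij_betw (?h r) (carrier (\<Gamma> n)) (carrier (\<Gamma> n))"
    by (rule bij_betw_byWitness [where f' = "?h ?r'"])
      (auto simp: carrier_pdiv pfrac_map [OF r] pfrac_map [OF r'] rT inv)
  moreover have "?h r \<in> hom (\<Gamma> n) (\<Gamma> n)"
  proof (rule homI)
    fix x y assume "x \<in> carrier (\<Gamma> n)" "y \<in> carrier (\<Gamma> n)"
    then obtain s t where st: "s \<in> carrier T" "t \<in> carrier T" "x = pfrac p T n s" "y = pfrac p T n t"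
      by (auto simp: carrier_pdiv)
    then show "?h r (x \<otimes>\<^bsub>\<Gamma> n\<^esub> y) = ?h r x \<otimes>\<^bsub>\<Gamma> n\<^esub> ?h r y"
      using hom_mult [OF add, of s t] by (simp add: pfrac_map [OF r] pfrac_mult rT)
  qed (auto simp: carrier_pdiv pfrac_map [OF r] rT)
  ultimately show ?thesis by (simp add: iso_def)
qed

lemma pow_p_equivariant:
  assumes "r \<in> iso (add_monoid T) (add_monoid T)" "x \<in> carrier (\<Gamma> n)" "n \<ge> 1"
  shows "((\<lambda>(k, s). (k, r s)) ` x) [^]\<^bsub>\<Gamma> n\<^esub> p = (\<lambda>(k, s). (k, r s)) ` (x [^]\<^bsub>\<Gamma> n\<^esub> p)"
proof -
  obtain t where t: "t \<in> carrier T" "x = pfrac p T n t" using assms(2) by (auto simp: carrier_pdiv)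
  have "r t \<in> carrier T" using assms(1) t(1) by (auto simp: iso_def hom_def)
  then show ?thesis using t assms by (simp add: pfrac_map pdiv_pow_p)
qed

end


section \<open>Restriction of Galois automorphisms\<close>

text \<open>The inverse function is restricted to the carrier because members of
  \<open>abs_gal\<close> are extensional.\<close>

lemma abs_gal_inverse:
  assumes "ring L" "K \<subseteq> carrier L" "\<omega> \<in> abs_gal L K"
  obtains \<tau> where "\<tau> \<in> abs_gal L K" "compose (carrier L) \<omega> \<tau> = (\<lambda>x\<in>carrier L. x)"
    "compose (carrier L) \<tau> \<omega> = (\<lambda>x\<in>carrier L. x)"
proof -
  interpret ring L by fact
  have w: "\<omega> \<in> ring_iso L L" "\<omega> \<in> extensional (carrier L)" "\<And>x. x \<in> K \<Longrightarrow> \<omega> x = x"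
    using assms(3) by (auto simp: abs_gal_def)
  have bij: "bij_betw \<omega> (carrier L) (carrier L)"
    using w(1) by (auto simp: ring_iso_def)
  let ?\<tau> = "restrict (inv_into (carrier L) \<omega>) (carrier L)"
  have "?\<tau> \<in> ring_iso L L"
    by (rule ring_iso_restrict [OF ring_iso_set_sym [OF ring_axioms w(1)]]) simp
  moreover have "?\<tau> x = x" if x: "x \<in> K" for x
    using bij x assms(2) w(3) inv_into_f_f [of \<omega> "carrier L" x] by (auto simp: bij_betw_def)
  ultimately have "?\<tau> \<in> abs_gal L K" by (auto simp: abs_gal_def)
  then show ?thesis
  proof (rule that)
    show "compose (carrier L) \<omega> ?\<tau> = (\<lambda>x\<in>carrier L. x)"
      unfolding compose_def by (rule restrict_ext) (use bij in \<open>auto simp: bij_betw_def f_inv_into_f\<close>)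
    show "compose (carrier L) ?\<tau> \<omega> = (\<lambda>x\<in>carrier L. x)"
      unfolding compose_def by (rule restrict_ext) (use bij in \<open>auto simp: bij_betw_def\<close>)
  qed
qed

text \<open>\<open>P\<close> splits over \<open>L\<close> already, so a larger field holds no new
  roots. The induction splits off one linear factor; its image or that of the cofactor vanishes at
  \<open>y\<close>, as \<open>M\<close> is a domain.\<close>

lemma (in algebraically_closed) root_in_image:
  assumes "field M" "j \<in> ring_hom L M" "P \<in> carrier (poly_ring L)" "P \<noteq> []"
    and "y \<in> carrier M" "ring.eval M (map j P) y = \<zero>\<^bsub>M\<^esub>"
  shows "y \<in> j ` carrier L"
  using assms(3,4,6)
proof (induction "length P" arbitrary: P rule: less_induct)
  case less
  interpret M: field M by fact
  interpret h: ring_hom_ring L M j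
    by (intro ring_hom_ringI2 ring_axioms M.ring_axioms assms(2))
  have inj: "inj_on j (carrier L)"
    by (rule non_trivial_field_hom_is_inj [OF assms(2) field_axioms M.field_axioms])
  have setP: "set P \<subseteq> carrier L"
    using less.prems(1) polynomial_incl by (auto simp: univ_poly_carrier [symmetric])
  show ?case
  proof (cases "length P = 1")
    \<comment> \<open>A nonzero constant stays nonzero under the injective \<open>j\<close>, so this
      case is contradictory.\<close>
    case True
    then obtain c where c: "P = [c]" using less.prems(2) by (cases P) auto
    then have "c \<in> carrier L" "c \<noteq> \<zero>"
      using less.prems(1) by (auto simp: univ_poly_carrier [symmetric] polynomial_def)
    moreover have "j c = \<zero>\<^bsub>M\<^esub>"
      using less.prems(3) c \<open>c \<in> carrier L\<close> assms(5) by simp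
    ultimately show ?thesis
      using inj h.hom_zero zero_closed by (metis inj_onD)
  next
    case False
    then have "length P - 1 \<noteq> 0" using less.prems(2) by (cases P) auto
    then have "roots P \<noteq> {#}"
      using roots_over_carrier [OF less.prems(1)] by (auto simp: splitted_def)
    then obtain a where a: "is_root P a"
      using roots_mem_iff_is_root [OF less.prems(1)] by blast
    then have aL: "a \<in> carrier L" by (simp add: is_root_def)
    let ?X = "[\<one>, \<ominus> a]"
    obtain Q where Q: "Q \<in> carrier (poly_ring L)" "P = poly_mult ?X Q"
      using is_root_imp_pdivides [OF less.prems(1) a]
      by (auto simp: pdivides_def factor_def univ_poly_mult)
    have "Q \<noteq> []" using Q(2) less.prems(2) by auto
    have setQ: "set Q \<subseteq> carrier L"
      using Q(1) polynomial_incl by (auto simp: univ_poly_carrier [symmetric])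
    have X: "polynomial (carrier L) ?X" "set ?X \<subseteq> carrier L"
      using aL by (auto simp: polynomial_def)
    have deg: "length P - 1 = 1 + (length Q - 1)"
      using poly_mult_degree_eq [OF carrier_is_subring X(1), of Q] Q \<open>Q \<noteq> []\<close>
      by (auto simp: univ_poly_carrier)
    have maps: "set (map j P) \<subseteq> carrier M" "set (map j Q) \<subseteq> carrier M" "set (map j ?X) \<subseteq> carrier M"
      using setP setQ X(2) by auto
    have "\<zero>\<^bsub>M\<^esub> = ring.eval M (map j P) y" using less.prems(3) by simp
    \<comment> \<open>\<open>poly_mult_hom'\<close> describes the normalized image of a product;
      normalizing does not change values.\<close>
    also have "\<dots> = ring.eval M (ring.normalize M (map j P)) y"
      using M.eval_normalize [OF maps(1) assms(5)] by simp
    also have "\<dots> = ring.eval M (ring.poly_mult M (map j ?X) (map j Q)) y"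
      using h.poly_mult_hom' [OF X(2) setQ] Q(2) by simp
    also have "\<dots> = ring.eval M (map j ?X) y \<otimes>\<^bsub>M\<^esub> ring.eval M (map j Q) y"
      by (rule M.eval_poly_mult [OF maps(3,2) assms(5)])
    finally have "ring.eval M (map j ?X) y = \<zero>\<^bsub>M\<^esub> \<or> ring.eval M (map j Q) y = \<zero>\<^bsub>M\<^esub>"
      using M.integral M.eval_in_carrier [OF maps(2) assms(5)] M.eval_in_carrier [OF maps(3) assms(5)]
      by metis
    then show ?thesis
    proof
      assume "ring.eval M (map j ?X) y = \<zero>\<^bsub>M\<^esub>"
      then have "y \<oplus>\<^bsub>M\<^esub> (\<ominus>\<^bsub>M\<^esub> j a) = \<zero>\<^bsub>M\<^esub>"
        using aL assms(5) by simp
      then have "y = j a"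
        using aL assms(5) h.hom_closed M.minus_equality [of y "\<ominus>\<^bsub>M\<^esub> j a"] by simp
      then show ?thesis using aL by blast
    next
      assume "ring.eval M (map j Q) y = \<zero>\<^bsub>M\<^esub>"
      then show ?thesis
        using less.hyps [OF _ Q(1) \<open>Q \<noteq> []\<close>] deg \<open>Q \<noteq> []\<close> by (cases Q) auto
    qed
  qed
qed

text \<open>The \<open>inv_into\<close> makes sense because \<open>L\<close> is normal over
  \<open>F\<close>: an automorphism fixing \<open>K\<close> moves \<open>j x\<close> to a root of
  the same equation over \<open>F\<close>, and \<open>root_in_image\<close> puts that root in the
  image of \<open>L\<close>.\<close>

lemma abs_gal_restrict:
  assumes "algebraic_closure L F" "field M" "j \<in> ring_hom L M" "j ` F \<subseteq> K" "K \<subseteq> carrier M"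
    and "\<omega> \<in> abs_gal M K"
  defines "\<sigma> \<equiv> \<lambda>x\<in>carrier L. inv_into (carrier L) j (\<omega> (j x))"
  shows "\<sigma> \<in> abs_gal L F" and "x \<in> carrier L \<Longrightarrow> j (\<sigma> x) = \<omega> (j x)"
proof -
  interpret L: algebraic_closure L F by fact
  interpret M: field M by fact
  interpret h: ring_hom_ring L M j
    by (intro ring_hom_ringI2 L.ring_axioms M.ring_axioms assms(3))
  have inj: "inj_on j (carrier L)"
    by (rule non_trivial_field_hom_is_inj [OF assms(3) L.field_axioms M.field_axioms])
  have F: "subring F L" "F \<subseteq> carrier L"
    using L.subfield_axioms subfieldE by auto
  \<comment> \<open>Stated for every automorphism, since surjectivity of \<open>\<sigma>\<close>
    applies it to the inverse.\<close>
  have image: "\<omega> (j x) \<in> j ` carrier L" if "\<omega> \<in> abs_gal M K" and x: "x \<in> carrier L" for \<omega> x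
  proof -
    have w: "\<omega> \<in> ring_hom M M" "\<And>y. y \<in> K \<Longrightarrow> \<omega> y = y"
      using that(1) by (auto simp: abs_gal_def ring_iso_def)
    interpret w: ring_hom_ring M M \<omega>
      by (intro ring_hom_ringI2 M.ring_axioms w)
    \<comment> \<open>\<open>\<omega>\<close> permutes the roots of an equation of \<open>x\<close> over \<open>F\<close>, and these all lie in the image of \<open>L\<close>.\<close>
    obtain P where P: "P \<in> carrier (F [X]\<^bsub>L\<^esub>)" "P \<noteq> []" "L.eval P x = \<zero>\<^bsub>L\<^esub>"
      using L.algebraicE [OF F(1) x L.algebraic_extension [OF x]] by blast
    have setP: "set P \<subseteq> F"
      using P(1) by (auto simp: univ_poly_carrier [symmetric] polynomial_def)
    have "\<omega> (j (L.eval P x)) = \<omega> (M.eval (map j P) (j x))"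
      using h.eval_hom' [OF x, of P] setP F(2) by auto
    also have "\<dots> = M.eval (map \<omega> (map j P)) (\<omega> (j x))"
      using setP F(2) x by (intro w.eval_hom') auto
    also have "map \<omega> (map j P) = map j P"
      using setP assms(4) w(2) by (auto intro!: map_idI)
    finally have "M.eval (map j P) (\<omega> (j x)) = \<zero>\<^bsub>M\<^esub>"
      using P(3) by simp
    then show ?thesis
      using L.root_in_image [OF M.field_axioms assms(3) L.carrier_polynomial_shell [OF F(1) P(1)] P(2)] x
      by simp
  qed
  show j\<sigma>: "j (\<sigma> x) = \<omega> (j x)" if "x \<in> carrier L" for x
    using image [OF assms(6) that] that by (simp add: \<sigma>_def f_inv_into_f)
  have \<sigma>L: "\<sigma> x \<in> carrier L" if "x \<in> carrier L" for x
    using image [OF assms(6) that] that by (simp add: \<sigma>_def inv_into_into)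
  have w: "\<omega> \<in> ring_hom M M" "\<And>y. y \<in> K \<Longrightarrow> \<omega> y = y" "bij_betw \<omega> (carrier M) (carrier M)"
    using assms(6) by (auto simp: abs_gal_def ring_iso_def)
  have "\<sigma> \<in> ring_iso L L"
  proof (rule ring_iso_memI)
    fix x y assume xy: "x \<in> carrier L" "y \<in> carrier L"
    show "\<sigma> (x \<otimes>\<^bsub>L\<^esub> y) = \<sigma> x \<otimes>\<^bsub>L\<^esub> \<sigma> y"
      by (rule inj_onD [OF inj]) (use xy \<sigma>L j\<sigma> in \<open>simp_all add: ring_hom_mult [OF w(1)]\<close>)
    show "\<sigma> (x \<oplus>\<^bsub>L\<^esub> y) = \<sigma> x \<oplus>\<^bsub>L\<^esub> \<sigma> y"
      by (rule inj_onD [OF inj]) (use xy \<sigma>L j\<sigma> in \<open>simp_all add: ring_hom_add [OF w(1)]\<close>)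
  next
    show "\<sigma> \<one>\<^bsub>L\<^esub> = \<one>\<^bsub>L\<^esub>"
      by (rule inj_onD [OF inj]) (use \<sigma>L j\<sigma> in \<open>simp_all add: ring_hom_one [OF w(1)]\<close>)
    have "inj_on \<sigma> (carrier L)"
    proof (rule inj_onI)
      fix x y assume xy: "x \<in> carrier L" "y \<in> carrier L" "\<sigma> x = \<sigma> y"
      then have "\<omega> (j x) = \<omega> (j y)" using j\<sigma> by metis
      then have "j x = j y" using w(3) xy by (auto simp: bij_betw_def inj_on_def)
      then show "x = y" using inj xy by (auto simp: inj_on_def)
    qed
    moreover have "y \<in> \<sigma> ` carrier L" if y: "y \<in> carrier L" for y
    proof -
      \<comment> \<open>A preimage of \<open>y\<close> under \<open>\<sigma>\<close> is the element
        of \<open>L\<close> that \<open>j\<close> sends to \<open>\<tau> (j y)\<close>.\<close>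
      obtain \<tau> where \<tau>: "\<tau> \<in> abs_gal M K" "compose (carrier M) \<omega> \<tau> = (\<lambda>x\<in>carrier M. x)"
        using abs_gal_inverse [OF M.ring_axioms assms(5,6)] by metis
      obtain x where x: "x \<in> carrier L" "\<tau> (j y) = j x"
        using image [OF \<tau>(1) y] by auto
      have "\<omega> (\<tau> (j y)) = j y"
        using fun_cong [OF \<tau>(2), of "j y"] y by (simp add: compose_def)
      then have "j (\<sigma> x) = j y" using x j\<sigma> by simp
      then have "\<sigma> x = y" using inj x y \<sigma>L by (auto simp: inj_on_def)
      then show ?thesis using x by blast
    qed
    ultimately show "bij_betw \<sigma> (carrier L) (carrier L)"
      using \<sigma>L by (auto simp: bij_betw_def)
  qed (rule \<sigma>L)
  moreover have "\<sigma> x = x" if x: "x \<in> F" for x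
    by (rule inj_onD [OF inj]) (use x F(2) \<sigma>L j\<sigma> w(2) assms(4) in auto)
  moreover have "\<sigma> \<in> extensional (carrier L)" by (simp add: \<sigma>_def)
  ultimately show "\<sigma> \<in> abs_gal L F" by (simp add: abs_gal_def)
qed


section \<open>Cohomology classes at levels \<open>n\<close> and \<open>n - 1\<close>\<close>

lemma abs_gal_compose:
  assumes "ring L" "K \<subseteq> carrier L" "\<omega> \<in> abs_gal L K" "\<tau> \<in> abs_gal L K"
  shows "compose (carrier L) \<omega> \<tau> \<in> abs_gal L K"
proof -
  interpret ring L by fact
  have w: "\<omega> \<in> ring_iso L L" "\<tau> \<in> ring_iso L L"
    using assms(3,4) by (auto simp: abs_gal_def)
  have "compose (carrier L) \<omega> \<tau> \<in> ring_iso L L"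
    by (rule ring_iso_restrict [OF ring_iso_set_trans [OF w(2,1)]]) (simp add: compose_def)
  then show ?thesis
    using assms(2-4) by (auto simp: abs_gal_def compose_def)
qed

lemma topspace_krull: "topspace (krull_topology L K) \<subseteq> abs_gal L K"
  by (simp add: krull_topology_def)

text \<open>\<open>H1\<close> consists of classes of continuous cocycles, so continuity must survive
  \<open>f\<close>; it does because \<open>f\<close> is a map between discrete spaces. The cocycle
  identity is equivariance.\<close>

lemma (in equivariant_hom) f_cocycle:
  assumes "K \<subseteq> carrier L" "c \<in> carrier (cocycles L K G \<rho>)"
  shows "(\<lambda>\<omega>\<in>\<Omega>. f (c \<omega>)) \<in> carrier (cocycles L K H \<rho>')"
proof -
  have c: "c \<in> \<Omega> \<rightarrow>\<^sub>E carrier G"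
    "continuous_map (krull_topology L K) (discrete_topology (carrier G)) c"
    "\<And>\<omega> \<tau>. \<omega> \<in> \<Omega> \<Longrightarrow> \<tau> \<in> \<Omega> \<Longrightarrow>
      c (compose (carrier L) \<omega> \<tau>) = c \<omega> \<otimes>\<^bsub>G\<^esub> \<rho> \<omega> (c \<tau>)"
    using assms(2) by (auto simp: cocycles_def)
  have cG: "c \<omega> \<in> carrier G" if "\<omega> \<in> \<Omega>" for \<omega> using c(1) that by auto
  have \<rho>G: "\<rho> \<omega> g \<in> carrier G" if "\<omega> \<in> \<Omega>" "g \<in> carrier G" for \<omega> g
    using \<rho>_iso that by (auto simp: iso_def hom_def)
  have "continuous_map (krull_topology L K) (discrete_topology (carrier H)) (f \<circ> c)"
    by (rule continuous_map_compose [OF c(2)]) auto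
  then have "continuous_map (krull_topology L K) (discrete_topology (carrier H)) (\<lambda>\<omega>\<in>\<Omega>. f (c \<omega>))"
    by (rule continuous_map_eq) (use topspace_krull [of L K] in auto)
  moreover have "f (c (compose (carrier L) \<omega> \<tau>)) = f (c \<omega>) \<otimes>\<^bsub>H\<^esub> \<rho>' \<omega> (f (c \<tau>))"
    if "\<omega> \<in> \<Omega>" "\<tau> \<in> \<Omega>" for \<omega> \<tau>
    using that cG \<rho>G by (simp add: c(3) equivariant)
  ultimately show ?thesis
    using cG abs_gal_compose [OF dom.coef.ring_axioms assms(1)] by (auto simp: cocycles_def)
qed

section \<open>The arithmetic data as instances of the general results\<close>

locale galois_setup =
  fixes D :: "('c, 'l, 't) galois_data"
  assumes setting: "galois_setting D"
begin

abbreviation "p \<equiv> prm D"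
abbreviation "T \<equiv> lat D"
abbreviation "L \<equiv> clos D"
abbreviation "F \<equiv> base D"
abbreviation "M \<equiv> lclos D"
abbreviation "K \<equiv> lfield D"
abbreviation "powp n \<equiv> \<lambda>x. x [^]\<^bsub>Gam D n\<^esub> p"

lemma closure: "algebraic_closure L F"
  using setting by (simp add: galois_setting_def)

sublocale L: algebraic_closure L F by (rule closure)

lemma F_subset: "F \<subseteq> carrier L"
  using L.subfield_axioms subfieldE by auto

lemma completion:
  assumes "v \<in> plc D"
  shows "algebraic_closure (M v) (K v)" "lemb D v \<in> ring_hom L (M v)" "lemb D v ` F \<subseteq> K v"
    and "x \<in> K v \<Longrightarrow> y \<in> K v \<Longrightarrow> labs D v (x \<otimes>\<^bsub>M v\<^esub> y) = labs D v x * labs D v y"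
    and "x \<in> K v \<Longrightarrow> 0 \<le> labs D v x"
  using setting assms by (auto simp: galois_setting_def is_completion_def)

lemma M_field: "v \<in> plc D \<Longrightarrow> field (M v)"
  using completion(1) algebraic_closure.axioms(1) by blast

lemma K_subset: "v \<in> plc D \<Longrightarrow> K v \<subseteq> carrier (M v)"
  using algebraic_closure.axioms(2) [OF completion(1)] subfieldE by blast

lemma K_mult: "v \<in> plc D \<Longrightarrow> x \<in> K v \<Longrightarrow> y \<in> K v \<Longrightarrow> x \<otimes>\<^bsub>M v\<^esub> y \<in> K v"
  using algebraic_closure.axioms(2) [OF completion(1)] subfieldE(1) subringE(6) by metis

lemma K_one: "v \<in> plc D \<Longrightarrow> \<one>\<^bsub>M v\<^esub> \<in> K v"
  using algebraic_closure.axioms(2) [OF completion(1)] subfieldE(1) subringE(3) by metis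

lemma Ov_subset: "v \<in> plc D \<Longrightarrow> Ov D v \<subseteq> carrier (M v)"
  using K_subset by (auto simp: Ov_def)

lemma Ov_mult: "v \<in> plc D \<Longrightarrow> x \<in> Ov D v \<Longrightarrow> y \<in> Ov D v \<Longrightarrow> x \<otimes>\<^bsub>M v\<^esub> y \<in> Ov D v"
  using K_mult completion(4,5) by (auto simp: Ov_def mult_le_one)

lemma Ov_one:
  assumes "v \<in> plc D"
  shows "\<one>\<^bsub>M v\<^esub> \<in> Ov D v"
proof -
  interpret field "M v" by (rule M_field [OF assms])
  have "labs D v \<one>\<^bsub>M v\<^esub> = labs D v \<one>\<^bsub>M v\<^esub> * labs D v \<one>\<^bsub>M v\<^esub>"
    using completion(4) [OF assms K_one [OF assms] K_one [OF assms]] by simp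
  then have "labs D v \<one>\<^bsub>M v\<^esub> \<le> 1" by auto
  then show ?thesis using K_one [OF assms] by (simp add: Ov_def)
qed

lemma lattice: "padic_lattice p T"
  using setting by (auto simp: galois_setting_def padic_lattice_def padic_lattice_axioms_def prime_gt_0_nat)

sublocale T: padic_lattice p T by (rule lattice)

lemma Gam_group_algebra: "cring R \<Longrightarrow> group_algebra R (Gam D n)"
  by (simp add: group_algebra_def group_algebra_axioms_def Gam_def T.pdiv_comm_group T.finite_pdiv)

text \<open>Bijectivity is not among the data; the action of the inverse automorphism supplies the
  inverse map.\<close>

lemma rho_iso:
  assumes "\<omega> \<in> \<Omega>F D"
  shows "rho D \<omega> \<in> iso (add_monoid T) (add_monoid T)"
proof -
  have rho: "rho D \<omega> t \<in> carrier T" "rho D \<omega> (s \<oplus>\<^bsub>T\<^esub> t) = rho D \<omega> s \<oplus>\<^bsub>T\<^esub> rho D \<omega> t"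
    if "\<omega> \<in> \<Omega>F D" "s \<in> carrier T" "t \<in> carrier T" for \<omega> s t
    using setting that by (auto simp: galois_setting_def)
  have comp: "rho D (\<lambda>x\<in>carrier L. x) t = t"
    "\<omega> \<in> \<Omega>F D \<Longrightarrow> \<tau> \<in> \<Omega>F D \<Longrightarrow> rho D (compose (carrier L) \<omega> \<tau>) t = rho D \<omega> (rho D \<tau> t)"
    if "t \<in> carrier T" for \<omega> \<tau> t
    using setting that by (auto simp: galois_setting_def)
  obtain \<tau> where \<tau>: "\<tau> \<in> \<Omega>F D" "compose (carrier L) \<omega> \<tau> = (\<lambda>x\<in>carrier L. x)"
    "compose (carrier L) \<tau> \<omega> = (\<lambda>x\<in>carrier L. x)"
    using abs_gal_inverse [OF L.ring_axioms F_subset] assms unfolding \<Omega>F_def by metis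
  have "bij_betw (rho D \<omega>) (carrier T) (carrier T)"
  proof (rule bij_betw_byWitness [where f' = "rho D \<tau>"])
    show "\<forall>t\<in>carrier T. rho D \<tau> (rho D \<omega> t) = t" "\<forall>t\<in>carrier T. rho D \<omega> (rho D \<tau> t) = t"
      using comp(1) comp(2) [OF _ assms \<tau>(1)] comp(2) [OF _ \<tau>(1) assms] \<tau>(2,3) by metis+
  qed (use rho(1) assms \<tau>(1) in auto)
  then show ?thesis
    using rho assms by (auto simp: iso_def hom_def)
qed

lemma act_iso: "\<omega> \<in> \<Omega>F D \<Longrightarrow> act D \<omega> \<in> iso (Gam D n) (Gam D n)"
  using T.pdiv_map_iso [OF rho_iso] by (simp add: Gam_def act_def [abs_def])

lemma gal_res:
  assumes "v \<in> plc D" "\<omega> \<in> \<Omega>v D v"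
  shows "gal_res D v \<omega> \<in> \<Omega>F D"
  using abs_gal_restrict(1) [OF closure M_field [OF assms(1)] completion(2,3) [OF assms(1)]
      K_subset [OF assms(1)]] assms(2)
  by (simp add: gal_res_def \<Omega>v_def \<Omega>F_def)

lemma powp_hom: "n \<ge> 1 \<Longrightarrow> powp n \<in> hom (Gam D n) (Gam D (n - 1))"
  using T.pow_p_hom by (simp add: Gam_def)

lemma powp_equivariant:
  "\<omega> \<in> \<Omega>F D \<Longrightarrow> g \<in> carrier (Gam D n) \<Longrightarrow> n \<ge> 1 \<Longrightarrow> powp n (act D \<omega> g) = act D \<omega> (powp n g)"
  using T.pow_p_equivariant [OF rho_iso] by (simp add: Gam_def act_def)

lemma glob_hom:
  assumes "n \<ge> 1"
  shows "equivariant_hom L (Gam D n) (Gam D (n - 1)) (powp n) F (act D) (act D)"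
  by (intro equivariant_hom.intro group_algebra_hom.intro group_algebra_hom_axioms.intro
      equivariant_hom_axioms.intro Gam_group_algebra L.is_cring powp_hom assms L.one_not_zero)
    (use act_iso powp_equivariant assms in \<open>auto simp: \<Omega>F_def\<close>)

text \<open>\<open>lact\<close> is \<open>act\<close> composed with \<open>gal_res\<close>, so
  isomorphy and equivariance are inherited from the global action once \<open>gal_res\<close> lands
  in \<open>\<Omega>F D\<close>.\<close>

lemma loc_hom:
  assumes "n \<ge> 1" "v \<in> plc D"
  shows "equivariant_hom (M v) (Gam D n) (Gam D (n - 1)) (powp n) (K v) (lact D v) (lact D v)"
proof -
  interpret field "M v" by (rule M_field [OF assms(2)])
  show ?thesis
    by (intro equivariant_hom.intro group_algebra_hom.intro group_algebra_hom_axioms.intro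
        equivariant_hom_axioms.intro Gam_group_algebra is_cring powp_hom assms one_not_zero)
      (use gal_res [OF assms(2)] act_iso powp_equivariant assms in \<open>auto simp: lact_def \<Omega>v_def\<close>)
qed

lemma q_map_eq: "q_map D R n = push R (Gam D n) (Gam D (n - 1)) (powp n)"
  by (intro ext) (simp add: q_map_def push_def)

lemma to_local_eq: "to_local D n v = coeff_map (Gam D n) (lemb D v)"
  by (intro ext) (simp add: to_local_def coeff_map_def)

lemma glob_algebra: "group_algebra L (Gam D n)"
  by (rule Gam_group_algebra [OF L.is_cring])

lemma loc_algebra: "v \<in> plc D \<Longrightarrow> group_algebra (M v) (Gam D n)"
  by (rule Gam_group_algebra) (metis M_field fieldE(1) domain.axioms(1) field.axioms(1))

lemma to_local_hom:
  assumes "v \<in> plc D"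
  shows "to_local D n v \<in> ring_hom (grp_alg L (Gam D n)) (grp_alg (M v) (Gam D n))"
proof -
  interpret loc: group_algebra "M v" "Gam D n" by (rule loc_algebra [OF assms])
  show ?thesis
    unfolding to_local_eq
    by (rule group_algebra.coeff_map_ring_hom [OF glob_algebra loc.coef.is_cring completion(2) [OF assms]])
qed

lemma q_to_local:
  assumes "n \<ge> 1" "v \<in> plc D" "a \<in> carrier (grp_alg L (Gam D n))"
  shows "q_map D (M v) n (to_local D n v a) = to_local D (n - 1) v (q_map D L n a)"
proof -
  interpret equivariant_hom L "Gam D n" "Gam D (n - 1)" "powp n" F "act D" "act D"
    by (rule glob_hom [OF assms(1)])
  interpret loc: group_algebra "M v" "Gam D n" by (rule loc_algebra [OF assms(2)])
  show ?thesis
    unfolding q_map_eq to_local_eq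
    by (rule push_coeff_map [OF loc.coef.is_cring completion(2) [OF assms(2)] assms(3)])
qed

lemma loc_ext_subset:
  assumes "v \<in> plc D" "R \<subseteq> carrier (M v)" "B \<subseteq> carrier (grp_alg L (Gam D n))"
  shows "loc_ext D n v R B \<subseteq> carrier (grp_alg (M v) (Gam D n))"
proof -
  interpret loc: group_algebra "M v" "Gam D n" by (rule loc_algebra [OF assms(1)])
  show ?thesis
    unfolding loc_ext_def
    by (rule loc.span_over_subset [OF assms(2)])
      (use assms(3) ring_hom_closed [OF to_local_hom [OF assms(1)]] in auto)
qed

text \<open>\<open>q\<close> commutes with spans and with localization of coefficients, so an
  inclusion between global algebras extends to their scalar extensions, for \<open>Ov D v\<close>
  and for the completion alike.\<close>

lemma q_loc_ext:
  assumes "n \<ge> 1" "v \<in> plc D" "R \<subseteq> carrier (M v)" "B \<subseteq> carrier (grp_alg L (Gam D n))"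
    and "q_map D L n ` B \<subseteq> C"
  shows "q_map D (M v) n ` loc_ext D n v R B \<subseteq> loc_ext D (n - 1) v R C"
proof -
  interpret equivariant_hom "M v" "Gam D n" "Gam D (n - 1)" "powp n" "K v" "lact D v" "lact D v"
    by (rule loc_hom [OF assms(1,2)])
  have B: "to_local D n v ` B \<subseteq> carrier dom.A"
    using assms(4) ring_hom_closed [OF to_local_hom [OF assms(2)]] by auto
  have "q_map D (M v) n ` loc_ext D n v R B =
      span_over (M v) (Gam D (n - 1)) R (q_map D (M v) n ` to_local D n v ` B)"
    unfolding loc_ext_def q_map_eq by (rule push_span_over [OF assms(3) B])
  also have "q_map D (M v) n ` to_local D n v ` B = to_local D (n - 1) v ` q_map D L n ` B"
    unfolding image_image using assms(4) q_to_local [OF assms(1,2)] by (intro image_cong) auto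
  also have "span_over (M v) (Gam D (n - 1)) R \<dots> \<subseteq> loc_ext D (n - 1) v R C"
    unfolding loc_ext_def using assms(5) by (intro span_over_mono image_mono)
  finally show ?thesis .
qed

lemma q_An:
  assumes "n \<ge> 1"
  shows "q_map D L n ` An D n \<subseteq> An D (n - 1)"
proof -
  interpret equivariant_hom L "Gam D n" "Gam D (n - 1)" "powp n" F "act D" "act D"
    by (rule glob_hom [OF assms])
  show ?thesis
    unfolding q_map_eq by (auto simp: An_def \<Omega>F_def push_alg_act [symmetric] simp del: One_nat_def)
qed

lemma An_subset: "An D n \<subseteq> carrier (grp_alg L (Gam D n))"
  by (auto simp: An_def)

lemma q_HH_glob:
  assumes "n \<ge> 1" "\<alpha> \<in> HH_glob D n"
  shows "q_map D L n \<alpha> \<in> HH_glob D (n - 1)"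
    and "cls_glob D (n - 1) (q_map D L n \<alpha>) = p_map D n (cls_glob D n \<alpha>)"
proof -
  interpret equivariant_hom L "Gam D n" "Gam D (n - 1)" "powp n" F "act D" "act D"
    by (rule glob_hom [OF assms(1)])
  note \<alpha> = assms(2) [unfolded HH_glob_def] An_subset
  show "q_map D L n \<alpha> \<in> HH_glob D (n - 1)"
    using push_HH [OF \<alpha> q_An [OF assms(1), unfolded q_map_eq]] by (simp add: HH_glob_def q_map_eq)
  show "cls_glob D (n - 1) (q_map D L n \<alpha>) = p_map D n (cls_glob D n \<alpha>)"
    using cls_push [OF \<alpha>] by (simp add: cls_glob_def q_map_eq p_map_def \<Omega>F_def)
qed

lemma H1F_coset:
  assumes "x \<in> carrier (H1F D n)"
  obtains c where "c \<in> carrier (cocycles L F (Gam D n) (act D))"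
    "x = coboundaries L F (Gam D n) (act D) #>\<^bsub>cocycles L F (Gam D n) (act D)\<^esub> c"
  using assms by (auto simp: H1F_def H1_def carrier_FactGroup)

lemma p_map_coset:
  assumes "n \<ge> 1" "c \<in> carrier (cocycles L F (Gam D n) (act D))"
  shows "p_map D n (coboundaries L F (Gam D n) (act D) #>\<^bsub>cocycles L F (Gam D n) (act D)\<^esub> c) =
    coboundaries L F (Gam D (n - 1)) (act D) #>\<^bsub>cocycles L F (Gam D (n - 1)) (act D)\<^esub>
      (\<lambda>\<omega>\<in>\<Omega>F D. powp n (c \<omega>))"
    and "(\<lambda>\<omega>\<in>\<Omega>F D. powp n (c \<omega>)) \<in> carrier (cocycles L F (Gam D (n - 1)) (act D))"
proof -
  interpret equivariant_hom L "Gam D n" "Gam D (n - 1)" "powp n" F "act D" "act D"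
    by (rule glob_hom [OF assms(1)])
  have "c \<in> \<Omega> \<rightarrow>\<^sub>E carrier (Gam D n)" using assms(2) by (simp add: cocycles_def)
  from f_coset [OF this] f_cocycle [OF F_subset assms(2)]
  show "p_map D n (coboundaries L F (Gam D n) (act D) #>\<^bsub>cocycles L F (Gam D n) (act D)\<^esub> c) =
    coboundaries L F (Gam D (n - 1)) (act D) #>\<^bsub>cocycles L F (Gam D (n - 1)) (act D)\<^esub>
      (\<lambda>\<omega>\<in>\<Omega>F D. powp n (c \<omega>))"
    "(\<lambda>\<omega>\<in>\<Omega>F D. powp n (c \<omega>)) \<in> carrier (cocycles L F (Gam D (n - 1)) (act D))"
    by (simp_all add: p_map_def \<Omega>F_def)
qed

text \<open>Restriction along \<open>gal_res\<close> is a homomorphism of cochain groups that takes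
  the coboundary of \<open>g\<close> to the local coboundary of the same \<open>g\<close>, as
  \<open>coset_image\<close> requires.\<close>

lemma localize_coset:
  assumes "v \<in> plc D" "c \<in> carrier (cocycles L F (Gam D n) (act D))"
  shows "localize D n v (coboundaries L F (Gam D n) (act D) #>\<^bsub>cocycles L F (Gam D n) (act D)\<^esub> c) =
    coboundaries (M v) (K v) (Gam D n) (lact D v) #>\<^bsub>cocycles (M v) (K v) (Gam D n) (lact D v)\<^esub>
      (\<lambda>\<omega>\<in>\<Omega>v D v. c (gal_res D v \<omega>))"
proof -
  let ?P = "product_group (abs_gal L F) (\<lambda>_. Gam D n)"
  let ?Q = "product_group (abs_gal (M v) (K v)) (\<lambda>_. Gam D n)"
  let ?res = "\<lambda>c. \<lambda>\<omega>\<in>abs_gal (M v) (K v). c (gal_res D v \<omega>)"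
  interpret G: comm_group "Gam D n" by (simp add: Gam_def T.pdiv_comm_group)
  note res = gal_res [OF assms(1), unfolded \<Omega>v_def \<Omega>F_def]
  note act = act_iso [unfolded \<Omega>F_def]
  have "?res \<in> hom ?P ?Q"
    using res by (intro homI) (auto simp: PiE_iff intro!: restrict_ext)
  moreover have "subgroup (coboundaries L F (Gam D n) (act D)) ?P"
    by (rule coboundaries_subgroup [OF G.comm_group_axioms]) (use act in \<open>auto simp: iso_def\<close>)
  moreover have "subgroup (coboundaries (M v) (K v) (Gam D n) (lact D v)) ?Q"
    by (rule coboundaries_subgroup [OF G.comm_group_axioms]) (use act res in \<open>auto simp: iso_def lact_def\<close>)
  moreover have "?res ` coboundaries L F (Gam D n) (act D) \<subseteq>
      coboundaries (M v) (K v) (Gam D n) (lact D v)"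
  proof -
    have "?res (\<lambda>\<omega>\<in>abs_gal L F. act D \<omega> g \<otimes>\<^bsub>Gam D n\<^esub> inv\<^bsub>Gam D n\<^esub> g) =
        (\<lambda>\<omega>\<in>abs_gal (M v) (K v). lact D v \<omega> g \<otimes>\<^bsub>Gam D n\<^esub> inv\<^bsub>Gam D n\<^esub> g)" for g
      by (rule restrict_ext) (use res in \<open>auto simp: lact_def\<close>)
    then show ?thesis by (auto simp: coboundaries_def)
  qed
  moreover have "c \<in> carrier ?P" using assms(2) by (simp add: cocycles_def)
  ultimately show ?thesis
    unfolding localize_def cocycles_set_mult cocycles_r_coset \<Omega>v_def
    by (intro coset_image) auto
qed

text \<open>The class statement holds because localization changes the argument of a cocycle and
  \<open>p_map\<close> its values, so the two commute; this is checked on a representative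
  \<open>c\<close> of \<open>x\<close>.\<close>

lemma q_HH_loc:
  assumes "n \<ge> 1" "v \<in> plc D" "x \<in> carrier (H1F D n)"
    and "B \<subseteq> carrier (grp_alg L (Gam D n))" "q_map D L n ` B \<subseteq> C"
    and "\<beta> \<in> HH_loc D n B v" "cls_loc D n v \<beta> = localize D n v x"
  shows "q_map D (M v) n \<beta> \<in> HH_loc D (n - 1) C v"
    and "cls_loc D (n - 1) v (q_map D (M v) n \<beta>) = localize D (n - 1) v (p_map D n x)"
proof -
  interpret equivariant_hom "M v" "Gam D n" "Gam D (n - 1)" "powp n" "K v" "lact D v" "lact D v"
    by (rule loc_hom [OF assms(1,2)])
  note sub = loc_ext_subset [OF assms(2) Ov_subset [OF assms(2)] assms(4)]
  note \<beta> = assms(6) [unfolded HH_loc_def]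
  show "q_map D (M v) n \<beta> \<in> HH_loc D (n - 1) C v"
    unfolding HH_loc_def q_map_eq
    by (rule push_HH [OF \<beta> sub])
      (rule q_loc_ext [OF assms(1,2) Ov_subset [OF assms(2)] assms(4,5), unfolded q_map_eq])
  obtain c where c: "c \<in> carrier (cocycles L F (Gam D n) (act D))"
    "x = coboundaries L F (Gam D n) (act D) #>\<^bsub>cocycles L F (Gam D n) (act D)\<^esub> c"
    using H1F_coset [OF assms(3)] .
  note res = gal_res [OF assms(2)]
  let ?r = "\<lambda>\<omega>\<in>\<Omega>v D v. c (gal_res D v \<omega>)"
  have r: "?r \<in> \<Omega> \<rightarrow>\<^sub>E carrier (Gam D n)"
    using c(1) res by (auto simp: cocycles_def \<Omega>v_def \<Omega>F_def)
  have "(\<lambda>\<omega>\<in>\<Omega>. powp n (?r \<omega>)) = (\<lambda>\<omega>\<in>\<Omega>v D v. (\<lambda>\<omega>\<in>\<Omega>F D. powp n (c \<omega>)) (gal_res D v \<omega>))"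
    unfolding \<Omega>v_def by (rule restrict_ext) (use res in \<open>auto simp: \<Omega>v_def\<close>)
  then show "cls_loc D (n - 1) v (q_map D (M v) n \<beta>) = localize D (n - 1) v (p_map D n x)"
    using cls_push [OF \<beta> sub] f_coset [OF r] assms(7)
    by (simp add: c(2) localize_coset [OF assms(2) c(1)] p_map_coset [OF assms(1) c(1)]
        localize_coset [OF assms(2) p_map_coset(2) [OF assms(1) c(1)]] cls_loc_def q_map_eq
        del: One_nat_def)
qed

lemma p_map_H1_order:
  assumes "n \<ge> 1" "B \<subseteq> carrier (grp_alg L (Gam D n))" "q_map D L n ` B \<subseteq> C"
    and "x \<in> H1_order D n B"
  shows "p_map D n x \<in> H1_order D (n - 1) C"
proof -
  have x: "x \<in> carrier (H1F D n)"
    "\<And>v. v \<in> plc D \<Longrightarrow> localize D n v x \<in> cls_loc D n v ` HH_loc D n B v"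
    using assms(4) by (auto simp: H1_order_def)
  obtain c where c: "c \<in> carrier (cocycles L F (Gam D n) (act D))"
    "x = coboundaries L F (Gam D n) (act D) #>\<^bsub>cocycles L F (Gam D n) (act D)\<^esub> c"
    using H1F_coset [OF x(1)] .
  have "p_map D n x \<in> carrier (H1F D (n - 1))"
    unfolding c(2) p_map_coset(1) [OF assms(1) c(1)]
    using p_map_coset(2) [OF assms(1) c(1)] by (auto simp: H1F_def H1_def carrier_FactGroup)
  moreover have "localize D (n - 1) v (p_map D n x) \<in> cls_loc D (n - 1) v ` HH_loc D (n - 1) C v"
    if v: "v \<in> plc D" for v
  proof -
    obtain \<beta> where "\<beta> \<in> HH_loc D n B v" "cls_loc D n v \<beta> = localize D n v x"
      using x(2) [OF v] by (auto simp: image_iff)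
    from q_HH_loc [OF assms(1) v x(1) assms(2,3) this] show ?thesis by (metis imageI)
  qed
  ultimately show ?thesis by (simp add: H1_order_def)
qed

end


section \<open>Ideles\<close>

lemma subgroup_absorb_coset:
  assumes "comm_group P" "subgroup U P" "subgroup N P" "x \<in> U" "n \<in> N" "b \<in> carrier P"
  shows "(U <#>\<^bsub>P\<^esub> N) #>\<^bsub>P\<^esub> (x \<otimes>\<^bsub>P\<^esub> n \<otimes>\<^bsub>P\<^esub> b) = (U <#>\<^bsub>P\<^esub> N) #>\<^bsub>P\<^esub> b"
proof -
  interpret P: comm_group P by fact
  have sub: "U \<subseteq> carrier P" "N \<subseteq> carrier P"
    using assms(2,3) by (auto dest: subgroup.subset)
  have xn: "x \<otimes>\<^bsub>P\<^esub> n \<in> U <#>\<^bsub>P\<^esub> N" using assms(4,5) by (auto simp: set_mult_def)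
  have UN: "subgroup (U <#>\<^bsub>P\<^esub> N) P"
    by (rule P.mult_subgroups [OF assms(2,3)])
  have "(U <#>\<^bsub>P\<^esub> N) #>\<^bsub>P\<^esub> (x \<otimes>\<^bsub>P\<^esub> n) #>\<^bsub>P\<^esub> b = (U <#>\<^bsub>P\<^esub> N) #>\<^bsub>P\<^esub> (x \<otimes>\<^bsub>P\<^esub> n \<otimes>\<^bsub>P\<^esub> b)"
    using sub assms(4-6) subgroup.subset [OF UN] by (intro P.coset_mult_assoc) auto
  moreover have "(U <#>\<^bsub>P\<^esub> N) #>\<^bsub>P\<^esub> (x \<otimes>\<^bsub>P\<^esub> n) = U <#>\<^bsub>P\<^esub> N"
    using sub assms(4,5) by (intro P.coset_join2 UN xn) auto
  ultimately show ?thesis by simp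
qed

text \<open>The equation says that \<open>c\<close> and \<open>b\<close> agree modulo
  \<open>U N\<close>; applying \<open>h\<close> to \<open>c = x n b\<close> gives factors in
  \<open>U'\<close> and \<open>N'\<close>, which are absorbed. It is used with
  \<open>gam_prod\<close> for \<open>U\<close> and \<open>idele_kernel\<close> for
  \<open>N\<close>.\<close>

lemma coset_image_mod:
  assumes P: "comm_group P" and Q: "comm_group Q" and h: "h \<in> hom P Q"
    and U: "subgroup U P" and N: "subgroup N P" and U': "subgroup U' Q" and N': "subgroup N' Q"
    and hU: "h ` U \<subseteq> U'" and hN: "h ` N \<subseteq> N'"
    and c: "c \<in> carrier P" and b: "b \<in> carrier P"
    and eq: "U <#>\<^bsub>P\<^esub> (N #>\<^bsub>P\<^esub> c) = (U <#>\<^bsub>P\<^esub> N) #>\<^bsub>P\<^esub> b"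
  shows "U' <#>\<^bsub>Q\<^esub> (N' #>\<^bsub>Q\<^esub> h c) = (U' <#>\<^bsub>Q\<^esub> N') #>\<^bsub>Q\<^esub> h b"
proof -
  interpret P: comm_group P by fact
  interpret Q: comm_group Q by fact
  have sub: "U \<subseteq> carrier P" "N \<subseteq> carrier P" "U' \<subseteq> carrier Q" "N' \<subseteq> carrier Q"
    using U N U' N' by (auto dest: subgroup.subset)
  have "\<one>\<^bsub>P\<^esub> \<otimes>\<^bsub>P\<^esub> (\<one>\<^bsub>P\<^esub> \<otimes>\<^bsub>P\<^esub> c) \<in> U <#>\<^bsub>P\<^esub> (N #>\<^bsub>P\<^esub> c)"
    using subgroup.one_closed [OF U] subgroup.one_closed [OF N]
    unfolding set_mult_def r_coset_def by blast
  then have "c \<in> (U <#>\<^bsub>P\<^esub> N) #>\<^bsub>P\<^esub> b"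
    using c eq by simp
  then obtain x n where xn: "x \<in> U" "n \<in> N" "c = x \<otimes>\<^bsub>P\<^esub> n \<otimes>\<^bsub>P\<^esub> b"
    by (auto simp: set_mult_def r_coset_def)
  have hc: "h c = h x \<otimes>\<^bsub>Q\<^esub> h n \<otimes>\<^bsub>Q\<^esub> h b"
    using xn sub b by (simp add: hom_mult [OF h] subsetD)
  have car: "h c \<in> carrier Q" "h b \<in> carrier Q"
    using hom_in_carrier [OF h] b c by auto
  have "U' <#>\<^bsub>Q\<^esub> (N' #>\<^bsub>Q\<^esub> h c) = (U' <#>\<^bsub>Q\<^esub> N') #>\<^bsub>Q\<^esub> h c"
    by (rule Q.setmult_rcos_assoc [OF sub(3,4) car(1)])
  also have "\<dots> = (U' <#>\<^bsub>Q\<^esub> N') #>\<^bsub>Q\<^esub> h b"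
    unfolding hc using xn hU hN car by (intro subgroup_absorb_coset [OF Q U' N']) auto
  finally show ?thesis .
qed

lemma product_group_comm:
  assumes "\<And>i. i \<in> I \<Longrightarrow> comm_group (G i)"
  shows "comm_group (product_group I G)"
proof (rule group.group_comm_groupI)
  show "group (product_group I G)"
    using assms by (simp add: comm_group.axioms(2))
  show "x \<otimes>\<^bsub>product_group I G\<^esub> y = y \<otimes>\<^bsub>product_group I G\<^esub> x"
    if "x \<in> carrier (product_group I G)" "y \<in> carrier (product_group I G)" for x y
    using that assms by (auto intro!: restrict_ext comm_monoid.m_comm comm_group.axioms(1))
qed


section \<open>The action of \<open>q\<close> on \<open>big_group\<close>, \<open>gam_prod\<close>
  and \<open>idele_kernel\<close>\<close>

context galois_setup
begin

abbreviation "q_idele n c \<equiv> \<lambda>v\<in>plc D. q_map D (M v) n (c v)"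

lemma big_group_comm: "comm_group (big_group D n)"
  unfolding big_group_def by (rule product_group_comm) (rule group_algebra.Units_comm_group [OF loc_algebra])

lemma carrier_big_group: "carrier (big_group D n) = (\<Pi>\<^sub>E v\<in>plc D. Units (grp_alg (M v) (Gam D n)))"
  by (simp add: big_group_def units_of_carrier cong: PiE_cong)

lemma mult_big_group:
  "c \<otimes>\<^bsub>big_group D n\<^esub> d = (\<lambda>v\<in>plc D. c v \<otimes>\<^bsub>grp_alg (M v) (Gam D n)\<^esub> d v)"
  by (simp add: big_group_def units_of_mult)

text \<open>Gathers the push-forward facts with \<open>v\<close> as a parameter, so that they can be
  used pointwise in products over all places.\<close>

lemma q_unit:
  assumes "n \<ge> 1" "v \<in> plc D"
  shows "u \<in> Units (grp_alg (M v) (Gam D n)) \<Longrightarrow>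
      q_map D (M v) n u \<in> Units (grp_alg (M v) (Gam D (n - 1)))"
    and "u \<in> carrier (grp_alg (M v) (Gam D n)) \<Longrightarrow> w \<in> carrier (grp_alg (M v) (Gam D n)) \<Longrightarrow>
      q_map D (M v) n (u \<otimes>\<^bsub>grp_alg (M v) (Gam D n)\<^esub> w) =
      q_map D (M v) n u \<otimes>\<^bsub>grp_alg (M v) (Gam D (n - 1))\<^esub> q_map D (M v) n w"
    and "g \<in> carrier (Gam D n) \<Longrightarrow>
      q_map D (M v) n (grp_elem (M v) (Gam D n) g) = grp_elem (M v) (Gam D (n - 1)) (powp n g)"
    and "B \<subseteq> carrier (grp_alg (M v) (Gam D n)) \<Longrightarrow> q_map D (M v) n ` B \<subseteq> C \<Longrightarrow>
      u \<in> sub_units (M v) (Gam D n) B \<Longrightarrow> q_map D (M v) n u \<in> sub_units (M v) (Gam D (n - 1)) C"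
proof -
  interpret equivariant_hom "M v" "Gam D n" "Gam D (n - 1)" "powp n" "K v" "lact D v" "lact D v"
    by (rule loc_hom [OF assms])
  show "u \<in> Units (grp_alg (M v) (Gam D n)) \<Longrightarrow>
      q_map D (M v) n u \<in> Units (grp_alg (M v) (Gam D (n - 1)))"
    unfolding q_map_eq by (rule push_inv)
  show "u \<in> carrier (grp_alg (M v) (Gam D n)) \<Longrightarrow> w \<in> carrier (grp_alg (M v) (Gam D n)) \<Longrightarrow>
      q_map D (M v) n (u \<otimes>\<^bsub>grp_alg (M v) (Gam D n)\<^esub> w) =
      q_map D (M v) n u \<otimes>\<^bsub>grp_alg (M v) (Gam D (n - 1))\<^esub> q_map D (M v) n w"
    unfolding q_map_eq by (rule push_mult)
  show "g \<in> carrier (Gam D n) \<Longrightarrow>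
      q_map D (M v) n (grp_elem (M v) (Gam D n) g) = grp_elem (M v) (Gam D (n - 1)) (powp n g)"
    unfolding q_map_eq by (rule push_grp_elem)
  show "B \<subseteq> carrier (grp_alg (M v) (Gam D n)) \<Longrightarrow> q_map D (M v) n ` B \<subseteq> C \<Longrightarrow>
      u \<in> sub_units (M v) (Gam D n) B \<Longrightarrow> q_map D (M v) n u \<in> sub_units (M v) (Gam D (n - 1)) C"
    unfolding q_map_eq by (rule push_sub_units)
qed

lemma Units_carrier: "u \<in> Units R \<Longrightarrow> u \<in> carrier R"
  by (simp add: Units_def)

lemma q_idele_hom:
  assumes "n \<ge> 1"
  shows "q_idele n \<in> hom (big_group D n) (big_group D (n - 1))"
proof (rule homI)
  fix c d assume cd: "c \<in> carrier (big_group D n)" "d \<in> carrier (big_group D n)"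
  show "q_idele n c \<in> carrier (big_group D (n - 1))"
    using cd q_unit(1) [OF assms] by (auto simp: carrier_big_group)
  have "c v \<in> carrier (grp_alg (M v) (Gam D n))" "d v \<in> carrier (grp_alg (M v) (Gam D n))"
    if "v \<in> plc D" for v
    using cd that by (auto simp: carrier_big_group intro!: Units_carrier)
  then show "q_idele n (c \<otimes>\<^bsub>big_group D n\<^esub> d) = q_idele n c \<otimes>\<^bsub>big_group D (n - 1)\<^esub> q_idele n d"
    by (auto simp: mult_big_group q_unit(2) [OF assms] simp del: One_nat_def intro!: restrict_ext)
qed

lemma gam_prod_subgroup: "subgroup (gam_prod D n) (big_group D n)"
  unfolding gam_prod_def big_group_def
proof (subst PiE_subgroup_product_group)
  fix v assume v: "v \<in> plc D"
  interpret loc: group_algebra "M v" "Gam D n" by (rule loc_algebra [OF v])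
  show "group (units_of loc.A)"
    using loc.Units_comm_group by (rule comm_group.axioms(2))
next
  show "\<forall>v\<in>plc D. subgroup (grp_elem (M v) (Gam D n) ` carrier (Gam D n)) (units_of (grp_alg (M v) (Gam D n)))"
  proof
    fix v assume v: "v \<in> plc D"
    interpret loc: group_algebra "M v" "Gam D n" by (rule loc_algebra [OF v])
    have "group_hom (Gam D n) (units_of loc.A) (grp_elem (M v) (Gam D n))"
      by (intro group_hom.intro loc.grp.is_group comm_group.axioms(2) [OF loc.Units_comm_group]
          group_hom_axioms.intro homI)
        (auto simp: units_of_carrier units_of_mult loc.grp_elem_Units loc.grp_elem_mult)
    then show "subgroup (grp_elem (M v) (Gam D n) ` carrier (Gam D n)) (units_of loc.A)"
      by (rule group_hom.img_is_subgroup)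
  qed
qed

lemma q_gam_prod:
  assumes "n \<ge> 1"
  shows "q_idele n ` gam_prod D n \<subseteq> gam_prod D (n - 1)"
proof -
  have "q_idele n c v \<in> grp_elem (M v) (Gam D (n - 1)) ` carrier (Gam D (n - 1))"
    if c: "c \<in> gam_prod D n" and v: "v \<in> plc D" for c v
  proof -
    obtain g where "g \<in> carrier (Gam D n)" "c v = grp_elem (M v) (Gam D n) g"
      using c v by (auto simp: gam_prod_def PiE_iff)
    then show ?thesis
      using v q_unit(3) [OF assms v] hom_in_carrier [OF powp_hom [OF assms]] by simp
  qed
  then show ?thesis by (auto simp: gam_prod_def)
qed

lemma loc_units_subset:
  assumes "v \<in> plc D" "R \<subseteq> carrier (M v)" "B \<subseteq> carrier (grp_alg L (Gam D n))"
  shows "loc_units D n v R B \<subseteq> Units (grp_alg (M v) (Gam D n))"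
  unfolding loc_units_def
  by (rule group_algebra.sub_units_subset_Units [OF loc_algebra [OF assms(1)] loc_ext_subset [OF assms]])

lemma q_loc_units:
  assumes "n \<ge> 1" "v \<in> plc D" "R \<subseteq> carrier (M v)" "B \<subseteq> carrier (grp_alg L (Gam D n))"
    and "q_map D L n ` B \<subseteq> C" "u \<in> loc_units D n v R B"
  shows "q_map D (M v) n u \<in> loc_units D (n - 1) v R C"
  using q_unit(4) [OF assms(1,2) loc_ext_subset [OF assms(2-4)] q_loc_ext [OF assms(1-5)]] assms(6)
  by (simp add: loc_units_def)

lemma loc_units_subgroup:
  assumes "v \<in> plc D" "subring B (grp_alg L (Gam D n))"
  shows "subgroup (loc_units D n v (Ov D v) B) (units_of (grp_alg (M v) (Gam D n)))"
proof -
  interpret loc: group_algebra "M v" "Gam D n" by (rule loc_algebra [OF assms(1)])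
  note hom = to_local_hom [OF assms(1), of n]
  note B = subringE [OF assms(2)]
  have sub: "to_local D n v ` B \<subseteq> carrier loc.A"
    using ring_hom_closed [OF hom] B(1) by auto
  have one: "\<one>\<^bsub>loc.A\<^esub> \<in> to_local D n v ` B"
    using ring_hom_one [OF hom] B(3) by (metis imageI)
  have mult: "b \<otimes>\<^bsub>loc.A\<^esub> c \<in> to_local D n v ` B"
    if bc: "b \<in> to_local D n v ` B" "c \<in> to_local D n v ` B" for b c
  proof -
    obtain b' c' where bc': "b' \<in> B" "c' \<in> B" "b = to_local D n v b'" "c = to_local D n v c'"
      using bc by auto
    then have "b \<otimes>\<^bsub>loc.A\<^esub> c = to_local D n v (b' \<otimes>\<^bsub>grp_alg L (Gam D n)\<^esub> c')"
      using ring_hom_mult [OF hom, of b' c'] B(1) by (simp add: subsetD)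
    then show ?thesis using bc' B(6) by blast
  qed
  note Ov = Ov_subset [OF assms(1)]
  show ?thesis
    unfolding loc_units_def loc_ext_def
    by (rule loc.sub_units_subgroup)
      (use loc.span_over_subset [OF Ov sub] loc.span_over_one_closed [OF Ov_one [OF assms(1)] one]
        loc.span_over_mult_closed [OF Ov sub Ov_mult [OF assms(1)] mult] in auto)
qed

lemma diag_unit:
  assumes "a \<in> Units (grp_alg L (Gam D n))"
  shows "diag D n a \<in> carrier (big_group D n)"
proof -
  have "to_local D n v a \<in> Units (grp_alg (M v) (Gam D n))" if v: "v \<in> plc D" for v
  proof -
    interpret glob: group_algebra L "Gam D n" by (rule glob_algebra)
    interpret loc: group_algebra "M v" "Gam D n" by (rule loc_algebra [OF v])
    show ?thesis
      by (rule Units_hom_inv(1) [OF glob.monoid_axioms loc.monoid_axioms to_local_hom [OF v] assms])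
  qed
  then show ?thesis by (auto simp: carrier_big_group diag_def)
qed

lemma diag_hom: "diag D n \<in> hom (units_of (grp_alg L (Gam D n))) (big_group D n)"
proof (rule homI)
  fix a b assume "a \<in> carrier (units_of (grp_alg L (Gam D n)))" "b \<in> carrier (units_of (grp_alg L (Gam D n)))"
  then have "a \<in> carrier (grp_alg L (Gam D n))" "b \<in> carrier (grp_alg L (Gam D n))"
    by (auto simp: units_of_carrier intro: Units_carrier)
  then show "diag D n (a \<otimes>\<^bsub>units_of (grp_alg L (Gam D n))\<^esub> b) = diag D n a \<otimes>\<^bsub>big_group D n\<^esub> diag D n b"
    by (auto simp: diag_def mult_big_group units_of_mult ring_hom_mult [OF to_local_hom] intro!: restrict_ext)
qed (auto simp: units_of_carrier diag_unit)

lemma q_diag: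
  assumes "n \<ge> 1" "a \<in> carrier (grp_alg L (Gam D n))"
  shows "q_idele n (diag D n a) = diag D (n - 1) (q_map D L n a)"
  unfolding diag_def by (rule restrict_ext) (use q_to_local [OF assms(1) _ assms(2)] in simp)

text \<open>Each automorphism acts by a ring endomorphism, a push-forward after a coefficient map;
  its fixed points contain one and are closed under products.\<close>

lemma An_subring_closed:
  shows "\<one>\<^bsub>grp_alg L (Gam D n)\<^esub> \<in> An D n"
    and "a \<in> An D n \<Longrightarrow> b \<in> An D n \<Longrightarrow> a \<otimes>\<^bsub>grp_alg L (Gam D n)\<^esub> b \<in> An D n"
proof -
  interpret glob: group_algebra L "Gam D n" by (rule glob_algebra)
  have hom: "alg_act L (Gam D n) (act D) \<omega> \<in> ring_hom glob.A glob.A" if w: "\<omega> \<in> \<Omega>F D" for \<omega>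
  proof -
    have iso: "act D \<omega> \<in> iso (Gam D n) (Gam D n)" by (rule act_iso [OF w])
    have w': "\<omega> \<in> ring_hom L L" using w by (auto simp: \<Omega>F_def abs_gal_def ring_iso_def)
    interpret a: group_algebra_hom L "Gam D n" "Gam D n" "act D \<omega>"
      by (intro group_algebra_hom.intro glob_algebra group_algebra_hom_axioms.intro)
        (use iso in \<open>auto simp: iso_def\<close>)
    have bij: "bij_betw (act D \<omega>) (carrier (Gam D n)) (carrier (Gam D n))"
      using iso by (auto simp: iso_def)
    have "push L (Gam D n) (Gam D n) (act D \<omega>) \<circ> coeff_map (Gam D n) \<omega> \<in> ring_hom glob.A glob.A"
      by (rule ring_hom_trans [OF glob.coeff_map_ring_hom [OF L.is_cring w'] a.push_ring_hom])
    then show ?thesis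
      by (rule glob.ring_hom_restrict)
        (use glob.alg_act_eq_push [where \<rho> = "act D", OF w' bij] in simp)
  qed
  show "\<one>\<^bsub>grp_alg L (Gam D n)\<^esub> \<in> An D n"
    using ring_hom_one [OF hom] by (auto simp: An_def)
  show "a \<in> An D n \<Longrightarrow> b \<in> An D n \<Longrightarrow> a \<otimes>\<^bsub>grp_alg L (Gam D n)\<^esub> b \<in> An D n"
    using ring_hom_mult [OF hom] by (auto simp: An_def)
qed

lemma idele_kernel_subgroup:
  assumes "subring B (grp_alg L (Gam D n))"
  shows "subgroup (idele_kernel D n B) (big_group D n)"
proof -
  interpret B: comm_group "big_group D n" by (rule big_group_comm)
  interpret glob: group_algebra L "Gam D n" by (rule glob_algebra)
  have "subgroup (\<Pi>\<^sub>E v\<in>plc D. loc_units D n v (Ov D v) B) (big_group D n)"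
    unfolding big_group_def
    by (subst PiE_subgroup_product_group)
      (use loc_units_subgroup [OF _ assms] comm_group.axioms(2) [OF group_algebra.Units_comm_group [OF loc_algebra]] in auto)
  moreover have "subgroup (diag D n ` sub_units L (Gam D n) (An D n)) (big_group D n)"
    by (rule group_hom.subgroup_img_is_subgroup
        [OF group_hom.intro [OF comm_group.axioms(2) [OF glob.Units_comm_group] B.is_group
            group_hom_axioms.intro [OF diag_hom]]
          glob.sub_units_subgroup [OF An_subset An_subring_closed]])
  ultimately show ?thesis
    unfolding idele_kernel_def by (rule B.mult_subgroups)
qed

text \<open>Local units go to local units by \<open>q_loc_units\<close>, and principal ideles go to
  principal ideles because \<open>q\<close> commutes with \<open>diag\<close>.\<close>

lemma q_idele_kernel:
  assumes "n \<ge> 1" "B \<subseteq> carrier (grp_alg L (Gam D n))" "q_map D L n ` B \<subseteq> C"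
  shows "q_idele n ` idele_kernel D n B \<subseteq> idele_kernel D (n - 1) C"
proof -
  let ?U = "\<Pi>\<^sub>E v\<in>plc D. loc_units D n v (Ov D v) B"
  let ?V = "diag D n ` sub_units L (Gam D n) (An D n)"
  interpret glob: group_algebra L "Gam D n" by (rule glob_algebra)
  interpret equivariant_hom L "Gam D n" "Gam D (n - 1)" "powp n" F "act D" "act D"
    by (rule glob_hom [OF assms(1)])
  have An: "sub_units L (Gam D n) (An D n) \<subseteq> Units glob.A"
    by (rule glob.sub_units_subset_Units [OF An_subset])
  have "?U \<subseteq> carrier (big_group D n)"
    unfolding carrier_big_group
    by (rule PiE_mono) (use loc_units_subset [OF _ Ov_subset assms(2)] in auto)
  moreover have "?V \<subseteq> carrier (big_group D n)"
    using An diag_unit by auto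
  ultimately have "q_idele n ` idele_kernel D n B = q_idele n ` ?U <#>\<^bsub>big_group D (n - 1)\<^esub> q_idele n ` ?V"
    unfolding idele_kernel_def by (rule set_mult_hom [OF q_idele_hom [OF assms(1)]])
  moreover have "q_idele n ` ?U \<subseteq> (\<Pi>\<^sub>E v\<in>plc D. loc_units D (n - 1) v (Ov D v) C)"
    using q_loc_units [OF assms(1) _ Ov_subset assms(2,3)] by (auto simp: PiE_iff)
  moreover have "q_idele n ` ?V \<subseteq> diag D (n - 1) ` sub_units L (Gam D (n - 1)) (An D (n - 1))"
  proof -
    have "q_idele n (diag D n a) \<in> diag D (n - 1) ` sub_units L (Gam D (n - 1)) (An D (n - 1))"
      if a: "a \<in> sub_units L (Gam D n) (An D n)" for a
    proof -
      have "a \<in> carrier glob.A" using a An by (auto intro: Units_carrier)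
      then show ?thesis
        using q_diag [OF assms(1)] push_sub_units [OF An_subset q_An [OF assms(1), unfolded q_map_eq] a]
        by (simp add: q_map_eq del: One_nat_def)
    qed
    then show ?thesis by blast
  qed
  ultimately show ?thesis
    unfolding idele_kernel_def by (simp only: mono_set_mult)
qed

end

section \<open>Orders, finite ideles and the map of class groups\<close>

context galois_setup
begin

lemma OFint_subset: "OFint D \<subseteq> carrier L"
  using integral_closure_subset by (auto simp: OFint_def ring_of_integers_def)

lemma full_subalgebra_subset: "full_subalgebra D n B \<Longrightarrow> B \<subseteq> carrier (grp_alg L (Gam D n))"
  using An_subset by (auto simp: full_subalgebra_def)

lemma q_span_over:
  assumes "n \<ge> 1" "R \<subseteq> carrier L" "B \<subseteq> carrier (grp_alg L (Gam D n))"
  shows "q_map D L n ` span_over L (Gam D n) R B = span_over L (Gam D (n - 1)) R (q_map D L n ` B)"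
proof -
  interpret equivariant_hom L "Gam D n" "Gam D (n - 1)" "powp n" F "act D" "act D"
    by (rule glob_hom [OF assms(1)])
  show ?thesis unfolding q_map_eq by (rule push_span_over [OF assms(2,3)])
qed

text \<open>Images of generators generate the image. Surjectivity onto \<open>An D (n - 1)\<close>
  ensures that the image still spans the whole algebra over \<open>F\<close>.\<close>

lemma q_is_order:
  assumes "n \<ge> 1" "q_map D L n ` An D n = An D (n - 1)" "is_order D n B"
  shows "is_order D (n - 1) (q_map D L n ` B)"
proof -
  interpret equivariant_hom L "Gam D n" "Gam D (n - 1)" "powp n" F "act D" "act D"
    by (rule glob_hom [OF assms(1)])
  have B: "subring B dom.A" "B \<subseteq> An D n"
    "\<And>r b. r \<in> OFint D \<Longrightarrow> b \<in> B \<Longrightarrow> scal L (Gam D n) r b \<in> B"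
    "span_over L (Gam D n) F B = An D n"
    using assms(3) by (auto simp: is_order_def full_subalgebra_def)
  obtain S where S: "finite S" "S \<subseteq> B" "B = span_over L (Gam D n) (OFint D) S"
    using assms(3) by (auto simp: is_order_def)
  have B_sub: "B \<subseteq> carrier dom.A" using B(2) An_subset by blast
  interpret h: ring_hom_ring dom.A cod.A "q_map D L n"
    unfolding q_map_eq by (intro ring_hom_ringI2 dom.ring_axioms cod.ring_axioms push_ring_hom)
  have "scal L (Gam D (n - 1)) r (q_map D L n b) \<in> q_map D L n ` B"
    if "r \<in> OFint D" "b \<in> B" for r b
  proof -
    have "scal L (Gam D (n - 1)) r (q_map D L n b) = q_map D L n (scal L (Gam D n) r b)"
      using push_scal [of r b] that B_sub OFint_subset by (simp add: q_map_eq subsetD del: One_nat_def)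
    then show ?thesis using B(3) that by blast
  qed
  moreover have "q_map D L n ` B \<subseteq> An D (n - 1)"
    using B(2) assms(2) by blast
  moreover have "span_over L (Gam D (n - 1)) F (q_map D L n ` B) = An D (n - 1)"
    using q_span_over [OF assms(1) F_subset B_sub] B(4) assms(2) by simp
  ultimately have "full_subalgebra D (n - 1) (q_map D L n ` B)"
    using h.img_is_subring [OF B(1)] by (auto simp: full_subalgebra_def simp del: One_nat_def)
  moreover have "q_map D L n ` B = span_over L (Gam D (n - 1)) (OFint D) (q_map D L n ` S)"
    using q_span_over [OF assms(1) OFint_subset, of S] S B_sub by auto
  ultimately show ?thesis
    using S(1,2) unfolding is_order_def by (intro conjI exI [of _ "q_map D L n ` S"]) auto
qed

lemma max_order_subset: "max_order D n \<subseteq> carrier (grp_alg L (Gam D n))"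
  using full_subalgebra_subset by (auto simp: max_order_def is_order_def)

text \<open>\<open>max_order\<close> is by definition the union of all orders, so it suffices that
  \<open>q\<close> sends each order to an order.\<close>

lemma q_max_order:
  assumes "n \<ge> 1" "q_map D L n ` An D n = An D (n - 1)"
  shows "q_map D L n ` max_order D n \<subseteq> max_order D (n - 1)"
  using q_is_order [OF assms] by (auto simp: max_order_def)

lemma finite_ideles_subset: "finite_ideles D n \<subseteq> carrier (big_group D n)"
proof
  fix c assume "c \<in> finite_ideles D n"
  then show "c \<in> carrier (big_group D n)"
    using loc_units_subset [OF _ K_subset An_subset]
    by (auto simp: finite_ideles_def carrier_big_group PiE_iff subset_iff)
qed

text \<open>The exceptional places of the image are among those of \<open>c\<close>.\<close>

lemma q_finite_ideles:
  assumes "n \<ge> 1" "q_map D L n ` An D n = An D (n - 1)" "c \<in> finite_ideles D n"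
  shows "q_idele n c \<in> finite_ideles D (n - 1)"
proof -
  have c: "c v \<in> loc_units D n v (K v) (An D n)" if "v \<in> plc D" for v
    using assms(3) that by (auto simp: finite_ideles_def)
  have fin: "finite {v \<in> plc D. c v \<notin> loc_units D n v (Ov D v) (max_order D n)}"
    using assms(3) by (simp add: finite_ideles_def)
  have "q_idele n c \<in> (\<Pi>\<^sub>E v\<in>plc D. loc_units D (n - 1) v (K v) (An D (n - 1)))"
    using q_loc_units [OF assms(1) _ K_subset An_subset q_An [OF assms(1)] c] by auto
  moreover have "{v \<in> plc D. q_idele n c v \<notin> loc_units D (n - 1) v (Ov D v) (max_order D (n - 1))} \<subseteq>
      {v \<in> plc D. c v \<notin> loc_units D n v (Ov D v) (max_order D n)}"
    using q_loc_units [OF assms(1) _ Ov_subset max_order_subset q_max_order [OF assms(1,2)]] by auto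
  ultimately show ?thesis
    using finite_subset [OF _ fin] by (simp add: finite_ideles_def)
qed

lemma pD_map_coset:
  assumes "n \<ge> 1" "subring B (grp_alg L (Gam D n))" "subring C (grp_alg L (Gam D (n - 1)))"
    and "q_map D L n ` B \<subseteq> C" "c \<in> carrier (big_group D n)"
  shows "pD_map D n C (idele_kernel D n B #>\<^bsub>big_group D n\<^esub> c) =
    idele_kernel D (n - 1) C #>\<^bsub>big_group D (n - 1)\<^esub> q_idele n c"
  unfolding pD_map_def
  by (rule coset_image [OF comm_group.axioms(2) [OF big_group_comm] comm_group.axioms(2) [OF big_group_comm]
        q_idele_hom [OF assms(1)] idele_kernel_subgroup [OF assms(2)] idele_kernel_subgroup [OF assms(3)]
        q_idele_kernel [OF assms(1) subringE(1) [OF assms(2)] assms(4)] assms(5)])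

text \<open>The choices made for \<open>x\<close> are transported by \<open>q\<close>, so the
  statement holds for every \<open>C\<close> related to \<open>x\<close> and needs no uniqueness of
  \<open>C\<close>.\<close>

lemma is_phi_pD_map:
  assumes "n \<ge> 1" "full_subalgebra D n B" "full_subalgebra D (n - 1) B'"
    and qB: "q_map D L n ` B = B'"
    and x: "x \<in> H1_order D n B" and phi: "is_phi D n B x C"
  shows "is_phi D (n - 1) B' (p_map D n x) (pD_map D n B' C)"
proof -
  let ?P = "big_group D n" and ?Q = "big_group D (n - 1)"
  let ?N = "idele_kernel D n B" and ?N' = "idele_kernel D (n - 1) B'"
  interpret P: comm_group ?P by (rule big_group_comm)
  interpret Q: comm_group ?Q by (rule big_group_comm)
  interpret glob: group_algebra L "Gam D n" by (rule glob_algebra)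
  have subring: "subring B glob.A" "subring B' (grp_alg L (Gam D (n - 1)))"
    using assms(2,3) by (auto simp: full_subalgebra_def)
  note B = full_subalgebra_subset [OF assms(2)]
  have qB': "q_map D L n ` B \<subseteq> B'" using qB by simp
  \<comment> \<open>Here surjectivity onto \<open>B'\<close> enters: taking \<open>F\<close>-spans,
    it gives surjectivity onto \<open>An D (n - 1)\<close>, as needed for maximal orders and finite
    ideles.\<close>
  have "q_map D L n ` An D n = span_over L (Gam D (n - 1)) F (q_map D L n ` B)"
    using q_span_over [OF assms(1) F_subset B] assms(2) by (simp add: full_subalgebra_def)
  then have qAn: "q_map D L n ` An D n = An D (n - 1)"
    using assms(3) qB by (simp add: full_subalgebra_def)
  obtain \<alpha> \<beta> where \<alpha>: "\<alpha> \<in> HH_glob D n" "cls_glob D n \<alpha> = x"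
    and \<beta>: "\<beta> \<in> (\<Pi>\<^sub>E v\<in>plc D. HH_loc D n B v)"
      "\<And>v. v \<in> plc D \<Longrightarrow> cls_loc D n v (\<beta> v) = localize D n v x"
    and eq: "gam_prod D n <#>\<^bsub>?P\<^esub> C =
      (gam_prod D n <#>\<^bsub>?P\<^esub> ?N) #>\<^bsub>?P\<^esub> (\<beta> \<otimes>\<^bsub>?P\<^esub> inv\<^bsub>?P\<^esub> (diag D n \<alpha>))"
    using phi by (auto simp: is_phi_def)
  \<comment> \<open>\<open>c\<close> is a genuine finite idele; the family built from
    \<open>\<beta>\<close> and \<open>\<alpha>\<close> is only treated as an element of
    \<open>big_group\<close>, tied to \<open>c\<close> by \<open>eq\<close>.\<close>
  obtain c where c: "c \<in> finite_ideles D n" "C = ?N #>\<^bsub>?P\<^esub> c"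
    using phi by (auto simp: is_phi_def Cl_def carrier_FactGroup)
  have cP: "c \<in> carrier ?P" using c(1) finite_ideles_subset by blast
  have \<alpha>U: "\<alpha> \<in> Units glob.A"
    using glob.HH_subset_Units [OF An_subset] \<alpha>(1) unfolding HH_glob_def by blast
  have \<beta>P: "\<beta> \<in> carrier ?P"
  proof -
    have "\<beta> v \<in> Units (grp_alg (M v) (Gam D n))" if v: "v \<in> plc D" for v
      using group_algebra.HH_subset_Units [OF loc_algebra [OF v] loc_ext_subset [OF v Ov_subset [OF v] B]]
        PiE_mem [OF \<beta>(1) v] unfolding HH_loc_def by blast
    then show ?thesis using \<beta>(1) by (auto simp: carrier_big_group PiE_iff)
  qed
  note dP = diag_unit [OF \<alpha>U]
  have pD: "pD_map D n B' C = ?N' #>\<^bsub>?Q\<^esub> q_idele n c"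
    unfolding c(2) by (rule pD_map_coset [OF assms(1) subring qB' cP])
  have "pD_map D n B' C \<in> carrier (Cl D (n - 1) B')"
    unfolding pD using q_finite_ideles [OF assms(1) qAn c(1)]
    by (auto simp: Cl_def carrier_FactGroup)
  moreover have "q_idele n \<beta> \<in> (\<Pi>\<^sub>E v\<in>plc D. HH_loc D (n - 1) B' v)"
    "\<forall>v\<in>plc D. cls_loc D (n - 1) v (q_idele n \<beta> v) = localize D (n - 1) v (p_map D n x)"
  proof -
    have xH: "x \<in> carrier (H1F D n)" using x by (simp add: H1_order_def)
    note loc = q_HH_loc [OF assms(1) _ xH B qB' PiE_mem [OF \<beta>(1)] \<beta>(2)]
    show "q_idele n \<beta> \<in> (\<Pi>\<^sub>E v\<in>plc D. HH_loc D (n - 1) B' v)" using loc(1) by auto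
    show "\<forall>v\<in>plc D. cls_loc D (n - 1) v (q_idele n \<beta> v) = localize D (n - 1) v (p_map D n x)"
      using loc(2) by simp
  qed
  moreover have "gam_prod D (n - 1) <#>\<^bsub>?Q\<^esub> pD_map D n B' C =
      (gam_prod D (n - 1) <#>\<^bsub>?Q\<^esub> ?N') #>\<^bsub>?Q\<^esub>
        (q_idele n \<beta> \<otimes>\<^bsub>?Q\<^esub> inv\<^bsub>?Q\<^esub> (diag D (n - 1) (q_map D L n \<alpha>)))"
  proof -
    interpret h: group_hom ?P ?Q "q_idele n"
      by (intro group_hom.intro P.is_group Q.is_group group_hom_axioms.intro q_idele_hom [OF assms(1)])
    have "q_idele n (\<beta> \<otimes>\<^bsub>?P\<^esub> inv\<^bsub>?P\<^esub> (diag D n \<alpha>)) =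
        q_idele n \<beta> \<otimes>\<^bsub>?Q\<^esub> inv\<^bsub>?Q\<^esub> (q_idele n (diag D n \<alpha>))"
      using h.hom_mult [OF \<beta>P P.inv_closed [OF dP]] h.hom_inv [OF dP] by argo
    also have "q_idele n (diag D n \<alpha>) = diag D (n - 1) (q_map D L n \<alpha>)"
      by (rule q_diag [OF assms(1) Units_carrier [OF \<alpha>U]])
    finally have hb: "q_idele n (\<beta> \<otimes>\<^bsub>?P\<^esub> inv\<^bsub>?P\<^esub> (diag D n \<alpha>)) =
        q_idele n \<beta> \<otimes>\<^bsub>?Q\<^esub> inv\<^bsub>?Q\<^esub> (diag D (n - 1) (q_map D L n \<alpha>))" .
    show ?thesis
      unfolding pD hb [symmetric]
      by (rule coset_image_mod [OF big_group_comm big_group_comm q_idele_hom [OF assms(1)]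
            gam_prod_subgroup idele_kernel_subgroup [OF subring(1)]
            gam_prod_subgroup idele_kernel_subgroup [OF subring(2)]
            q_gam_prod [OF assms(1)] q_idele_kernel [OF assms(1) B qB'] cP
            P.m_closed [OF \<beta>P P.inv_closed [OF dP]] eq [unfolded c(2)]])
  qed
  ultimately show ?thesis
    unfolding is_phi_def
    using q_HH_glob(1) [OF assms(1) \<alpha>(1)] q_HH_glob(2) [OF assms(1) \<alpha>(1), unfolded \<alpha>(2)] by blast
qed

end

theorem theorem4p2:
  fixes D :: "('c, 'l, 't) galois_data"
    and \<AA> :: "nat \<Rightarrow> ('t gam \<Rightarrow> 'c) set"
    and n :: nat
    and x :: "(('c \<Rightarrow> 'c) \<Rightarrow> 't gam) set"
  assumes "galois_setting D"
    and "\<And>m. m \<ge> 1 \<Longrightarrow> full_subalgebra D m (\<AA> m)"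
    and "\<And>m. m \<ge> 2 \<Longrightarrow> q_map D (clos D) m ` \<AA> m = \<AA> (m - 1)"
    and "n \<ge> 2"
    and "x \<in> H1_order D n (\<AA> n)"
  shows "p_map D n x \<in> H1_order D (n - 1) (\<AA> (n - 1)) \<and>
    (\<forall>C. is_phi D n (\<AA> n) x C \<longrightarrow>
       is_phi D (n - 1) (\<AA> (n - 1)) (p_map D n x) (pD_map D n (\<AA> (n - 1)) C)) \<and>
    (phi_well_defined D n (\<AA> n) \<and> phi_well_defined D (n - 1) (\<AA> (n - 1)) \<longrightarrow>
       phi D (n - 1) (\<AA> (n - 1)) (p_map D n x) = pD_map D n (\<AA> (n - 1)) (phi D n (\<AA> n) x))"
proof -
  interpret galois_setup D by (rule galois_setup.intro [OF assms(1)])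
  \<comment> \<open>The second bound makes level \<open>n - 1\<close> one of those where a full
    subalgebra is given.\<close>
  have n: "n \<ge> 1" "n - 1 \<ge> 1" using assms(4) by auto
  note full = assms(2) [OF n(1)] assms(2) [OF n(2)] and q = assms(3) [OF assms(4)]
  have mem: "p_map D n x \<in> H1_order D (n - 1) (\<AA> (n - 1))"
    by (rule p_map_H1_order [OF n(1) full_subalgebra_subset [OF full(1)] _ assms(5)]) (simp add: q)
  have phi: "is_phi D (n - 1) (\<AA> (n - 1)) (p_map D n x) (pD_map D n (\<AA> (n - 1)) C)"
    if "is_phi D n (\<AA> n) x C" for C
    by (rule is_phi_pD_map [OF n(1) full q assms(5) that])
  have "phi D (n - 1) (\<AA> (n - 1)) (p_map D n x) = pD_map D n (\<AA> (n - 1)) (phi D n (\<AA> n) x)"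
    if wd: "phi_well_defined D n (\<AA> n)" "phi_well_defined D (n - 1) (\<AA> (n - 1))"
  proof -
    \<comment> \<open>Uniqueness at level \<open>n\<close> makes the \<open>THE\<close> in
      \<open>phi\<close> a related class; its image is then related to \<open>p_map D n x\<close>,
      and uniqueness at level \<open>n - 1\<close> identifies it with \<open>phi\<close>
      there.\<close>
    have "is_phi D n (\<AA> n) x (phi D n (\<AA> n) x)"
      unfolding phi_def by (rule theI') (use wd(1) assms(5) in \<open>simp add: phi_well_defined_def\<close>)
    moreover have "\<exists>!C. is_phi D (n - 1) (\<AA> (n - 1)) (p_map D n x) C"
      using wd(2) mem by (simp add: phi_well_defined_def)
    ultimately show ?thesis
      unfolding phi_def [of D "n - 1"] by (intro the1_equality phi)
  qed
  then show ?thesis using mem phi by blast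
qed

end
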